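(* Let $I=(-1,1)$, $\beta>0$, $y_d\in L_2(I)$, $f\in H^1(I)$, and let $\psi\in H^2(I)$ satisfy $\int_I\psi\,dx>0$. Let $\bar y$ be the unique minimizer of $\frac12\big(\|y-y_d\|_{L_2(I)}^2+\beta\|y''+f\|_{L_2(I)}^2\big)$ over $$K=\{y\in H^2(I)\cap H^1_0(I):\ y'\leq\psi\ \text{on}\ I\},$$ and let $\bar u=-(\bar y''+f)$. For a partition $\mathcal{T}_h$ of $I$ with mesh size $h$, let $\bar y_h$ be the unique minimizer of $\frac12\big(\|y_h-y_d\|_{L_2(I)}^2+\beta\|y_h''+f\|_{L_2(I)}^2\big)$ over $$K_h=\{y_h\in V_h:\ P_hy_h'\leq P_h\psi\ \text{on}\ I\},$$ and let $\bar u_h=-(\bar y_h''+f)$. Then there exists a positive constant $C$, independent of the mesh size $h$, such that $$|\bar y-\bar y_h|_{H^1(I)}+\|\bar u-\bar u_h\|_{L_2(I)}\leq Ch.$$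
   Context: $H^k(I)$ and $H^1_0(I)$ are the usual real-valued $L_2$-based Sobolev spaces, and $|v|_{H^1(I)}=\|v'\|_{L_2(I)}$. For a partition $\mathcal{T}_h$ of $[-1,1]$ into finitely many subintervals, the mesh size $h$ is the maximal length of the subintervals. $V_h\subset H^2(I)\cap H^1_0(I)$ is the cubic Hermite finite element space associated with $\mathcal{T}_h$, i.e. the space of all $C^1$ functions on $[-1,1]$ that are polynomials of degree at most $3$ on each subinterval of $\mathcal{T}_h$ and vanish at $\pm1$. $P_h$ is the nodal interpolation operator onto the continuous piecewise linear ($P_1$) finite element space associated with $\mathcal{T}_h$: for continuous $\zeta$ on $[-1,1]$, $P_h\zeta$ is the continuous function that is affine on each subinterval and agrees with $\zeta$ at all grid points, including $\pm1$. Thus the constraint $P_hy_h'\leq P_h\psi$ means $y_h'\leq\psi$ at all grid points. The constant $C$ may depend on the data $\beta,y_d,f,\psi$ (and on $\bar y$), but not on $h$. *)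

theory Defs
  imports "HOL-Analysis.Analysis" "HOL-Computational_Algebra.Polynomial"
begin

text \<open>
  Elements of Lebesgue and Sobolev spaces on \<open>I = (-1,1)\<close> are represented by functions
  \<open>real \<Rightarrow> real\<close>, of which only the values almost everywhere in \<open>I\<close> matter. Where point values
  are used (nodal interpolation), the continuous representative on \<open>[-1,1]\<close> has to be supplied.
\<close>

abbreviation leb_I :: "real measure" where
  "leb_I \<equiv> lebesgue_on {-1<..<1}"

definition L2 :: "(real \<Rightarrow> real) set" where
  "L2 = {v. v \<in> borel_measurable leb_I \<and> integrable leb_I (\<lambda>x. (v x)\<^sup>2)}"

definition L2_norm :: "(real \<Rightarrow> real) \<Rightarrow> real" where
  "L2_norm v = sqrt (LINT x|leb_I. (v x)\<^sup>2)"


subsection \<open>Sobolev spaces\<close>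

definition test_fun :: "(real \<Rightarrow> real) \<Rightarrow> bool" where
  "test_fun \<phi> \<longleftrightarrow>
     (\<forall>k. (deriv ^^ k) \<phi> differentiable_on UNIV) \<and>
     compact (closure {x. \<phi> x \<noteq> 0}) \<and> closure {x. \<phi> x \<noteq> 0} \<subseteq> {-1<..<1}"

definition has_weak_deriv :: "(real \<Rightarrow> real) \<Rightarrow> (real \<Rightarrow> real) \<Rightarrow> bool" where
  "has_weak_deriv v g \<longleftrightarrow> v \<in> L2 \<and> g \<in> L2 \<and>
     (\<forall>\<phi>. test_fun \<phi> \<longrightarrow> (LINT x|leb_I. v x * deriv \<phi> x) = - (LINT x|leb_I. g x * \<phi> x))"

text \<open>The weak derivative is unique only up to null sets. It is used below only inside \<open>L\<^sub>2\<close> norms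
  and in almost-everywhere statements, which do not depend on the choice.\<close>

definition weak_deriv :: "(real \<Rightarrow> real) \<Rightarrow> real \<Rightarrow> real" where
  "weak_deriv v = (SOME g. has_weak_deriv v g)"

primrec Sobolev :: "nat \<Rightarrow> (real \<Rightarrow> real) set" where
  "Sobolev 0 = L2"
| "Sobolev (Suc k) = {v. \<exists>g \<in> Sobolev k. has_weak_deriv v g}"

definition H1_seminorm :: "(real \<Rightarrow> real) \<Rightarrow> real" where
  "H1_seminorm v = L2_norm (weak_deriv v)"

definition H1_norm :: "(real \<Rightarrow> real) \<Rightarrow> real" where
  "H1_norm v = sqrt ((L2_norm v)\<^sup>2 + (H1_seminorm v)\<^sup>2)"

text \<open>The closure of the test functions in \<open>H\<^sup>1(I)\<close>.\<close>

definition H10 :: "(real \<Rightarrow> real) set" where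
  "H10 = {v \<in> Sobolev 1. \<forall>e>0. \<exists>\<phi>. test_fun \<phi> \<and> H1_norm (\<lambda>x. v x - \<phi> x) < e}"


subsection \<open>The continuous problem\<close>

definition cost :: "real \<Rightarrow> (real \<Rightarrow> real) \<Rightarrow> (real \<Rightarrow> real) \<Rightarrow> (real \<Rightarrow> real) \<Rightarrow> real" where
  "cost \<beta> y\<^sub>d f y = 1/2 * ((L2_norm (\<lambda>x. y x - y\<^sub>d x))\<^sup>2
     + \<beta> * (L2_norm (\<lambda>x. weak_deriv (weak_deriv y) x + f x))\<^sup>2)"

text \<open>Both sides of the constraint have continuous representatives, for which the inequality
  almost everywhere is the same as the inequality everywhere in \<open>I\<close>.\<close>

definition K :: "(real \<Rightarrow> real) \<Rightarrow> (real \<Rightarrow> real) set" where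
  "K \<psi> = {y \<in> Sobolev 2 \<inter> H10. AE x in leb_I. weak_deriv y x \<le> \<psi> x}"

definition control :: "(real \<Rightarrow> real) \<Rightarrow> (real \<Rightarrow> real) \<Rightarrow> real \<Rightarrow> real" where
  "control f y = (\<lambda>x. - (weak_deriv (weak_deriv y) x + f x))"


subsection \<open>The discrete problem\<close>

text \<open>The grid points are \<open>x 0, \<dots>, x n\<close>; the values \<open>x i\<close> for \<open>i > n\<close> are irrelevant.\<close>

definition grid :: "nat \<Rightarrow> (nat \<Rightarrow> real) \<Rightarrow> bool" where
  "grid n x \<longleftrightarrow> 0 < n \<and> x 0 = -1 \<and> x n = 1 \<and> (\<forall>i<n. x i < x (Suc i))"

definition mesh_size :: "nat \<Rightarrow> (nat \<Rightarrow> real) \<Rightarrow> real" where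
  "mesh_size n x = Max ((\<lambda>i. x (Suc i) - x i) ` {..<n})"

text \<open>Classical derivative on \<open>[-1,1]\<close>, one-sided at the endpoints.\<close>

definition cderiv :: "(real \<Rightarrow> real) \<Rightarrow> real \<Rightarrow> real" where
  "cderiv v t = vector_derivative v (at t within {-1..1})"

definition V :: "nat \<Rightarrow> (nat \<Rightarrow> real) \<Rightarrow> (real \<Rightarrow> real) set" where
  "V n x = {v. v differentiable_on {-1..1} \<and> continuous_on {-1..1} (cderiv v) \<and>
     (\<forall>i<n. \<exists>p :: real poly. degree p \<le> 3 \<and> (\<forall>t\<in>{x i..x (Suc i)}. v t = poly p t)) \<and>
     v (-1) = 0 \<and> v 1 = 0}"

definition is_P1_interpolant ::
    "nat \<Rightarrow> (nat \<Rightarrow> real) \<Rightarrow> (real \<Rightarrow> real) \<Rightarrow> (real \<Rightarrow> real) \<Rightarrow> bool" where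
  "is_P1_interpolant n x \<zeta> g \<longleftrightarrow> continuous_on {-1..1} g \<and>
     (\<forall>i<n. \<exists>a b. \<forall>t\<in>{x i..x (Suc i)}. g t = a + b * t) \<and>
     (\<forall>i\<le>n. g (x i) = \<zeta> (x i))"

text \<open>Determined on \<open>[-1,1]\<close>; the values outside are arbitrary and never used.\<close>

definition P1_interp :: "nat \<Rightarrow> (nat \<Rightarrow> real) \<Rightarrow> (real \<Rightarrow> real) \<Rightarrow> real \<Rightarrow> real" where
  "P1_interp n x \<zeta> = (SOME g. is_P1_interpolant n x \<zeta> g)"

definition K_discrete :: "nat \<Rightarrow> (nat \<Rightarrow> real) \<Rightarrow> (real \<Rightarrow> real) \<Rightarrow> (real \<Rightarrow> real) set" where
  "K_discrete n x \<psi> = {v \<in> V n x.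
     \<forall>t\<in>{-1<..<1}. P1_interp n x (cderiv v) t \<le> P1_interp n x \<psi> t}"

end

theory Submission
  imports Defs
begin

text \<open>Everything is expressed through the slope \<open>p = y'\<close>. With \<open>prim\<close> the primitive that vanishes at
  \<open>-1\<close>, a state is \<open>y = prim p\<close>, the boundary conditions become \<open>\<integral> p = 0\<close>, the constraint becomes
  \<open>p \<le> \<psi>\<close>, and the problem is an obstacle problem for \<open>p\<close> in \<open>H\<^sup>1\<close> with natural boundary conditions
  and one scalar side condition. Finite element states correspond to continuous piecewise quadratic
  slopes.

  Since \<open>\<integral> \<psi> > 0\<close>, the gap \<open>d = \<psi> - p\<close> has positive mean, and a multiple of \<open>d\<close> can restore the mean
  of any other direction. Hence the side condition is removed by an explicit scalar, and the
  derivative of the cost yields a linear functional \<open>\<Lambda>\<close> (\<open>multiplier\<close>) on \<open>H\<^sup>1\<close> with \<open>\<Lambda> q \<ge> 0\<close> for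
  \<open>q \<ge> 0\<close> and \<open>\<Lambda> d = 0\<close>. For \<open>q\<close> vanishing at the end points, \<open>\<Lambda> q = - \<integral> M q'\<close>, where \<open>M\<close> (\<open>stress\<close>)
  differs from \<open>\<beta> p'\<close> by a function with square integrable derivative, and \<open>d' = B - M / \<beta>\<close> with
  \<open>B\<close> (\<open>load\<close>) in \<open>H\<^sup>1\<close>.

  Regularity is a Lewy--Stampacchia inequality, \<open>0 \<le> \<Lambda> q \<le> \<beta> \<integral> \<bar>B'\<bar> q\<close> for \<open>q \<ge> 0\<close> vanishing at the end
  points (\<open>multiplier_le_load\<close>): testing with \<open>q (1 - d / D)\<^sup>N\<close> and letting \<open>N\<close> grow localises \<open>\<Lambda>\<close> to
  the contact set, where \<open>d' = 0\<close>. It says that \<open>M' \<in> L\<^sub>2\<close>, that is \<open>p \<in> H\<^sup>2\<close>. What is used of this is the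
  dual form \<open>local_osc\<close>, an estimate of \<open>\<integral> M m\<close> for \<open>m\<close> of mean zero supported in a short interval. It
  holds for \<open>M\<close>, \<open>p'\<close> and \<open>d'\<close>, and makes their distance to piecewise constants \<open>O(h)\<close>.

  For the error estimate let \<open>p\<^sub>I\<close> be the continuous piecewise quadratic that agrees with \<open>p\<close> at the nodes
  and whose derivative is the cellwise \<open>L\<^sub>2\<close> projection of \<open>p'\<close> onto affine functions; its primitive
  is the Hermite interpolant of \<open>y\<close> and is admissible for the discrete problem. Comparing the two variational
  inequalities bounds the squared error by \<open>O(h)\<close> times the error plus \<open>\<Lambda> (p\<^sub>h - p\<^sub>I)\<close>. At the nodes
  \<open>p\<^sub>h - p\<^sub>I \<le> \<psi> - p = d\<close>, so the piecewise linear interpolant of \<open>d - (p\<^sub>h - p\<^sub>I)\<close> is nonnegative, and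
  together with \<open>\<Lambda> d = 0\<close> only interpolation errors remain. These vanish at the nodes, hence
  \<open>\<Lambda>\<close> of them is a pairing of two functions orthogonal to piecewise constants, one of which is \<open>M\<close>; the
  pairing is \<open>O(h) (h + error)\<close> (\<open>multiplier_le_nodal\<close>). A quadratic inequality for the error results
  (\<open>discrete_error\<close>), and the Poincare inequality bounds the \<open>H\<^sup>1\<close> seminorm of the state error.\<close>

section \<open>Square integrable functions and their primitives\<close>

lemma leb_I_measurable_borel: "f \<in> borel_measurable borel \<Longrightarrow> f \<in> borel_measurable leb_I"
  by (intro measurable_restrict_space1 measurable_completion) simp

lemma leb_I_measurable_continuous:
  assumes "continuous_on {-1..1} F" shows "F \<in> borel_measurable leb_I"
  by (intro continuous_imp_measurable_on_sets_lebesgue continuous_on_subset[OF assms]) auto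

lemma finite_measure_leb_I: "finite_measure leb_I"
  by (rule finite_measure_lebesgue_on) (simp add: lmeasurable_iff_integrable)

interpretation leb_I: finite_measure leb_I
  by (rule finite_measure_leb_I)

lemma measure_leb_I [simp]: "measure leb_I {-1<..<1} = 2"
  by (simp add: measure_restrict_space)

named_theorems L2_intros

lemma L2_I: "u \<in> borel_measurable leb_I \<Longrightarrow> integrable leb_I (\<lambda>x. (u x)\<^sup>2) \<Longrightarrow> u \<in> L2"
  by (simp add: L2_def)

lemma L2_measurable: "u \<in> L2 \<Longrightarrow> u \<in> borel_measurable leb_I"
  by (simp add: L2_def)

lemma L2_square_integrable: "u \<in> L2 \<Longrightarrow> integrable leb_I (\<lambda>x. (u x)\<^sup>2)"
  by (simp add: L2_def)

lemma abs_mult_le_squares: "\<bar>a * b\<bar> \<le> a\<^sup>2 + (b::real)\<^sup>2"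
proof -
  have "0 \<le> (\<bar>a\<bar> - \<bar>b\<bar>)\<^sup>2" by simp
  then have "2 * \<bar>a * b\<bar> \<le> a\<^sup>2 + b\<^sup>2"
    by (simp add: power2_diff abs_mult)
  then show ?thesis by linarith
qed

lemma L2_mult_integrable:
  assumes "u \<in> L2" "v \<in> L2" shows "integrable leb_I (\<lambda>x. u x * v x)"
proof (rule Bochner_Integration.integrable_bound)
  show "integrable leb_I (\<lambda>x. (u x)\<^sup>2 + (v x)\<^sup>2)"
    using assms by (simp add: L2_square_integrable)
  show "(\<lambda>x. u x * v x) \<in> borel_measurable leb_I"
    using assms by (intro borel_measurable_times L2_measurable)
  show "AE x in leb_I. norm (u x * v x) \<le> norm ((u x)\<^sup>2 + (v x)\<^sup>2)"
    by (intro AE_I2) (use abs_mult_le_squares in simp)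
qed

lemma L2_const [L2_intros]: "(\<lambda>x. c) \<in> L2"
  by (simp add: L2_def)

lemma L2_integrable: "u \<in> L2 \<Longrightarrow> integrable leb_I u"
  using L2_mult_integrable[of u "\<lambda>x. 1"] by (simp add: L2_const)

lemma L2_mult_bounded:
  assumes "u \<in> L2" "b \<in> borel_measurable leb_I" "\<And>x. x \<in> {-1<..<1} \<Longrightarrow> \<bar>b x\<bar> \<le> C"
  shows "(\<lambda>x. u x * b x) \<in> L2" "(\<lambda>x. b x * u x) \<in> L2"
proof -
  show *: "(\<lambda>x. u x * b x) \<in> L2"
  proof (rule L2_I)
    show m: "(\<lambda>x. u x * b x) \<in> borel_measurable leb_I"
      using assms L2_measurable by simp
    show "integrable leb_I (\<lambda>x. (u x * b x)\<^sup>2)"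
    proof (rule Bochner_Integration.integrable_bound)
      show "integrable leb_I (\<lambda>x. C\<^sup>2 * (u x)\<^sup>2)" using assms by (simp add: L2_square_integrable)
      show "(\<lambda>x. (u x * b x)\<^sup>2) \<in> borel_measurable leb_I" using m by simp
      show "AE x in leb_I. norm ((u x * b x)\<^sup>2) \<le> norm (C\<^sup>2 * (u x)\<^sup>2)"
      proof (intro AE_I2)
        fix x assume "x \<in> space leb_I"
        then have "\<bar>b x\<bar> \<le> C" using assms(3) by simp
        then have "(b x)\<^sup>2 \<le> C\<^sup>2" by (metis abs_ge_zero power2_abs power_mono)
        then show "norm ((u x * b x)\<^sup>2) \<le> norm (C\<^sup>2 * (u x)\<^sup>2)"
          by (simp add: power_mult_distrib mult.commute[of "(u x)\<^sup>2"] mult_right_mono)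
      qed
    qed
  qed
  then show "(\<lambda>x. b x * u x) \<in> L2" by (simp add: mult.commute)
qed

lemma L2_bounded:
  assumes "b \<in> borel_measurable leb_I" "\<And>x. x \<in> {-1<..<1} \<Longrightarrow> \<bar>b x\<bar> \<le> C"
  shows "b \<in> L2"
  using L2_mult_bounded(1)[OF L2_const[of 1] assms] by simp

lemma L2_cmult [L2_intros]: "u \<in> L2 \<Longrightarrow> (\<lambda>x. c * u x) \<in> L2"
  by (rule L2_mult_bounded(2)[where C="\<bar>c\<bar>"]) auto

lemma L2_minus [L2_intros]: "u \<in> L2 \<Longrightarrow> (\<lambda>x. - u x) \<in> L2"
  using L2_cmult[of u "-1"] by simp

lemma L2_add [L2_intros]: "u \<in> L2 \<Longrightarrow> v \<in> L2 \<Longrightarrow> (\<lambda>x. u x + v x) \<in> L2"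
proof (rule L2_I)
  assume a: "u \<in> L2" "v \<in> L2"
  then show "(\<lambda>x. u x + v x) \<in> borel_measurable leb_I"
    by (intro borel_measurable_add L2_measurable)
  show "integrable leb_I (\<lambda>x. (u x + v x)\<^sup>2)"
    using a L2_mult_integrable[OF a] by (simp add: power2_sum L2_square_integrable mult.assoc)
qed

lemma L2_diff [L2_intros]: "u \<in> L2 \<Longrightarrow> v \<in> L2 \<Longrightarrow> (\<lambda>x. u x - v x) \<in> L2"
  using L2_add[of u "\<lambda>x. - v x"] by (simp add: L2_minus)

lemma L2_abs [L2_intros]: "u \<in> L2 \<Longrightarrow> (\<lambda>x. \<bar>u x\<bar>) \<in> L2"
  unfolding L2_def by (auto intro!: borel_measurable_abs)

lemma L2_sum [L2_intros]: "(\<And>i. i \<in> A \<Longrightarrow> u i \<in> L2) \<Longrightarrow> (\<lambda>x. \<Sum>i\<in>A. u i x) \<in> L2"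
  by (induction A rule: infinite_finite_induct) (auto intro: L2_intros)

lemma L2_indicator [L2_intros]:
  assumes "u \<in> L2" "A \<in> sets borel"
  shows "(\<lambda>x. indicat_real A x * u x) \<in> L2"
proof (rule L2_mult_bounded(2)[OF assms(1), where C=1])
  show "indicat_real A \<in> borel_measurable leb_I"
    using assms by (intro leb_I_measurable_borel) simp
qed (simp add: indicator_def)

lemma L2_continuous:
  assumes "continuous_on {-1..1} F" shows "F \<in> L2"
proof -
  obtain C where "\<And>x. x \<in> {-1..1} \<Longrightarrow> \<bar>F x\<bar> \<le> C"
    using compact_continuous_image[OF assms] compact_imp_bounded
    by (metis compact_Icc bounded_iff image_eqI real_norm_def)
  then show ?thesis
    using leb_I_measurable_continuous[OF assms] by (intro L2_bounded[where C=C]) auto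
qed

lemma L2_cong_AE:
  assumes "u \<in> L2" "v \<in> borel_measurable leb_I" "AE x in leb_I. u x = v x"
  shows "v \<in> L2"
proof (rule L2_I[OF assms(2)])
  show "integrable leb_I (\<lambda>x. (v x)\<^sup>2)"
    by (rule integrable_cong_AE_imp[OF L2_square_integrable[OF assms(1)]])
      (use assms(2,3) in \<open>auto elim: eventually_mono\<close>)
qed

lemma AE_leb_I_measurable:
  fixes u v :: "real \<Rightarrow> real"
  assumes "u \<in> borel_measurable leb_I" "AE x in leb_I. u x = v x"
  shows "v \<in> borel_measurable leb_I"
proof -
  have "AE x in lebesgue. indicat_real {-1<..<1} x * u x = indicat_real {-1<..<1} x * v x"
    using assms(2) by (subst (asm) AE_restrict_space_iff) (auto elim!: eventually_mono simp: indicator_def)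
  moreover have "(\<lambda>x. indicat_real {-1<..<1} x * u x) \<in> borel_measurable lebesgue"
    using assms(1) by (subst (asm) borel_measurable_restrict_space_iff) auto
  ultimately have "(\<lambda>x. indicat_real {-1<..<1} x * v x) \<in> borel_measurable lebesgue"
    by (rule borel_measurable_AE[rotated])
  then show ?thesis
    by (subst borel_measurable_restrict_space_iff) auto
qed

lemma L2_AE: "u \<in> L2 \<Longrightarrow> AE x in leb_I. u x = v x \<Longrightarrow> v \<in> L2"
  using AE_leb_I_measurable[of u v] L2_cong_AE[of u v] L2_measurable[of u] by blast

lemma integral_cong_AE_leb_I:
  fixes u v :: "real \<Rightarrow> real"
  assumes "u \<in> borel_measurable leb_I" "AE x in leb_I. u x = v x"
  shows "(LINT x|leb_I. u x) = (LINT x|leb_I. v x)"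
  using AE_leb_I_measurable[OF assms] assms by (intro integral_cong_AE) auto

lemma L2_norm_cong_AE:
  assumes "u \<in> L2" "AE x in leb_I. u x = v x"
  shows "L2_norm u = L2_norm v"
  unfolding L2_norm_def
  by (subst integral_cong_AE_leb_I[of _ "\<lambda>x. (v x)\<^sup>2"])
     (use assms L2_measurable in \<open>auto elim: eventually_mono\<close>)

lemma L2_norm_nonneg [simp]: "0 \<le> L2_norm u"
  by (simp add: L2_norm_def)

lemma L2_norm_square: "(L2_norm u)\<^sup>2 = (LINT x|leb_I. (u x)\<^sup>2)"
  by (simp add: L2_norm_def)

lemma Cauchy_Schwarz_L2:
  assumes "u \<in> L2" "v \<in> L2"
  shows "\<bar>LINT x|leb_I. u x * v x\<bar> \<le> L2_norm u * L2_norm v"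
proof -
  define A B C where "A = (LINT x|leb_I. (u x)\<^sup>2)" and "B = (LINT x|leb_I. u x * v x)"
    and "C = (LINT x|leb_I. (v x)\<^sup>2)"
  have ge: "0 \<le> A - 2 * t * B + t\<^sup>2 * C" for t
  proof -
    have "0 \<le> (LINT x|leb_I. (u x - t * v x)\<^sup>2)" by simp
    also have "\<dots> = (LINT x|leb_I. (u x)\<^sup>2 - 2 * t * (u x * v x) + t\<^sup>2 * (v x)\<^sup>2)"
      by (simp add: power2_diff power_mult_distrib algebra_simps)
    also have "\<dots> = A - 2 * t * B + t\<^sup>2 * C"
      unfolding A_def B_def C_def
      using L2_square_integrable[OF assms(1)] L2_square_integrable[OF assms(2)] L2_mult_integrable[OF assms]
      by simp
    finally show ?thesis .
  qed
  have "C \<ge> 0" "A \<ge> 0" by (auto simp: A_def C_def)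
  have "B\<^sup>2 \<le> A * C"
  proof (cases "C = 0")
    case True
    have "B = 0"
    proof (rule ccontr)
      assume "B \<noteq> 0"
      have "0 \<le> A - 2 * ((A + 1) / (2 * B)) * B" using ge[of "(A + 1) / (2 * B)"] True by simp
      with \<open>B \<noteq> 0\<close> show False by simp
    qed
    then show ?thesis using True by simp
  next
    case False
    then have "0 \<le> C * (A - 2 * (B / C) * B + (B / C)\<^sup>2 * C)" using ge[of "B/C"] \<open>C \<ge> 0\<close> by simp
    also have "\<dots> = A * C - B\<^sup>2" using False by (simp add: field_simps power2_eq_square)
    finally show ?thesis by simp
  qed
  then have "\<bar>B\<bar> \<le> sqrt (A * C)" using real_le_rsqrt[of "\<bar>B\<bar>"] by simp
  then show ?thesis by (simp add: L2_norm_def real_sqrt_mult A_def B_def C_def)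
qed

lemma L2_norm_cmult [simp]: "L2_norm (\<lambda>x. c * u x) = \<bar>c\<bar> * L2_norm u"
  by (simp add: L2_norm_def power_mult_distrib real_sqrt_mult)

lemma L2_norm_minus [simp]: "L2_norm (\<lambda>x. - u x) = L2_norm u"
  by (simp add: L2_norm_def)

lemma L2_norm_minus_commute: "L2_norm (\<lambda>x. u x - v x) = L2_norm (\<lambda>x. v x - u x)"
  by (simp add: L2_norm_def power2_commute)

lemma L2_norm_add:
  assumes "u \<in> L2" "v \<in> L2"
  shows "(L2_norm (\<lambda>x. u x + v x))\<^sup>2 =
    (L2_norm u)\<^sup>2 + 2 * (LINT x|leb_I. u x * v x) + (L2_norm v)\<^sup>2"
  using L2_square_integrable[OF assms(1)] L2_square_integrable[OF assms(2)] L2_mult_integrable[OF assms]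
  by (simp add: L2_norm_square power2_sum mult.assoc)

lemma L2_norm_triangle:
  assumes "u \<in> L2" "v \<in> L2"
  shows "L2_norm (\<lambda>x. u x + v x) \<le> L2_norm u + L2_norm v"
proof (rule power2_le_imp_le)
  show "(L2_norm (\<lambda>x. u x + v x))\<^sup>2 \<le> (L2_norm u + L2_norm v)\<^sup>2"
    using Cauchy_Schwarz_L2[OF assms] by (simp add: L2_norm_add[OF assms] power2_sum abs_le_iff)
qed (simp add: add_nonneg_nonneg)

lemma L2_norm_mono:
  assumes "v \<in> L2" "u \<in> L2" "\<And>x. x \<in> {-1<..<1} \<Longrightarrow> \<bar>u x\<bar> \<le> \<bar>v x\<bar>"
  shows "L2_norm u \<le> L2_norm v"
  unfolding L2_norm_def
proof (intro real_sqrt_le_mono integral_mono)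
  fix x assume "x \<in> space leb_I"
  then show "(u x)\<^sup>2 \<le> (v x)\<^sup>2" using assms(3)[of x] by (simp add: abs_le_square_iff)
qed (use assms in \<open>auto intro: L2_square_integrable\<close>)

lemma L2_norm_const [simp]: "L2_norm (\<lambda>x. c) = sqrt 2 * \<bar>c\<bar>"
  by (simp add: L2_norm_def real_sqrt_mult)

lemma integral_abs_le_L2_norm:
  assumes "u \<in> L2" shows "(LINT x|leb_I. \<bar>u x\<bar>) \<le> sqrt 2 * L2_norm u"
  using Cauchy_Schwarz_L2[OF L2_abs[OF assms] L2_const[of 1]]
  by (simp add: L2_norm_def mult.commute abs_le_iff)

lemma abs_integral_le:
  fixes u :: "real \<Rightarrow> real"
  shows "\<bar>LINT x|leb_I. u x\<bar> \<le> (LINT x|leb_I. \<bar>u x\<bar>)"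
  using integral_norm_bound[of leb_I u] by simp

text \<open>The primitive of \<open>u\<close> on \<open>[-1,1]\<close> that vanishes at \<open>-1\<close>. Being a Lebesgue integral over \<open>(-1,1)\<close>, it is
  constant outside \<open>[-1,1]\<close>.\<close>
definition prim :: "(real \<Rightarrow> real) \<Rightarrow> real \<Rightarrow> real" where
  "prim u x = (LINT t|leb_I. indicat_real {..<x} t * u t)"

lemma ind_integrable:
  fixes u :: "real \<Rightarrow> real"
  assumes "integrable leb_I u" "A \<in> sets borel"
  shows "integrable leb_I (\<lambda>t. indicat_real A t * u t)"
proof -
  have "indicat_real A \<in> borel_measurable leb_I"
    using assms by (intro leb_I_measurable_borel) simp
  then have "(\<lambda>t. indicat_real A t * u t) \<in> borel_measurable leb_I"
    using assms(1) by (intro borel_measurable_times) auto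
  then show ?thesis
    by (intro Bochner_Integration.integrable_bound[OF assms(1)]) (auto simp: indicator_def)
qed

lemma prim_left [simp]: "prim u (-1) = 0"
proof -
  have "prim u (-1) = (LINT t|leb_I. 0)"
    unfolding prim_def by (rule Bochner_Integration.integral_cong) (auto simp: indicator_def)
  then show ?thesis by simp
qed

lemma prim_right [simp]: "prim u 1 = (LINT t|leb_I. u t)"
  unfolding prim_def by (rule Bochner_Integration.integral_cong) (auto simp: indicator_def)

lemma prim_diff_eq:
  assumes "u \<in> L2" "a \<le> b"
  shows "prim u b - prim u a = (LINT t|leb_I. indicat_real {a..<b} t * u t)"
proof -
  have "prim u b - prim u a = (LINT t|leb_I. indicat_real {..<b} t * u t - indicat_real {..<a} t * u t)"
    unfolding prim_def using L2_integrable[OF assms(1)]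
    by (intro Bochner_Integration.integral_diff[symmetric] ind_integrable) auto
  also have "\<dots> = (LINT t|leb_I. indicat_real {a..<b} t * u t)"
    using assms(2) by (intro Bochner_Integration.integral_cong) (auto simp: indicator_def)
  finally show ?thesis .
qed

lemma prim_add: "u \<in> L2 \<Longrightarrow> v \<in> L2 \<Longrightarrow> prim (\<lambda>t. u t + v t) x = prim u x + prim v x"
  unfolding prim_def by (simp add: distrib_left ind_integrable L2_integrable)

lemma prim_cmult: "prim (\<lambda>t. c * u t) x = c * prim u x"
  unfolding prim_def by (simp add: mult.left_commute)

lemma prim_diff: "u \<in> L2 \<Longrightarrow> v \<in> L2 \<Longrightarrow> prim (\<lambda>t. u t - v t) x = prim u x - prim v x"
  unfolding prim_def by (simp add: right_diff_distrib ind_integrable L2_integrable)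

lemma prim_zero [simp]: "prim (\<lambda>t. 0) x = 0"
  by (simp add: prim_def)

lemma prim_cong_AE:
  assumes "u \<in> L2" "AE x in leb_I. u x = v x" shows "prim u x = prim v x"
  unfolding prim_def
  by (rule integral_cong_AE_leb_I)
     (use assms L2_measurable[OF L2_indicator] in \<open>auto elim: eventually_mono\<close>)

lemma measure_leb_I_Ico:
  assumes "-1 \<le> a" "a \<le> b" "b \<le> 1" shows "(LINT t|leb_I. indicat_real {a..<b} t) = b - a"
proof -
  have "(LINT t|leb_I. indicat_real {a..<b} t) = (LINT t|lebesgue. indicat_real {-1<..<1} t *\<^sub>R indicat_real {a..<b} t)"
    by (subst integral_restrict_space) auto
  also have "\<dots> = (LINT t|lebesgue. indicat_real ({-1<..<1} \<inter> {a..<b}) t)"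
    by (simp add: indicator_inter_arith)
  also have "\<dots> = measure lebesgue ({-1<..<1} \<inter> {a..<b})" by simp
  also have "\<dots> = measure lborel ({-1<..<1} \<inter> {a..<b})" by (subst measure_completion) auto
  also have "{-1<..<1} \<inter> {a..<b} = (if a = -1 then {a<..<b} else {a..<b})" using assms by auto
  also have "measure lborel \<dots> = b - a" using assms by auto
  finally show ?thesis .
qed

lemma L2_norm_indicator_Ico:
  assumes "-1 \<le> a" "a \<le> b" "b \<le> 1"
  shows "L2_norm (indicat_real {a..<b}) = sqrt (b - a)"
proof -
  have "(\<lambda>x. (indicat_real {a..<b} x)\<^sup>2) = indicat_real {a..<b}"
    by (auto simp: indicator_def)
  then show ?thesis using measure_leb_I_Ico[OF assms] by (simp add: L2_norm_def)
qed

lemma prim_Hoelder: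
  assumes "u \<in> L2" "-1 \<le> a" "a \<le> b" "b \<le> 1"
  shows "\<bar>prim u b - prim u a\<bar> \<le> sqrt (b - a) * L2_norm u"
proof -
  have "indicat_real {a..<b} \<in> L2" using L2_indicator[OF L2_const[of 1], of "{a..<b}"] by simp
  then show ?thesis
    using Cauchy_Schwarz_L2[of "indicat_real {a..<b}" u] assms
    by (simp add: prim_diff_eq L2_norm_indicator_Ico)
qed

lemma prim_continuous:
  assumes "u \<in> L2" shows "continuous_on {-1..1} (prim u)"
proof (rule continuous_onI)
  fix x e :: real assume x: "x \<in> {-1..1}" and e: "0 < e"
  define d where "d = (e / (L2_norm u + 1))\<^sup>2"
  have pos: "0 < L2_norm u + 1" using L2_norm_nonneg[of u] by linarith
  have "dist (prim u y) (prim u x) \<le> e" if y: "y \<in> {-1..1}" "dist y x < d" for y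
  proof -
    have "\<bar>prim u y - prim u x\<bar> \<le> sqrt \<bar>y - x\<bar> * L2_norm u"
      using prim_Hoelder[OF assms, of x y] prim_Hoelder[OF assms, of y x] x y
      by (cases "x \<le> y") (auto simp: abs_minus_commute)
    also have "\<dots> \<le> sqrt d * (L2_norm u + 1)"
      using y by (intro mult_mono) (auto simp: dist_real_def)
    also have "\<dots> = e" using e pos by (simp add: d_def)
    finally show ?thesis by (simp add: dist_real_def)
  qed
  moreover have "0 < d" using e pos by (simp add: d_def)
  ultimately show "\<exists>d>0. \<forall>y\<in>{-1..1}. dist y x < d \<longrightarrow> dist (prim u y) (prim u x) \<le> e" by blast
qed

lemma prim_L2 [L2_intros]: "u \<in> L2 \<Longrightarrow> prim u \<in> L2"
  by (rule L2_continuous[OF prim_continuous])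

lemma prim_abs_le: 
  assumes "u \<in> L2" "x \<in> {-1..1}"
  shows "\<bar>prim u x\<bar> \<le> sqrt 2 * L2_norm u"
proof -
  have "\<bar>prim u x\<bar> \<le> sqrt (x + 1) * L2_norm u"
    using prim_Hoelder[OF assms(1), of "-1" x] assms by simp
  also have "\<dots> \<le> sqrt 2 * L2_norm u" using assms by (intro mult_right_mono) auto
  finally show ?thesis .
qed

lemma L2_norm_le_sup:
  assumes "u \<in> L2" "\<And>x. x \<in> {-1<..<1} \<Longrightarrow> \<bar>u x\<bar> \<le> C"
  shows "L2_norm u \<le> sqrt 2 * C"
proof -
  have "0 \<le> C" using assms(2)[of 0] by simp
  then show ?thesis using L2_norm_mono[of "\<lambda>x. C" u] assms by (simp add: L2_const)
qed

lemma prim_norm: "u \<in> L2 \<Longrightarrow> L2_norm (prim u) \<le> 2 * L2_norm u"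
  using L2_norm_le_sup[of "prim u" "sqrt 2 * L2_norm u"] prim_abs_le[of u]
  by (simp add: prim_L2 flip: mult.assoc)

lemma AE_leb_I_neq: "AE t in leb_I. t \<noteq> (s::real)"
proof -
  have "AE t in lebesgue. t \<noteq> s"
    by (rule AE_completion) (rule AE_lborel_singleton)
  then show ?thesis by (subst AE_restrict_space_iff) (auto elim: eventually_mono)
qed

text \<open>Fubini's theorem: the integral of \<open>u s * v t\<close> over the square is the sum of its integrals over the two
  triangles cut off by the diagonal. This is the source of the product rule and of integration by parts.\<close>
lemma integral_mult_eq_prim:
  assumes u: "u \<in> L2" and v: "v \<in> L2"
  shows "(LINT t|leb_I. u t) * (LINT t|leb_I. v t) = (LINT t|leb_I. u t * prim v t + prim u t * v t)"
proof -
  interpret pair_sigma_finite leb_I leb_I ..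
  have [measurable]: "u \<in> borel_measurable leb_I" "v \<in> borel_measurable leb_I"
    using u v by (auto intro: L2_measurable)
  have [measurable]: "(\<lambda>x. x) \<in> borel_measurable leb_I"
    by (rule leb_I_measurable_borel) simp
  have iu: "integrable leb_I u" "integrable leb_I v" using u v by (auto intro: L2_integrable)
  define f where "f = (\<lambda>s t. if s < t then u s * v t else 0)"
  have int_uv: "integrable (leb_I \<Otimes>\<^sub>M leb_I) (\<lambda>(s,t). u s * v t)"
    by (rule Fubini_integrable) (use iu in \<open>auto simp: abs_mult\<close>)
  have int_f: "integrable (leb_I \<Otimes>\<^sub>M leb_I) (case_prod f)"
  proof (rule Bochner_Integration.integrable_bound[OF int_uv])
    show "case_prod f \<in> borel_measurable (leb_I \<Otimes>\<^sub>M leb_I)" unfolding f_def by measurable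
  qed (auto simp: f_def)
  have inner: "(LINT t|leb_I. f s t) = u s * ((LINT t|leb_I. v t) - prim v s)" for s
  proof -
    have "(LINT t|leb_I. f s t) = (LINT t|leb_I. u s * (v t - indicat_real {..<s} t * v t))"
    proof (rule integral_cong_AE_leb_I)
      show "f s \<in> borel_measurable leb_I" unfolding f_def by measurable
      show "AE t in leb_I. f s t = u s * (v t - indicat_real {..<s} t * v t)"
        using AE_leb_I_neq[of s] by eventually_elim (auto simp: f_def indicator_def)
    qed
    also have "\<dots> = u s * ((LINT t|leb_I. v t) - prim v s)"
      using iu by (simp add: prim_def ind_integrable)
    finally show ?thesis .
  qed
  have "(LINT t|leb_I. prim u t * v t) = (LINT t|leb_I. LINT s|leb_I. f s t)"
  proof (rule Bochner_Integration.integral_cong)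
    fix t
    have "prim u t * v t = (LINT s|leb_I. indicat_real {..<t} s * u s * v t)"
      using iu by (simp add: prim_def ind_integrable)
    also have "\<dots> = (LINT s|leb_I. f s t)"
      by (rule Bochner_Integration.integral_cong) (auto simp: f_def indicator_def)
    finally show "prim u t * v t = (LINT s|leb_I. f s t)" .
  qed simp
  also have "\<dots> = (LINT s|leb_I. LINT t|leb_I. f s t)"
    by (rule Fubini_integral[OF int_f])
  also have "\<dots> = (LINT s|leb_I. u s * (LINT t|leb_I. v t) - u s * prim v s)"
    by (simp add: inner right_diff_distrib)
  also have "\<dots> = (LINT s|leb_I. u s) * (LINT t|leb_I. v t) - (LINT s|leb_I. u s * prim v s)"
    using iu L2_mult_integrable[OF u prim_L2[OF v]] by simp
  finally show ?thesis
    using L2_mult_integrable[OF u prim_L2[OF v]] L2_mult_integrable[OF prim_L2[OF u] v] by simp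
qed

lemma prim_restrict:
  assumes "t \<le> x" shows "prim (\<lambda>s. indicat_real {..<x} s * u s) t = prim u t"
  unfolding prim_def using assms
  by (intro Bochner_Integration.integral_cong) (auto simp: indicator_def)

lemma prim_mult:
  assumes u: "u \<in> L2" and v: "v \<in> L2"
  shows "prim u x * prim v x = prim (\<lambda>t. u t * prim v t + prim u t * v t) x"
proof -
  let ?r = "\<lambda>w s. indicat_real {..<x} s * w s"
  have "prim u x * prim v x = (LINT t|leb_I. ?r u t) * (LINT t|leb_I. ?r v t)"
    by (simp add: prim_def)
  also have "\<dots> = (LINT t|leb_I. ?r u t * prim (?r v) t + prim (?r u) t * ?r v t)"
    by (rule integral_mult_eq_prim) (use u v in \<open>auto intro: L2_intros\<close>)
  also have "\<dots> = (LINT t|leb_I. indicat_real {..<x} t * (u t * prim v t + prim u t * v t))"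
  proof (rule Bochner_Integration.integral_cong)
    fix t
    show "?r u t * prim (?r v) t + prim (?r u) t * ?r v t =
      indicat_real {..<x} t * (u t * prim v t + prim u t * v t)"
      by (cases "t < x") (auto simp: prim_restrict)
  qed simp
  finally show ?thesis by (simp add: prim_def)
qed

section \<open>Functions with a square integrable derivative\<close>

text \<open>\<open>F\<close> is, on \<open>[-1,1]\<close>, absolutely continuous with derivative \<open>u \<in> L\<^sub>2\<close>: the continuous representative of an
  element of \<open>H\<^sup>1\<close> together with its weak derivative.\<close>
definition ac_deriv :: "(real \<Rightarrow> real) \<Rightarrow> (real \<Rightarrow> real) \<Rightarrow> bool" where
  "ac_deriv F u \<longleftrightarrow> u \<in> L2 \<and> (\<forall>x\<in>{-1..1}. F x = F (-1) + prim u x)"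

lemma ac_deriv_L2: "ac_deriv F u \<Longrightarrow> u \<in> L2"
  by (simp add: ac_deriv_def)

lemma ac_deriv_eq: "ac_deriv F u \<Longrightarrow> x \<in> {-1..1} \<Longrightarrow> F x = F (-1) + prim u x"
  unfolding ac_deriv_def by blast

lemma ac_deriv_continuous:
  assumes "ac_deriv F u" shows "continuous_on {-1..1} F"
proof -
  have "continuous_on {-1..1} (\<lambda>x. F (-1) + prim u x)"
    using prim_continuous assms by (intro continuous_intros) (auto simp: ac_deriv_def)
  then show ?thesis
    by (rule continuous_on_eq) (simp add: ac_deriv_eq[OF assms, symmetric])
qed

lemma ac_deriv_L2_fun: "ac_deriv F u \<Longrightarrow> F \<in> L2"
  by (rule L2_continuous[OF ac_deriv_continuous])

lemma ac_deriv_prim: "u \<in> L2 \<Longrightarrow> ac_deriv (prim u) u"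
  by (simp add: ac_deriv_def)

lemma ac_deriv_const: "ac_deriv (\<lambda>x. c) (\<lambda>x. 0)"
  by (simp add: ac_deriv_def L2_const)

lemma ac_deriv_add: "ac_deriv F u \<Longrightarrow> ac_deriv G v \<Longrightarrow> ac_deriv (\<lambda>x. F x + G x) (\<lambda>x. u x + v x)"
proof -
  assume a: "ac_deriv F u" "ac_deriv G v"
  note L = ac_deriv_L2[OF a(1)] ac_deriv_L2[OF a(2)]
  have "F x + G x = F (-1) + G (-1) + prim (\<lambda>x. u x + v x) x" if "x \<in> {-1..1}" for x
    using ac_deriv_eq[OF a(1) that] ac_deriv_eq[OF a(2) that] prim_add[OF L, of x] by linarith
  then show ?thesis using L2_add[OF L] unfolding ac_deriv_def by blast
qed

lemma ac_deriv_diff: "ac_deriv F u \<Longrightarrow> ac_deriv G v \<Longrightarrow> ac_deriv (\<lambda>x. F x - G x) (\<lambda>x. u x - v x)"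
proof -
  assume a: "ac_deriv F u" "ac_deriv G v"
  note L = ac_deriv_L2[OF a(1)] ac_deriv_L2[OF a(2)]
  have "F x - G x = F (-1) - G (-1) + prim (\<lambda>x. u x - v x) x" if "x \<in> {-1..1}" for x
    using ac_deriv_eq[OF a(1) that] ac_deriv_eq[OF a(2) that] prim_diff[OF L, of x] by linarith
  then show ?thesis using L2_diff[OF L] unfolding ac_deriv_def by blast
qed

lemma ac_deriv_cmult: "ac_deriv F u \<Longrightarrow> ac_deriv (\<lambda>x. c * F x) (\<lambda>x. c * u x)"
  unfolding ac_deriv_def prim_cmult by (metis L2_cmult distrib_left)

lemma ac_deriv_cong:
  "ac_deriv F u \<Longrightarrow> (\<And>x. x \<in> {-1..1} \<Longrightarrow> F x = G x) \<Longrightarrow> ac_deriv G u"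
  proof -
  assume a: "ac_deriv F u" "\<And>x. x \<in> {-1..1} \<Longrightarrow> F x = G x"
  have "G x = G (-1) + prim u x" if "x \<in> {-1..1}" for x
    using ac_deriv_eq[OF a(1) that] a(2)[OF that] a(2)[of "-1"] by simp
  then show "ac_deriv G u" using ac_deriv_L2[OF a(1)] unfolding ac_deriv_def by blast
qed

lemma ac_deriv_cong_AE:
  "ac_deriv F u \<Longrightarrow> AE x in leb_I. u x = v x \<Longrightarrow> ac_deriv F v"
  unfolding ac_deriv_def using L2_AE[of u v] prim_cong_AE[of u v] by metis

lemma L2_mult_continuous:
  assumes "u \<in> L2" "continuous_on {-1..1} F"
  shows "(\<lambda>x. u x * F x) \<in> L2" "(\<lambda>x. F x * u x) \<in> L2"
proof -
  have "bounded (F ` {-1..1})"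
    using compact_continuous_image[OF assms(2)] compact_imp_bounded by blast
  then obtain C where "\<And>x. x \<in> {-1<..<1} \<Longrightarrow> \<bar>F x\<bar> \<le> C"
    by (force simp: bounded_iff)
  then show "(\<lambda>x. u x * F x) \<in> L2" "(\<lambda>x. F x * u x) \<in> L2"
    using L2_mult_bounded[OF assms(1) leb_I_measurable_continuous[OF assms(2)]] by blast+
qed

lemma prim_cong: "(\<And>t. t \<in> {-1<..<1} \<Longrightarrow> u t = v t) \<Longrightarrow> prim u x = prim v x"
  unfolding prim_def by (rule Bochner_Integration.integral_cong) auto

lemma ac_deriv_mult:
  assumes F: "ac_deriv F u" and G: "ac_deriv G v"
  shows "ac_deriv (\<lambda>x. F x * G x) (\<lambda>x. u x * G x + F x * v x)"
  unfolding ac_deriv_def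
proof (intro conjI ballI)
  note L = ac_deriv_L2[OF F] ac_deriv_L2[OF G]
  note C = ac_deriv_continuous[OF F] ac_deriv_continuous[OF G]
  show "(\<lambda>x. u x * G x + F x * v x) \<in> L2"
    using L2_mult_continuous[OF L(1) C(2)] L2_mult_continuous[OF L(2) C(1)] by (intro L2_intros)
  fix x :: real assume x: "x \<in> {-1..1}"
  define a b where "a = F (-1)" and "b = G (-1)"
  have "prim (\<lambda>x. u x * G x + F x * v x) x =
     prim (\<lambda>t. (b * u t + a * v t) + (u t * prim v t + prim u t * v t)) x"
  proof (rule prim_cong)
    fix t :: real assume "t \<in> {-1<..<1}"
    then have "F t = a + prim u t" "G t = b + prim v t"
      unfolding a_def b_def by (intro ac_deriv_eq F G; simp)+
    then show "u t * G t + F t * v t = b * u t + a * v t + (u t * prim v t + prim u t * v t)"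
      by (simp add: algebra_simps)
  qed
  also have "\<dots> = prim (\<lambda>t. b * u t + a * v t) x + prim (\<lambda>t. u t * prim v t + prim u t * v t) x"
    by (intro prim_add L2_add L2_cmult L L2_mult_continuous(1)[OF L(1) prim_continuous[OF L(2)]]
        L2_mult_continuous(2)[OF L(2) prim_continuous[OF L(1)]])
  also have "\<dots> = b * prim u x + a * prim v x + prim u x * prim v x"
    using L by (simp add: prim_add L2_intros prim_cmult prim_mult)
  finally show "F x * G x = F (-1) * G (-1) + prim (\<lambda>x. u x * G x + F x * v x) x"
    unfolding ac_deriv_eq[OF F x] ac_deriv_eq[OF G x] by (simp add: a_def b_def algebra_simps)
qed

lemma ac_deriv_power:
  assumes F: "ac_deriv F u"
  shows "ac_deriv (\<lambda>x. F x ^ Suc n) (\<lambda>x. real (Suc n) * F x ^ n * u x)"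
proof (induction n)
  case 0 then show ?case using F by simp
next
  case (Suc n)
  have "ac_deriv (\<lambda>x. F x * F x ^ Suc n) (\<lambda>x. u x * F x ^ Suc n + F x * (real (Suc n) * F x ^ n * u x))"
    by (rule ac_deriv_mult[OF F Suc])
  then show ?case by (simp add: algebra_simps)
qed

lemma integration_by_parts:
  assumes F: "ac_deriv F u" and G: "ac_deriv G v"
  shows "(LINT t|leb_I. F t * v t) = F 1 * G 1 - F (-1) * G (-1) - (LINT t|leb_I. u t * G t)"
proof -
  note L = ac_deriv_L2[OF F] ac_deriv_L2[OF G] ac_deriv_L2_fun[OF F] ac_deriv_L2_fun[OF G]
  have "F 1 * G 1 = F (-1) * G (-1) + (LINT t|leb_I. u t * G t + F t * v t)"
    using ac_deriv_eq[OF ac_deriv_mult[OF F G], of 1] by simp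
  then show ?thesis
    using L by (simp add: L2_mult_integrable)
qed

lemma ac_deriv_diff_eq:
  assumes "ac_deriv F u" "-1 \<le> a" "a \<le> b" "b \<le> 1"
  shows "F b - F a = (LINT t|leb_I. indicat_real {a..<b} t * u t)"
  using prim_diff_eq[OF ac_deriv_L2[OF assms(1)] assms(3)] ac_deriv_eq[OF assms(1), of a]
    ac_deriv_eq[OF assms(1), of b] assms by simp

lemma prim_has_integral:
  assumes "u \<in> L2" "x \<in> {-1..1}"
  shows "(u has_integral prim u x) {-1..x}"
proof -
  have "integrable leb_I (\<lambda>t. indicat_real {..<x} t * u t)"
    using L2_integrable[OF assms(1)] by (intro ind_integrable) auto
  then have "((\<lambda>t. indicat_real {..<x} t * u t) has_integral prim u x) {-1<..<1}"
    unfolding prim_def by (intro has_integral_integral_lebesgue_on) auto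
  then have "((\<lambda>t. if t \<in> {-1<..<1} then indicat_real {..<x} t * u t else 0) has_integral prim u x) UNIV"
    by (subst has_integral_restrict_UNIV)
  then have "((\<lambda>t. if t \<in> {-1..x} then u t else 0) has_integral prim u x) UNIV"
    by (rule has_integral_spike[of "{-1,1,x}", rotated -1]) (use assms in \<open>auto simp: indicator_def\<close>)
  then show ?thesis by (subst (asm) has_integral_restrict_UNIV)
qed

text \<open>The fundamental theorem of calculus with finitely many exceptional points, as needed for
  piecewise polynomials.\<close>
lemma ac_deriv_classical:
  assumes "finite S" "continuous_on {-1..1} F" "u \<in> L2"
    and "\<And>x. x \<in> {-1<..<1} - S \<Longrightarrow> (F has_real_derivative u x) (at x)"
  shows "ac_deriv F u"
  unfolding ac_deriv_def
proof (intro conjI ballI)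
  fix x :: real assume x: "x \<in> {-1..1}"
  have "(u has_integral (F x - F (-1))) {-1..x}"
  proof (rule fundamental_theorem_of_calculus_interior_strong[OF assms(1)])
    show "continuous_on {-1..x} F" using assms(2) x by (auto intro: continuous_on_subset)
    show "(F has_vector_derivative u y) (at y)" if "y \<in> {-1<..<x} - S" for y
      using assms(4)[of y] that x by (auto simp: has_real_derivative_iff_has_vector_derivative)
  qed (use x in auto)
  moreover have "(u has_integral prim u x) {-1..x}" by (rule prim_has_integral[OF assms(3) x])
  ultimately have "F x - F (-1) = prim u x" by (rule has_integral_unique)
  then show "F x = F (-1) + prim u x" by simp
qed (rule assms)

section \<open>Vanishing primitives\<close>

text \<open>The sets over which \<open>u\<close> has integral zero form a Dynkin system that contains all half lines, hence all Borel
  sets; a Lebesgue set differs from a Borel set by a null set.\<close>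
lemma AE_zero_if_prim_zero:
  assumes u: "u \<in> L2" and z: "\<And>x. x \<in> {-1..1} \<Longrightarrow> prim u x = 0"
  shows "AE x in leb_I. u x = 0"
proof -
  note iu = L2_integrable[OF u]
  have total: "(LINT t|leb_I. u t) = 0" using z[of 1] by simp
  have borel: "(LINT t|leb_I. indicat_real A t * u t) = 0" if "A \<in> sets borel" for A
  proof -
    have "sets borel = sigma_sets UNIV (range (\<lambda>a::real. {..<a}))"
      by (subst borel_Iio) (simp add: sets_measure_of_conv)
    then have A: "A \<in> sigma_sets UNIV (range (\<lambda>a::real. {..<a}))" using that by simp
    have sb: "B \<in> sets borel" if "B \<in> sigma_sets UNIV (range (\<lambda>a::real. {..<a}))" for B
      using that \<open>sets borel = _\<close> by simp
    have I: "Int_stable (range (\<lambda>a::real. {..<a}))"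
    proof -
      have "{..<a} \<inter> {..<b} = {..<min a b}" for a b :: real by auto
      then show ?thesis unfolding Int_stable_def by auto
    qed
    have subset_Pow: "range (\<lambda>a::real. {..<a}) \<subseteq> Pow UNIV" by simp
    show ?thesis
      using I subset_Pow A
    proof (induction rule: sigma_sets_induct_disjoint)
      case (basic B)
      then obtain a where B: "B = {..<a}" by auto
      have "(LINT t|leb_I. indicat_real B t * u t) = prim u (max (-1) (min a 1))"
        unfolding prim_def B by (rule Bochner_Integration.integral_cong) (auto simp: indicator_def)
      then show ?case using z by simp
    next
      case (compl B)
      have "(LINT t|leb_I. indicat_real (UNIV - B) t * u t) = (LINT t|leb_I. u t - indicat_real B t * u t)"
        by (rule Bochner_Integration.integral_cong) (auto simp: indicator_def)
      also have "\<dots> = 0" using iu compl total sb[OF compl(1)] by (simp add: ind_integrable)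
      finally show ?case .
    next
      case (union B)
      have Bm: "B i \<inter> {-1<..<1} \<in> sets lebesgue" for i
        by (intro sets_completionI_sets) (use sb[OF subsetD[OF union(2) rangeI], of i] in simp)
      have s: "set_lebesgue_integral leb_I (\<Union>i. B i \<inter> {-1<..<1}) u = (\<Sum>i. set_lebesgue_integral leb_I (B i \<inter> {-1<..<1}) u)"
      proof (rule lebesgue_integral_countable_add)
        have B: "B i \<inter> {-1<..<1} \<in> sets leb_I" for i
          using Bm[of i] by (simp add: sets_restrict_space_iff)
        then show "B i \<inter> {-1<..<1} \<in> sets leb_I" for i .
        show "B i \<inter> {-1<..<1} \<inter> (B j \<inter> {-1<..<1}) = {}" if "i \<noteq> j" for i j
          using union(1) that by (auto simp: disjoint_family_on_def)
        have "(\<Union>i. B i \<inter> {-1<..<1}) \<in> sets leb_I" using B by blast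
        then show "set_integrable leb_I (\<Union>i. B i \<inter> {-1<..<1}) u"
          unfolding set_integrable_def using iu by (rule integrable_mult_indicator)
      qed
      have e: "set_lebesgue_integral leb_I (C \<inter> {-1<..<1}) u = (LINT t|leb_I. indicat_real C t * u t)" for C
        unfolding set_lebesgue_integral_def
        by (rule Bochner_Integration.integral_cong) (auto simp: indicator_def)
      have "(LINT t|leb_I. indicat_real (\<Union>(range B)) t * u t) = set_lebesgue_integral leb_I (\<Union>i. B i \<inter> {-1<..<1}) u"
        using e[of "\<Union>(range B)"] by (simp add: Int_UN_distrib2)
      also have "\<dots> = 0" using s union by (simp add: e)
      finally show ?case .
    qed simp
  qed
  show ?thesis
  proof (rule density_unique_real)
    fix A assume "A \<in> sets leb_I"
    then have "A \<in> sets lebesgue" by (auto simp: sets_restrict_space_iff)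
    then obtain S N N' where A: "A = S \<union> N" "N \<subseteq> N'" "N' \<in> null_sets lborel" "S \<in> sets lborel"
      by (rule sets_completionE)
    have "AE x in lborel. x \<notin> N'" by (rule AE_not_in[OF A(3)])
    then have "AE x in lebesgue. x \<notin> N'" by (rule AE_completion)
    then have "AE x in leb_I. x \<notin> N'"
      by (subst AE_restrict_space_iff) (auto elim: eventually_mono)
    then have ae: "AE x in leb_I. indicat_real S x * u x = indicat_real A x *\<^sub>R u x"
      by eventually_elim (use A in \<open>auto simp: indicator_def\<close>)
    have "(LINT t|leb_I. indicat_real A t *\<^sub>R u t) = (LINT t|leb_I. indicat_real S t * u t)"
      using ae A(4) iu
      by (intro integral_cong_AE_leb_I[symmetric]) (auto intro!: borel_measurable_integrable ind_integrable)
    also have "\<dots> = 0" using borel A(4) by simp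
    finally show "set_lebesgue_integral leb_I A u = set_lebesgue_integral leb_I A (\<lambda>x. 0)"
      by (simp add: set_lebesgue_integral_def)
  qed (use iu in auto)
qed

text \<open>Turns the almost everywhere constraints of the Sobolev setting into pointwise ones, end points included.\<close>
lemma continuous_AE_nonneg:
  assumes F: "continuous_on {-1..1} F" and ae: "AE x in leb_I. F x \<ge> (0::real)" and x: "x \<in> {-1..1}"
  shows "F x \<ge> 0"
proof (rule ccontr)
  assume "\<not> F x \<ge> 0"
  then obtain d where d: "d > 0" "\<And>y. y \<in> {-1..1} \<Longrightarrow> dist y x < d \<Longrightarrow> dist (F y) (F x) < - F x"
    using F x unfolding continuous_on_iff by (metis neg_0_less_iff_less not_le)
  define a where "a = max (-1) (x - d/2)"
  define b where "b = min 1 (x + d/2)"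
  have ab: "-1 \<le> a" "a < b" "b \<le> 1" using x d(1) by (auto simp: a_def b_def)
  have neg: "F y < 0" if "y \<in> {a..<b}" for y
  proof -
    have "y \<in> {-1..1}" "dist y x < d" using that d(1) by (auto simp: a_def b_def dist_real_def)
    then have "dist (F y) (F x) < - F x" by (rule d(2))
    then show ?thesis by (simp add: dist_real_def)
  qed
  have "(LINT t|leb_I. indicat_real {a..<b} t) = 0"
  proof (rule integral_eq_zero_AE)
    show "AE t in leb_I. indicat_real {a..<b} t = 0"
      using ae by eventually_elim (use neg in \<open>force simp: indicator_def\<close>)
  qed
  then show False using measure_leb_I_Ico[of a b] ab by simp
qed

lemma continuous_AE_eq:
  assumes "continuous_on {-1..1} F" "continuous_on {-1..1} G" "AE x in leb_I. F x = (G x :: real)"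
    and "x \<in> {-1..1}"
  shows "F x = G x"
proof (rule antisym)
  have "0 \<le> G x - F x"
    by (rule continuous_AE_nonneg[OF continuous_on_diff[OF assms(2,1)] _ assms(4)])
      (use assms(3) in \<open>auto elim: eventually_mono\<close>)
  then show "F x \<le> G x" by simp
  have "0 \<le> F x - G x"
    by (rule continuous_AE_nonneg[OF continuous_on_diff[OF assms(1,2)] _ assms(4)])
      (use assms(3) in \<open>auto elim: eventually_mono\<close>)
  then show "G x \<le> F x" by simp
qed

section \<open>Smooth cut-off functions\<close>

definition smooth :: "(real \<Rightarrow> real) \<Rightarrow> bool" where
  "smooth f \<longleftrightarrow> (\<forall>k. (deriv ^^ k) f differentiable_on UNIV)"

text \<open>To be smooth it is enough to lie in a class of functions closed under differentiation; this avoids formulas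
  for iterated derivatives.\<close>
lemma smooth_coinduct:
  assumes "P f" and step: "\<And>g. P g \<Longrightarrow> \<exists>h. P h \<and> (\<forall>x. (g has_real_derivative h x) (at x))"
  shows "smooth f"
  unfolding smooth_def
proof
  fix k
  have "P ((deriv ^^ k) f)"
  proof (induction k)
    case (Suc k)
    obtain h where h: "P h" "\<forall>x. ((deriv ^^ k) f has_real_derivative h x) (at x)"
      using step[OF Suc] by blast
    then have "deriv ((deriv ^^ k) f) = h" by (auto intro: DERIV_imp_deriv)
    then show ?case using h by simp
  qed (use assms in simp)
  then obtain h where "\<forall>x. ((deriv ^^ k) f has_real_derivative h x) (at x)" using step by blast
  then show "(deriv ^^ k) f differentiable_on UNIV"
    by (auto simp: differentiable_on_def real_differentiable_def)
qed

lemma smooth_deriv: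
  assumes "smooth f" shows "smooth (deriv f)" "(f has_real_derivative deriv f x) (at x)"
proof -
  show "smooth (deriv f)" unfolding smooth_def
  proof
    fix k show "(deriv ^^ k) (deriv f) differentiable_on UNIV"
      using assms[unfolded smooth_def, rule_format, of "Suc k"] by (simp add: funpow_swap1)
  qed
  have "f differentiable_on UNIV" using assms[unfolded smooth_def, rule_format, of 0] by simp
  then have "f differentiable (at x)" by (auto simp: differentiable_on_def)
  then show "(f has_real_derivative deriv f x) (at x)"
    by (auto simp: real_differentiable_def DERIV_deriv_iff_real_differentiable)
qed

lemma smooth_antiderivative:
  assumes "smooth g" "\<And>x. (f has_real_derivative g x) (at x)" shows "smooth f"
proof (rule smooth_coinduct[of "\<lambda>h. h = f \<or> smooth h"])
  fix h assume "h = f \<or> smooth h"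
  then show "\<exists>k. (k = f \<or> smooth k) \<and> (\<forall>x. (h has_real_derivative k x) (at x))"
    using assms smooth_deriv by blast
qed simp

lemma smooth_continuous: "smooth f \<Longrightarrow> continuous_on A f"
  using smooth_deriv(2)[of f] by (meson DERIV_isCont continuous_at_imp_continuous_on)

text \<open>The derivative of a product is a sum of products, so products alone are not closed under differentiation, but
  this class is.\<close>
inductive smooth_ring :: "(real \<Rightarrow> real) \<Rightarrow> bool" where
  base: "smooth f \<Longrightarrow> smooth_ring f"
| add: "smooth_ring f \<Longrightarrow> smooth_ring g \<Longrightarrow> smooth_ring (\<lambda>x. f x + g x)"
| mult: "smooth_ring f \<Longrightarrow> smooth_ring g \<Longrightarrow> smooth_ring (\<lambda>x. f x * g x)"

lemma smooth_ring_smooth: "smooth_ring f \<Longrightarrow> smooth f"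
proof (rule smooth_coinduct[of smooth_ring])
  fix g assume "smooth_ring g"
  then show "\<exists>h. smooth_ring h \<and> (\<forall>x. (g has_real_derivative h x) (at x))"
  proof induction
    case (base f)
    then show ?case using smooth_deriv[of f] smooth_ring.base by blast
  next
    case (add f g)
    then obtain h k where "smooth_ring h" "\<forall>x. (f has_real_derivative h x) (at x)"
      "smooth_ring k" "\<forall>x. (g has_real_derivative k x) (at x)" by blast
    then show ?case
      by (intro exI[of _ "\<lambda>x. h x + k x"]) (auto intro: smooth_ring.add derivative_intros)
  next
    case (mult f g)
    then obtain h k where "smooth_ring h" "\<forall>x. (f has_real_derivative h x) (at x)"
      "smooth_ring k" "\<forall>x. (g has_real_derivative k x) (at x)" by blast
    with mult show ?case
      by (intro exI[of _ "\<lambda>x. h x * g x + k x * f x"])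
        (auto intro: smooth_ring.intros DERIV_mult)
  qed
qed

lemma smooth_add: "smooth f \<Longrightarrow> smooth g \<Longrightarrow> smooth (\<lambda>x. f x + g x)"
  by (rule smooth_ring_smooth[OF smooth_ring.add[OF smooth_ring.base smooth_ring.base]])

lemma smooth_mult: "smooth f \<Longrightarrow> smooth g \<Longrightarrow> smooth (\<lambda>x. f x * g x)"
  by (rule smooth_ring_smooth[OF smooth_ring.mult[OF smooth_ring.base smooth_ring.base]])

lemma smooth_affine: "smooth (\<lambda>x. a * x + b)"
proof (rule smooth_coinduct[of "\<lambda>g. \<exists>a b. g = (\<lambda>x. a * x + b)"])
  fix g :: "real \<Rightarrow> real" assume "\<exists>a b. g = (\<lambda>x. a * x + b)"
  then obtain a b where g: "g = (\<lambda>x. a * x + b)" by blast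
  have "(g has_real_derivative 0 * x + a) (at x)" for x
    unfolding g by (auto intro!: derivative_eq_intros)
  then show "\<exists>h. (\<exists>a b. h = (\<lambda>x. a * x + b)) \<and> (\<forall>x. (g has_real_derivative h x) (at x))"
    by blast
qed blast

lemma smooth_const: "smooth (\<lambda>x. c)"
  using smooth_affine[of 0 c] by simp

lemma smooth_power: "smooth (\<lambda>x. x ^ n)"
  by (induction n) (use smooth_affine[of 1 0] in \<open>auto intro: smooth_mult smooth_const\<close>)

lemma smooth_sum: "(\<And>i. i \<in> A \<Longrightarrow> smooth (f i)) \<Longrightarrow> smooth (\<lambda>x. \<Sum>i\<in>A. f i x)"
  by (induction A rule: infinite_finite_induct) (auto intro: smooth_add smooth_const)

lemma smooth_compose_affine: "smooth f \<Longrightarrow> smooth (\<lambda>x. f (a * x + b))"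
proof (rule smooth_coinduct[of "\<lambda>g. \<exists>c f. smooth f \<and> g = (\<lambda>x. c * f (a * x + b))"])
  assume "smooth f"
  then show "\<exists>c h. smooth h \<and> (\<lambda>x. f (a * x + b)) = (\<lambda>x. c * h (a * x + b))"
    by (intro exI[of _ 1] exI[of _ f]) auto
next
  fix g assume "\<exists>c f. smooth f \<and> g = (\<lambda>x. c * f (a * x + b))"
  then obtain c f where f: "smooth f" and g: "g = (\<lambda>x. c * f (a * x + b))" by blast
  have "(g has_real_derivative c * (deriv f (a * x + b) * a)) (at x)" for x
    unfolding g
    by (rule DERIV_cmult, rule DERIV_chain2[OF smooth_deriv(2)[OF f]]) (auto intro!: derivative_eq_intros)
  then show "\<exists>h. (\<exists>c f. smooth f \<and> h = (\<lambda>x. c * f (a * x + b))) \<and> (\<forall>x. (g has_real_derivative h x) (at x))"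
  proof (intro exI conjI allI)
    show "smooth (deriv f)" by (rule smooth_deriv(1)[OF f])
    show "(\<lambda>x. c * (deriv f (a * x + b) * a)) = (\<lambda>x. (c * a) * deriv f (a * x + b))"
      by (simp add: mult_ac)
  qed
qed

text \<open>Unlike a usual cut-off function this one never reaches the value 1. It tends to 1 at infinity, which suffices
  since only rescaled limits are taken.\<close>
definition smooth_step :: "real \<Rightarrow> real" where
  "smooth_step x = (if x > 0 then exp (- 1 / x) else 0)"

lemma poly_mult_power_div_exp_tendsto_0:
  "((\<lambda>t::real. t ^ k * poly p t / exp t) \<longlongrightarrow> 0) at_top"
proof (induction p arbitrary: k)
  case (pCons a p)
  have "((\<lambda>t::real. a * (t ^ k / exp t) + t ^ Suc k * poly p t / exp t) \<longlongrightarrow> a * 0 + 0) at_top"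
    by (intro tendsto_intros tendsto_power_div_exp_0 pCons)
  then show ?case by (simp add: algebra_simps add_divide_distrib)
qed simp

text \<open>The functions that equal \<open>P (1/x) exp (-1/x)\<close> for \<open>x > 0\<close>, with a polynomial \<open>P\<close>, and vanish elsewhere are
  closed under differentiation, since \<open>exp\<close> beats every polynomial.\<close>
lemma smooth_smooth_step: "smooth smooth_step"
proof (rule smooth_coinduct[of "\<lambda>g. \<exists>p. g = (\<lambda>x. if x > 0 then poly p (1 / x) * exp (- 1 / x) else 0)"])
  show "\<exists>p. smooth_step = (\<lambda>x. if x > 0 then poly p (1 / x) * exp (- 1 / x) else 0)"
    by (rule exI[of _ 1]) (auto simp: smooth_step_def)
next
  fix g :: "real \<Rightarrow> real"
  assume "\<exists>p. g = (\<lambda>x. if x > 0 then poly p (1 / x) * exp (- 1 / x) else 0)"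
  then obtain p where g: "g = (\<lambda>x. if x > 0 then poly p (1 / x) * exp (- 1 / x) else 0)" by blast
  define q where "q = [:0, 0, 1:] * (p - pderiv p)"
  define h where "h = (\<lambda>x. if x > 0 then poly q (1 / x) * exp (- 1 / x) else 0)"
  have "(g has_real_derivative h x) (at x)" for x
  proof (cases x "0::real" rule: linorder_cases)
    case less
    have "((\<lambda>x. 0) has_real_derivative h x) (at x)" using less by (simp add: h_def)
    then show ?thesis
      by (rule has_field_derivative_transform_within_open[of _ _ _ "{..<0}"]) (use less in \<open>auto simp: g\<close>)
  next
    case greater
    have "((\<lambda>x. poly p (1 / x) * exp (- 1 / x)) has_real_derivative
        (poly (pderiv p) (1/x) * (- 1 / x\<^sup>2)) * exp (- 1 / x) + exp (-1 / x) * (1 / x\<^sup>2) * poly p (1 / x)) (at x)"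
      using greater
      by (auto intro!: derivative_eq_intros DERIV_chain2[OF poly_DERIV] simp: power2_eq_square)
    also have "(poly (pderiv p) (1/x) * (- 1 / x\<^sup>2)) * exp (- 1 / x) + exp (-1 / x) * (1 / x\<^sup>2) * poly p (1 / x)
      = h x" using greater by (simp add: h_def q_def algebra_simps power2_eq_square)
    finally show ?thesis
      by (rule has_field_derivative_transform_within_open[of _ _ _ "{0<..}"]) (use greater in \<open>auto simp: g\<close>)
  next
    case equal
    have "((\<lambda>y. g y / y) \<longlongrightarrow> 0) (at_right 0)"
    proof -
      have "((\<lambda>y. (inverse y) ^ 1 * poly p (inverse y) / exp (inverse y)) \<longlongrightarrow> 0) (at_right 0)"
        by (rule filterlim_compose[OF poly_mult_power_div_exp_tendsto_0 filterlim_inverse_at_top_right])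
      then show ?thesis
        by (rule Lim_transform_eventually)
          (auto simp: g eventually_at_right_field exp_minus field_simps intro!: exI[of _ 1])
    qed
    moreover have "((\<lambda>y. g y / y) \<longlongrightarrow> 0) (at_left 0)"
      by (rule Lim_transform_eventually[OF tendsto_const[of 0]])
        (auto simp: g eventually_at_left_field intro!: exI[of _ "-1"])
    ultimately have "((\<lambda>y. g y / y) \<longlongrightarrow> 0) (at 0)" by (rule filterlim_split_at[rotated])
    then show ?thesis using equal by (simp add: has_field_derivative_iff g h_def)
  qed
  then show "\<exists>h. (\<exists>p. h = (\<lambda>x. if x > 0 then poly p (1 / x) * exp (- 1 / x) else 0)) \<and>
      (\<forall>x. (g has_real_derivative h x) (at x))"
    unfolding h_def by blast
qed

lemma smooth_step_bounds: "0 \<le> smooth_step x" "smooth_step x \<le> 1"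
  by (auto simp: smooth_step_def)

lemma smooth_step_tendsto: "filterlim f at_top F \<Longrightarrow> ((\<lambda>k. smooth_step (f k)) \<longlongrightarrow> 1) F"
proof -
  assume f: "filterlim f at_top F"
  have "((\<lambda>x. exp (- 1 / x)) \<longlongrightarrow> 1) (at_top :: real filter)"
    using tendsto_exp[OF tendsto_divide_0[OF tendsto_const[of "-1::real"] filterlim_at_top_imp_at_infinity[OF filterlim_ident]]]
    by simp
  then have "(smooth_step \<longlongrightarrow> 1) at_top"
    by (rule Lim_transform_eventually) (auto simp: smooth_step_def eventually_at_top_dense intro!: exI[of _ 0])
  then show ?thesis using f by (rule filterlim_compose)
qed

text \<open>The shifts by 1 keep the support at distance \<open>1/k\<close> from \<open>-1\<close> and \<open>b\<close>, hence compact in \<open>(-1,1)\<close> for \<open>b \<le> 1\<close>.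
  As \<open>k\<close> grows the functions converge on \<open>(-1,1)\<close> to the indicator of the points below \<open>b\<close>, so that integrals against
  them converge to \<open>prim\<close>.\<close>
definition cutoff :: "real \<Rightarrow> nat \<Rightarrow> real \<Rightarrow> real" where
  "cutoff b k x = smooth_step (real k * (x + 1) - 1) * smooth_step (real k * (b - x) - 1)"

lemma cutoff_bounds: "0 \<le> cutoff b k x" "cutoff b k x \<le> 1"
  using smooth_step_bounds mult_mono[of "smooth_step (real k * (x + 1) - 1)" 1 "smooth_step (real k * (b - x) - 1)" 1]
  by (auto simp: cutoff_def)

lemma cutoff_abs_le: "\<bar>cutoff b k x\<bar> \<le> 1"
  using cutoff_bounds[of b k x] by simp

lemma smooth_cutoff: "smooth (cutoff b k)"
proof -
  have "smooth (\<lambda>x. smooth_step (real k * x + (real k - 1)) * smooth_step (- real k * x + (real k * b - 1)))"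
    by (intro smooth_mult smooth_compose_affine smooth_smooth_step)
  then show ?thesis unfolding cutoff_def[abs_def] by (simp add: algebra_simps)
qed

lemma cutoff_zero:
  assumes "b \<le> 1" "0 < k" "x \<notin> {-1 + 1 / real k .. 1 - 1 / real k}"
  shows "cutoff b k x = 0"
proof (cases "x < -1 + 1 / real k")
  case True
  then have "real k * (x + 1) < real k * (1 / real k)" using assms by (intro mult_strict_left_mono) auto
  then show ?thesis using assms by (simp add: cutoff_def smooth_step_def)
next
  case False
  then have "real k * (b - x) < real k * (1 / real k)" using assms by (intro mult_strict_left_mono) auto
  then show ?thesis using assms by (simp add: cutoff_def smooth_step_def)
qed

lemma cutoff_tendsto:
  assumes "-1 < x" shows "(\<lambda>k. cutoff b k x) \<longlonglongrightarrow> indicat_real {..<b} x"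
proof -
  have lim: "(\<lambda>k. smooth_step (real k * c - 1)) \<longlonglongrightarrow> 1" if "c > 0" for c
  proof (rule smooth_step_tendsto)
    have "filterlim (\<lambda>k. real k * c) at_top sequentially"
      using that by (intro filterlim_at_top_mult_tendsto_pos[OF tendsto_const] filterlim_real_sequentially) auto
    then have "filterlim (\<lambda>k. - 1 + real k * c) at_top sequentially"
      by (intro filterlim_tendsto_add_at_top[OF tendsto_const])
    then show "filterlim (\<lambda>k. real k * c - 1) at_top sequentially" by (simp add: add.commute)
  qed
  show ?thesis
  proof (cases "x < b")
    case True
    then show ?thesis using tendsto_mult[OF lim[of "x + 1"] lim[of "b - x"]] assms
      by (simp add: cutoff_def)
  next
    case False
    then have "real k * (b - x) - 1 \<le> 0" for k :: nat
      using mult_nonneg_nonpos[of "real k" "b - x"] by linarith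
    then have "cutoff b k x = 0" for k by (simp add: cutoff_def smooth_step_def not_less[symmetric])
    then show ?thesis using False by simp
  qed
qed

lemma L2_cutoff: "cutoff b k \<in> L2"
  by (intro L2_continuous smooth_continuous smooth_cutoff)

lemma integral_cutoff_tendsto:
  assumes u: "u \<in> L2"
  shows "(\<lambda>k. LINT t|leb_I. u t * cutoff b k t) \<longlonglongrightarrow> prim u b"
  unfolding prim_def
proof (rule integral_dominated_convergence[where w="\<lambda>t. \<bar>u t\<bar>"])
  show "AE t in leb_I. (\<lambda>k. u t * cutoff b k t) \<longlonglongrightarrow> indicat_real {..<b} t * u t"
  proof (rule AE_I2)
    fix t assume "t \<in> space leb_I"
    then show "(\<lambda>k. u t * cutoff b k t) \<longlonglongrightarrow> indicat_real {..<b} t * u t"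
      using tendsto_mult[OF tendsto_const[of "u t"] cutoff_tendsto[of t b]] by (simp add: mult.commute)
  qed
  show "AE t in leb_I. norm (u t * cutoff b k t) \<le> \<bar>u t\<bar>" for k
    using mult_left_mono[OF cutoff_abs_le, of "\<bar>u t\<bar>" b k for t] by (intro AE_I2) (simp add: abs_mult)
  show "(\<lambda>t. indicat_real {..<b} t * u t) \<in> borel_measurable leb_I"
    using u by (intro L2_measurable L2_intros) auto
  show "(\<lambda>t. u t * cutoff b k t) \<in> borel_measurable leb_I" for k
    using u L2_cutoff by (intro borel_measurable_times L2_measurable)
  show "integrable leb_I (\<lambda>t. \<bar>u t\<bar>)" using u by (intro L2_integrable L2_intros)
qed

lemma AE_zero_if_cutoff:
  assumes u: "u \<in> L2" and z: "\<And>b k. b \<le> 1 \<Longrightarrow> 2 \<le> k \<Longrightarrow> (LINT t|leb_I. u t * cutoff b k t) = 0"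
  shows "AE x in leb_I. u x = 0"
proof (rule AE_zero_if_prim_zero[OF u])
  fix x :: real assume x: "x \<in> {-1..1}"
  have "(\<lambda>k. LINT t|leb_I. u t * cutoff x k t) \<longlonglongrightarrow> 0"
    by (rule Lim_transform_eventually[OF tendsto_const])
      (use z x in \<open>auto simp: eventually_sequentially intro!: exI[of _ 2]\<close>)
  with integral_cutoff_tendsto[OF u, of x] show "prim u x = 0" by (rule LIMSEQ_unique)
qed

lemma integral_cutoff_pos: "0 < (LINT t|leb_I. cutoff 1 4 t)"
proof -
  have "exp (-1) * (1/2) = (LINT t|leb_I. exp (-1) * indicat_real {-1/4..<1/4} t)"
    using measure_leb_I_Ico[of "-1/4" "1/4"] by simp
  also have "\<dots> \<le> (LINT t|leb_I. cutoff 1 4 t)"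
  proof (rule integral_mono)
    show "integrable leb_I (\<lambda>t. exp (- 1) * indicat_real {- 1 / 4..<1 / 4} t)"
      using ind_integrable[OF L2_integrable[OF L2_const[of 1]], of "{-1/4..<1/4}"] by simp
    show "integrable leb_I (cutoff 1 4)" by (intro L2_integrable L2_cutoff)
    fix t :: real
    show "exp (- 1) * indicat_real {- 1 / 4..<1 / 4} t \<le> cutoff 1 4 t"
    proof (cases "t \<in> {-1/4..<1/4}")
      case True
      have *: "exp (- 1/2) \<le> smooth_step s" if "s \<ge> 2" for s
        using that by (simp add: smooth_step_def divide_simps)
      have "exp (-1) = exp (-1/2) * exp (- 1/2 :: real)" by (simp flip: exp_add)
      also have "\<dots> \<le> cutoff 1 4 t" unfolding cutoff_def
        using True by (intro mult_mono * smooth_step_bounds) auto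
      finally show ?thesis using True by simp
    qed (use cutoff_bounds in simp)
  qed
  finally show ?thesis by (rule less_le_trans[rotated]) simp
qed

section \<open>Weak derivatives\<close>

lemma test_funI:
  assumes "smooth f" "-1 < c" "d < 1" "\<And>x. x \<notin> {c..d} \<Longrightarrow> f x = 0"
  shows "test_fun f"
proof -
  have "closure {x. f x \<noteq> 0} \<subseteq> {c..d}"
  proof (rule closure_minimal)
    show "{x. f x \<noteq> 0} \<subseteq> {c..d}" using assms(4) by blast
  qed simp
  moreover from this have "compact (closure {x. f x \<noteq> 0})"
    by (meson bounded_closed_interval bounded_subset closed_closure compact_eq_bounded_closed)
  ultimately show ?thesis using assms(1-3) by (fastforce simp: test_fun_def smooth_def)
qed

lemma test_fun_smooth: "test_fun f \<Longrightarrow> smooth f"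
  by (simp add: test_fun_def smooth_def)

lemma test_fun_zero: "test_fun f \<Longrightarrow> x \<notin> {-1<..<1} \<Longrightarrow> f x = 0"
  using closure_subset[of "{x. f x \<noteq> 0}"] unfolding test_fun_def by blast

lemma test_fun_cutoff: "b \<le> 1 \<Longrightarrow> 2 \<le> k \<Longrightarrow> test_fun (cutoff b k)"
  by (rule test_funI[where c="-1 + 1 / real k" and d="1 - 1 / real k"])
    (auto simp: smooth_cutoff intro!: cutoff_zero)

lemma ac_deriv_smooth: "smooth f \<Longrightarrow> ac_deriv f (deriv f)"
  by (rule ac_deriv_classical[of "{}"])
    (auto intro: smooth_continuous L2_continuous smooth_deriv)

text \<open>The mean zero makes the primitive vanish to the right of the support of \<open>g\<close> as well.\<close>
lemma test_fun_antiderivative: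
  assumes g: "smooth g" and cd: "-1 < c" "c \<le> d" "d < 1" "\<And>x. x \<notin> {c..d} \<Longrightarrow> g x = 0"
    and mean: "(LINT t|leb_I. g t) = 0"
  shows "test_fun (prim g)" "deriv (prim g) = g"
proof -
  have L: "g \<in> L2" by (intro L2_continuous smooth_continuous g)
  have left: "prim g x = 0" if "x \<le> c" for x
  proof -
    have "prim g x = (LINT t|leb_I. 0)" unfolding prim_def
      by (rule Bochner_Integration.integral_cong) (use that cd(4) in \<open>auto simp: indicator_def\<close>)
    then show ?thesis by simp
  qed
  have right: "prim g x = 0" if "x > d" for x
  proof -
    have "prim g x = (LINT t|leb_I. g t)" unfolding prim_def
      by (rule Bochner_Integration.integral_cong) (use that cd(4) in \<open>auto simp: indicator_def\<close>)
    then show ?thesis using mean by simp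
  qed
  have D: "(prim g has_real_derivative g x) (at x)" for x
  proof (cases "x \<in> {-1<..<1}")
    case True
    have "((\<lambda>x. integral {-1..x} g) has_real_derivative g x) (at x within {-1..1})"
      using True by (intro integral_has_real_derivative smooth_continuous g) auto
    then have "((\<lambda>x. integral {-1..x} g) has_real_derivative g x) (at x within {-1<..<1})"
      by (rule DERIV_subset) auto
    then have "((\<lambda>x. integral {-1..x} g) has_real_derivative g x) (at x)"
      unfolding at_within_open[OF True open_greaterThanLessThan] .
    then show ?thesis
      by (rule has_field_derivative_transform_within_open[of _ _ _ "{-1<..<1}"])
        (use True in \<open>auto intro!: integral_unique prim_has_integral L\<close>)
  next
    case False
    have "g x = 0" by (rule cd(4)) (use cd False in auto)
    then have z: "((\<lambda>x. 0) has_real_derivative g x) (at x)" by simp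
    show ?thesis
    proof (cases "x < c")
      case True
      show ?thesis
        by (rule has_field_derivative_transform_within_open[OF z, of "{..<c}"]) (use True left in auto)
    next
      case False
      show ?thesis
        by (rule has_field_derivative_transform_within_open[OF z, of "{d<..}"])
          (use False \<open>x \<notin> {-1<..<1}\<close> cd right in auto)
    qed
  qed
  then show "deriv (prim g) = g" by (auto intro: DERIV_imp_deriv)
  show "test_fun (prim g)"
    by (rule test_funI[of _ c d]) (use smooth_antiderivative[OF g D] cd left right in auto)
qed

text \<open>Subtracting a multiple of one fixed bump from a cut-off function gives mean zero and hence the derivative of a
  test function. So the integrals of \<open>v\<close> against cut-off functions are those of a constant, and cut-off functions
  separate \<open>L\<^sub>2\<close> functions.\<close>
lemma du_Bois_Reymond:
  assumes v: "v \<in> L2" and z: "\<And>\<phi>. test_fun \<phi> \<Longrightarrow> (LINT t|leb_I. v t * deriv \<phi> t) = 0"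
  shows "\<exists>c. AE x in leb_I. v x = c"
proof -
  define I where "I = (\<lambda>w::real \<Rightarrow> real. LINT t|leb_I. w t)"
  define p where "p = cutoff 1 4"
  define c where "c = I (\<lambda>t. v t * p t) / I p"
  have Ip: "0 < I p" using integral_cutoff_pos by (simp add: I_def p_def)
  have Lp: "p \<in> L2" by (simp add: p_def L2_cutoff)
  have "AE x in leb_I. v x - c = 0"
  proof (rule AE_zero_if_cutoff)
    show "(\<lambda>x. v x - c) \<in> L2" using v by (intro L2_intros)
    fix b :: real and k :: nat assume bk: "b \<le> 1" "2 \<le> k"
    define q where "q = cutoff b k"
    have Lq: "q \<in> L2" by (simp add: q_def L2_cutoff)
    define s where "s = I q / I p"
    define g where "g = (\<lambda>t. q t + (- s) * p t)"
    define m where "m = max k 4"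
    have Ig: "I g = 0" using Ip Lp Lq by (simp add: g_def I_def s_def L2_integrable)
    have sg: "smooth g" unfolding g_def p_def q_def
      by (intro smooth_add smooth_mult smooth_const smooth_cutoff)
    have le: "1 / real m \<le> 1 / real k" "1 / real m \<le> 1 / 4" "1 / real m \<le> 1/2"
      using bk by (auto simp: m_def intro!: divide_left_mono)
    have gz: "g x = 0" if "x \<notin> {-1 + 1 / real m .. 1 - 1 / real m}" for x
      using cutoff_zero[of b k x] cutoff_zero[of 1 4 x] that le bk
      by (auto simp: g_def p_def q_def)
    have mm: "-1 < -1 + 1 / real m" "-1 + 1 / real m \<le> 1 - 1 / real m" "1 - 1 / real m < 1"
    proof -
      have "0 < 1 / real m" by (simp add: m_def)
      with le(3) show "-1 < -1 + 1 / real m" "-1 + 1 / real m \<le> 1 - 1 / real m" "1 - 1 / real m < 1"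
        by linarith+
    qed
    have "(LINT t|leb_I. v t * deriv (prim g) t) = 0"
      by (rule z[OF test_fun_antiderivative(1)[OF sg mm gz]]) (use Ig in \<open>auto simp: I_def\<close>)
    moreover have "deriv (prim g) = g"
      by (rule test_fun_antiderivative(2)[OF sg mm gz]) (use Ig in \<open>auto simp: I_def\<close>)
    ultimately have "I (\<lambda>t. v t * g t) = 0" by (simp add: I_def)
    moreover have "I (\<lambda>t. v t * g t) = I (\<lambda>t. v t * q t) - s * I (\<lambda>t. v t * p t)"
      using L2_mult_integrable[OF v Lq] L2_mult_integrable[OF v Lp]
      by (simp add: g_def I_def algebra_simps)
    ultimately have "I (\<lambda>t. v t * q t) = c * I q" by (simp add: s_def c_def)
    then show "(LINT t|leb_I. (v t - c) * cutoff b k t) = 0"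
      using L2_mult_integrable[OF v Lq] L2_integrable[OF Lq]
      by (simp add: I_def left_diff_distrib q_def[symmetric])
  qed
  then show ?thesis by auto
qed

lemma ac_deriv_test_fun:
  assumes "test_fun \<phi>"
  shows "ac_deriv \<phi> (deriv \<phi>)" "\<phi> (-1) = 0" "\<phi> 1 = 0"
  using assms test_fun_zero[of \<phi> "-1"] test_fun_zero[of \<phi> 1] ac_deriv_smooth[OF test_fun_smooth]
  by auto

lemma ac_deriv_imp_weak_deriv:
  assumes "ac_deriv F u" shows "has_weak_deriv F u"
  unfolding has_weak_deriv_def
proof (intro conjI allI impI)
  fix \<phi> assume \<phi>: "test_fun \<phi>"
  show "(LINT x|leb_I. F x * deriv \<phi> x) = - (LINT x|leb_I. u x * \<phi> x)"
    using integration_by_parts[OF assms ac_deriv_test_fun(1)[OF \<phi>]] ac_deriv_test_fun(2,3)[OF \<phi>] by simp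
qed (use assms ac_deriv_L2 ac_deriv_L2_fun in auto)

lemma has_weak_deriv_cong_AE:
  assumes "has_weak_deriv v g" "AE x in leb_I. v x = w x" "AE x in leb_I. g x = h x"
  shows "has_weak_deriv w h"
  unfolding has_weak_deriv_def
proof (intro conjI allI impI)
  have L: "v \<in> L2" "g \<in> L2" using assms(1) by (auto simp: has_weak_deriv_def)
  show "w \<in> L2" "h \<in> L2" using L2_AE[OF L(1) assms(2)] L2_AE[OF L(2) assms(3)] by auto
  fix \<phi> assume \<phi>: "test_fun \<phi>"
  note D = ac_deriv_test_fun(1)[OF \<phi>]
  have "(LINT x|leb_I. w x * deriv \<phi> x) = (LINT x|leb_I. v x * deriv \<phi> x)"
    using assms(2) by (intro integral_cong_AE_leb_I[symmetric] borel_measurable_times L2_measurable L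
      ac_deriv_L2[OF D]) (auto elim: eventually_mono)
  also have "\<dots> = - (LINT x|leb_I. g x * \<phi> x)"
    using assms(1) \<phi> by (auto simp: has_weak_deriv_def)
  also have "(LINT x|leb_I. g x * \<phi> x) = (LINT x|leb_I. h x * \<phi> x)"
    using assms(3) by (intro integral_cong_AE_leb_I borel_measurable_times L2_measurable L
      ac_deriv_L2_fun[OF D]) (auto elim: eventually_mono)
  finally show "(LINT x|leb_I. w x * deriv \<phi> x) = - (LINT x|leb_I. h x * \<phi> x)" .
qed

text \<open>\<open>v\<close> and \<open>prim g\<close> have the same weak derivative, so they differ by a constant.\<close>
lemma weak_deriv_imp_ac_deriv:
  assumes "has_weak_deriv v g"
  obtains F where "ac_deriv F g" "AE x in leb_I. v x = F x"
proof -
  have L: "v \<in> L2" "g \<in> L2" using assms by (auto simp: has_weak_deriv_def)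
  have P: "ac_deriv (prim g) g" by (rule ac_deriv_prim[OF L(2)])
  have "\<exists>c. AE x in leb_I. v x - prim g x = c"
  proof (rule du_Bois_Reymond)
    show "(\<lambda>x. v x - prim g x) \<in> L2" using L by (intro L2_intros)
    fix \<phi> assume \<phi>: "test_fun \<phi>"
    note D = ac_deriv_L2[OF ac_deriv_test_fun(1)[OF \<phi>]]
    have "(LINT x|leb_I. prim g x * deriv \<phi> x) = (LINT x|leb_I. v x * deriv \<phi> x)"
      using ac_deriv_imp_weak_deriv[OF P] assms \<phi> by (auto simp: has_weak_deriv_def)
    then show "(LINT t|leb_I. (v t - prim g t) * deriv \<phi> t) = 0"
      using L2_mult_integrable[OF L(1) D] L2_mult_integrable[OF prim_L2[OF L(2)] D]
      by (simp add: left_diff_distrib)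
  qed
  then obtain c where c: "AE x in leb_I. v x - prim g x = c" by blast
  have "ac_deriv (\<lambda>x. c + prim g x) (\<lambda>x. 0 + g x)"
    by (intro ac_deriv_add ac_deriv_const P)
  moreover have "AE x in leb_I. v x = c + prim g x" using c by eventually_elim simp
  ultimately show ?thesis using that by simp
qed

lemma has_weak_deriv_unique:
  assumes "has_weak_deriv v g" "has_weak_deriv v h"
  shows "AE x in leb_I. g x = h x"
proof -
  have L: "g \<in> L2" "h \<in> L2" using assms by (auto simp: has_weak_deriv_def)
  have "AE x in leb_I. g x - h x = 0"
  proof (rule AE_zero_if_cutoff)
    show "(\<lambda>x. g x - h x) \<in> L2" using L by (intro L2_intros)
    fix b :: real and k :: nat assume "b \<le> 1" "2 \<le> k"
    then have "(LINT x|leb_I. g x * cutoff b k x) = (LINT x|leb_I. h x * cutoff b k x)"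
      using assms test_fun_cutoff[of b k] by (auto simp: has_weak_deriv_def)
    then show "(LINT t|leb_I. (g t - h t) * cutoff b k t) = 0"
      using L2_mult_integrable[OF L(1) L2_cutoff] L2_mult_integrable[OF L(2) L2_cutoff]
      by (simp add: left_diff_distrib)
  qed
  then show ?thesis by auto
qed

lemma weak_deriv_eq:
  assumes "has_weak_deriv v g" shows "AE x in leb_I. weak_deriv v x = g x"
  unfolding weak_deriv_def by (rule has_weak_deriv_unique[OF someI[of "has_weak_deriv v"]]) (rule assms)+

lemma Sobolev_1_representative:
  assumes "v \<in> Sobolev 1"
  obtains F u where "ac_deriv F u" "AE x in leb_I. v x = F x"
  using assms weak_deriv_imp_ac_deriv unfolding One_nat_def Sobolev.simps by blast

lemma Sobolev_2_representative:
  assumes "v \<in> Sobolev 2"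
  obtains F G u where "ac_deriv F G" "ac_deriv G u" "AE x in leb_I. v x = F x"
proof -
  obtain g where g: "g \<in> Sobolev 1" "has_weak_deriv v g"
    using assms unfolding numeral_2_eq_2 One_nat_def by auto
  obtain G u where G: "ac_deriv G u" "AE x in leb_I. g x = G x"
    by (rule Sobolev_1_representative[OF g(1)])
  obtain F where F: "ac_deriv F g" "AE x in leb_I. v x = F x"
    by (rule weak_deriv_imp_ac_deriv[OF g(2)])
  show ?thesis by (rule that[OF ac_deriv_cong_AE[OF F(1) G(2)] G(1) F(2)])
qed

lemma H1_seminorm_eq: 
  assumes "has_weak_deriv v g" shows "H1_seminorm v = L2_norm g"
proof -
  have "g \<in> L2" using assms by (simp add: has_weak_deriv_def)
  moreover have "AE x in leb_I. g x = weak_deriv v x"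
    using weak_deriv_eq[OF assms] by eventually_elim simp
  ultimately show ?thesis unfolding H1_seminorm_def using L2_norm_cong_AE by metis
qed

text \<open>Test functions vanish at the end points, and point values are bounded by the \<open>H\<^sup>1\<close> norm.\<close>
lemma H10_boundary_values:
  assumes y: "y \<in> H10" and F: "ac_deriv F u" and ae: "AE x in leb_I. y x = F x"
  shows "F (-1) = 0" "F 1 = 0"
proof -
  have bound: "\<bar>F (-1)\<bar> \<le> 3 * e \<and> \<bar>F 1\<bar> \<le> 5 * e" if e: "e > 0" for e
  proof -
    obtain \<phi> where \<phi>: "test_fun \<phi>" "H1_norm (\<lambda>x. y x - \<phi> x) < e"
      using y e unfolding H10_def by blast
    note T = ac_deriv_test_fun[OF \<phi>(1)]
    have D: "ac_deriv (\<lambda>x. F x - \<phi> x) (\<lambda>x. u x - deriv \<phi> x)" by (intro ac_deriv_diff F T)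
    define g where "g = (\<lambda>x. u x - deriv \<phi> x)"
    define z where "z = (\<lambda>x. F x - \<phi> x)"
    have Dz: "ac_deriv z g" using D by (simp add: z_def g_def)
    have Lz: "z \<in> L2" and Lg: "g \<in> L2" using ac_deriv_L2[OF Dz] ac_deriv_L2_fun[OF Dz] by auto
    have aez: "AE x in leb_I. z x = y x - \<phi> x" using ae by eventually_elim (simp add: z_def)
    have wd: "has_weak_deriv (\<lambda>x. y x - \<phi> x) g"
      by (rule has_weak_deriv_cong_AE[OF ac_deriv_imp_weak_deriv[OF Dz] aez]) simp
    have "H1_norm (\<lambda>x. y x - \<phi> x) = sqrt ((L2_norm z)\<^sup>2 + (L2_norm g)\<^sup>2)"
      unfolding H1_norm_def H1_seminorm_eq[OF wd] L2_norm_cong_AE[OF Lz aez] ..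
    then have "sqrt ((L2_norm z)\<^sup>2 + (L2_norm g)\<^sup>2) < e" using \<phi>(2) by simp
    moreover have "L2_norm z \<le> sqrt ((L2_norm z)\<^sup>2 + (L2_norm g)\<^sup>2)"
      "L2_norm g \<le> sqrt ((L2_norm z)\<^sup>2 + (L2_norm g)\<^sup>2)"
      by (auto intro!: real_le_rsqrt)
    ultimately have b: "L2_norm z \<le> e" "L2_norm g \<le> e" by linarith+
    have "sqrt 2 * \<bar>F (-1)\<bar> = L2_norm (\<lambda>x. z x + (- prim g x))"
    proof -
      have "L2_norm (\<lambda>x. z x + (- prim g x)) = L2_norm (\<lambda>x. F (-1))"
      proof (rule L2_norm_cong_AE)
        show "(\<lambda>x. z x + (- prim g x)) \<in> L2" using Lz Lg by (intro L2_intros)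
        show "AE x in leb_I. z x + (- prim g x) = F (-1)"
          using ac_deriv_eq[OF Dz] by (intro AE_I2) (simp add: z_def T(2))
      qed
      then show ?thesis by simp
    qed
    also have "\<dots> \<le> L2_norm z + L2_norm (\<lambda>x. - prim g x)"
      using Lz Lg by (intro L2_norm_triangle L2_intros)
    also have "\<dots> \<le> e + 2 * e" using b prim_norm[OF Lg] by simp
    finally have "sqrt 2 * \<bar>F (-1)\<bar> \<le> 3 * e" by simp
    moreover have "1 * \<bar>F (-1)\<bar> \<le> sqrt 2 * \<bar>F (-1)\<bar>" by (intro mult_right_mono) auto
    ultimately have F1: "\<bar>F (-1)\<bar> \<le> 3 * e" by linarith
    have "F 1 = F (-1) + prim g 1" using ac_deriv_eq[OF Dz, of 1] T by (simp add: z_def)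
    moreover have "\<bar>prim g 1\<bar> \<le> 2 * e"
    proof -
      have "\<bar>prim g 1\<bar> \<le> sqrt 2 * L2_norm g" by (rule prim_abs_le[OF Lg]) simp
      also have "\<dots> \<le> 2 * e" using b(2) e by (intro mult_mono) (auto intro: real_le_lsqrt)
      finally show ?thesis .
    qed
    ultimately show ?thesis using F1 by linarith
  qed
  show "F (-1) = 0"
  proof (rule ccontr)
    assume "F (-1) \<noteq> 0" then show False using bound[of "\<bar>F (-1)\<bar> / 6"] by auto
  qed
  show "F 1 = 0"
  proof (rule ccontr)
    assume "F 1 \<noteq> 0" then show False using bound[of "\<bar>F 1\<bar> / 10"] by auto
  qed
qed

lemma L2_norm_cutoff_tendsto:
  assumes Q: "Q \<in> L2"
  shows "(\<lambda>k. L2_norm (\<lambda>x. Q x - Q x * cutoff 1 k x)) \<longlonglongrightarrow> 0"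
proof -
  have "(\<lambda>k. LINT x|leb_I. (Q x - Q x * cutoff 1 k x)\<^sup>2) \<longlonglongrightarrow> (LINT x|leb_I. 0)"
  proof (rule integral_dominated_convergence[where w="\<lambda>t. (Q t)\<^sup>2"])
    have m: "(\<lambda>x. Q x - Q x * cutoff 1 k x) \<in> borel_measurable leb_I" for k
      using Q L2_cutoff by (intro borel_measurable_diff borel_measurable_times L2_measurable)
    then show "(\<lambda>x. (Q x - Q x * cutoff 1 k x)\<^sup>2) \<in> borel_measurable leb_I" for k
      by (rule borel_measurable_power)
    show "AE x in leb_I. (\<lambda>k. (Q x - Q x * cutoff 1 k x)\<^sup>2) \<longlonglongrightarrow> 0"
    proof (rule AE_I2)
      fix x assume "x \<in> space leb_I"
      then have "(\<lambda>k. (Q x - Q x * cutoff 1 k x)\<^sup>2) \<longlonglongrightarrow> (Q x - Q x * indicat_real {..<1} x)\<^sup>2"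
        by (intro tendsto_intros cutoff_tendsto) auto
      then show "(\<lambda>k. (Q x - Q x * cutoff 1 k x)\<^sup>2) \<longlonglongrightarrow> 0" using \<open>x \<in> space leb_I\<close> by simp
    qed
    show "AE x in leb_I. norm ((Q x - Q x * cutoff 1 k x)\<^sup>2) \<le> (Q x)\<^sup>2" for k
    proof (rule AE_I2)
      fix x
      have "(Q x - Q x * cutoff 1 k x)\<^sup>2 = (Q x)\<^sup>2 * (1 - cutoff 1 k x)\<^sup>2"
        by (simp add: power_mult_distrib[symmetric] right_diff_distrib)
      also have "\<dots> \<le> (Q x)\<^sup>2 * 1"
        using cutoff_bounds[of 1 k x] by (intro mult_left_mono power_le_one) auto
      finally show "norm ((Q x - Q x * cutoff 1 k x)\<^sup>2) \<le> (Q x)\<^sup>2" by simp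
    qed
  qed (use L2_square_integrable[OF Q] in auto)
  then show ?thesis unfolding L2_norm_def using tendsto_real_sqrt by fastforce
qed

text \<open>The derivative has mean zero and is approximated in \<open>L\<^sub>2\<close> by smooth compactly supported functions of mean zero: a
  Weierstrass polynomial, multiplied by a cut-off function, minus a small multiple of a fixed bump that corrects the mean.
  The primitives of these are the test functions wanted.\<close>
lemma H10_if_boundary_values:
  assumes F: "ac_deriv F P" and P: "continuous_on {-1..1} P" and z: "F (-1) = 0" "F 1 = 0"
  shows "F \<in> H10"
proof -
  have wF: "has_weak_deriv F P" by (rule ac_deriv_imp_weak_deriv[OF F])
  have LP: "P \<in> L2" by (rule ac_deriv_L2[OF F])
  have intP: "(LINT t|leb_I. P t) = 0" using ac_deriv_eq[OF F, of 1] z by simp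
  define p where "p = cutoff 1 4"
  define Ip where "Ip = (LINT t|leb_I. p t)"
  have Ip: "0 < Ip" using integral_cutoff_pos by (simp add: Ip_def p_def)
  have Lp: "p \<in> L2" by (simp add: p_def L2_cutoff)
  have "\<exists>\<phi>. test_fun \<phi> \<and> H1_norm (\<lambda>x. F x - \<phi> x) < e" if e: "e > 0" for e
  proof -
    \<comment> \<open>crude constant for the three approximation steps below, each of which costs a multiple of the tolerance\<close>
    define A where "A = 3 + 4 * L2_norm p / Ip"
    have A: "A > 0" using Ip by (simp add: A_def add_pos_nonneg)
    define \<delta> where "\<delta> = e / (6 * A)"
    have \<delta>: "\<delta> > 0" using e A by (simp add: \<delta>_def)
    obtain Q where Q: "real_polynomial_function Q" "\<And>x. x \<in> {-1..1} \<Longrightarrow> \<bar>P x - Q x\<bar> < \<delta>"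
      using Stone_Weierstrass_real_polynomial_function[OF _ P \<delta>] by blast
    obtain a n where Qeq: "Q = (\<lambda>x. \<Sum>i\<le>n. a i * x ^ i)"
      using Q(1) by (auto simp: real_polynomial_function_iff_sum)
    have sQ: "smooth Q" unfolding Qeq by (intro smooth_sum smooth_mult smooth_const smooth_power)
    have LQ: "Q \<in> L2" by (intro L2_continuous smooth_continuous sQ)
    have "eventually (\<lambda>k. L2_norm (\<lambda>x. Q x - Q x * cutoff 1 k x) < \<delta> \<and> 4 \<le> k) sequentially"
      using order_tendstoD(2)[OF L2_norm_cutoff_tendsto[OF LQ] \<delta>] eventually_ge_at_top[of 4]
      by eventually_elim simp
    then obtain k where k: "L2_norm (\<lambda>x. Q x - Q x * cutoff 1 k x) < \<delta>" "4 \<le> k"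
      unfolding eventually_sequentially by blast
    define R where "R = (\<lambda>x. Q x * cutoff 1 k x)"
    have sR: "smooth R" unfolding R_def by (intro smooth_mult sQ smooth_cutoff)
    have LR: "R \<in> L2" by (intro L2_continuous smooth_continuous sR)
    define c where "c = (LINT t|leb_I. R t) / Ip"
    define g where "g = (\<lambda>x. R x + (- c) * p x)"
    have sg: "smooth g" unfolding g_def p_def by (intro smooth_add smooth_mult smooth_const smooth_cutoff sR)
    have Lg: "g \<in> L2" by (intro L2_continuous smooth_continuous sg)
    have Ig: "(LINT t|leb_I. g t) = 0"
      using Ip Lp LR by (simp add: g_def c_def Ip_def[symmetric] L2_integrable)
    have r: "0 < 1 / real k" "1 / real k \<le> 1 / 4" using k(2) by (auto simp: divide_simps)
    have gz: "g x = 0" if "x \<notin> {-1 + 1 / real k .. 1 - 1 / real k}" for x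
    proof -
      have "x < -1 + 1 / real k \<or> 1 - 1 / real k < x" using that by auto
      then have "\<not> (-1 + 1 / 4 \<le> x \<and> x \<le> 1 - 1 / 4)" using r(2) by linarith
      then have "cutoff 1 4 x = 0" by (intro cutoff_zero) auto
      moreover have "cutoff 1 k x = 0" by (rule cutoff_zero) (use that k(2) in auto)
      ultimately have "cutoff 1 k x = 0" "cutoff 1 4 x = 0" by auto
      then show ?thesis by (simp add: g_def p_def R_def)
    qed
    note T = test_fun_antiderivative(1)[OF sg, of "-1 + 1 / real k" "1 - 1 / real k", OF _ _ _ gz Ig]
    have tf: "test_fun (prim g)"
      using r by (intro T) (assumption | linarith)+
    have PQ: "L2_norm (\<lambda>x. P x - Q x) \<le> sqrt 2 * \<delta>"
      using Q(2) LP LQ by (intro L2_norm_le_sup L2_intros) (auto intro: less_imp_le)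
    have QR: "L2_norm (\<lambda>x. Q x - R x) \<le> \<delta>" using k by (simp add: R_def)
    have PR: "L2_norm (\<lambda>x. P x - R x) \<le> sqrt 2 * \<delta> + \<delta>"
      using L2_norm_triangle[OF L2_diff[OF LP LQ] L2_diff[OF LQ LR]] PQ QR by simp
    have s2: "sqrt 2 \<le> (3/2 :: real)" by (rule real_le_lsqrt) (auto simp: power2_eq_square)
    have PR': "L2_norm (\<lambda>x. P x - R x) \<le> 5/2 * \<delta>"
      using PR mult_right_mono[OF s2, of \<delta>] \<delta> by linarith
    have "\<bar>LINT t|leb_I. R t\<bar> = \<bar>LINT t|leb_I. P t - R t\<bar>"
      using intP LP LR by (simp add: L2_integrable)
    also have "\<dots> \<le> sqrt 2 * L2_norm (\<lambda>x. P x - R x)"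
      by (rule order_trans[OF abs_integral_le integral_abs_le_L2_norm]) (intro L2_intros LP LR)
    also have "\<dots> \<le> (3/2) * (5/2 * \<delta>)"
      by (intro mult_mono s2 PR') auto
    finally have "\<bar>c\<bar> \<le> 4 * \<delta> / Ip"
      using Ip \<delta> by (simp add: c_def divide_right_mono abs_divide)
    then have cp: "\<bar>c\<bar> * L2_norm p \<le> 4 * \<delta> / Ip * L2_norm p" by (intro mult_right_mono) auto
    have "L2_norm (\<lambda>x. P x - g x) = L2_norm (\<lambda>x. (P x - R x) + c * p x)"
      by (simp add: g_def algebra_simps)
    also have "\<dots> \<le> L2_norm (\<lambda>x. P x - R x) + L2_norm (\<lambda>x. c * p x)"
      by (intro L2_norm_triangle L2_intros LP LR Lp)
    also have "\<dots> \<le> 5/2 * \<delta> + 4 * \<delta> / Ip * L2_norm p"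
      using PR' cp by simp
    also have "\<dots> \<le> \<delta> * A" using \<delta> by (simp add: A_def algebra_simps)
    also have "\<dots> = e / 6" using A by (simp add: \<delta>_def)
    finally have Pg: "L2_norm (\<lambda>x. P x - g x) \<le> e / 6" .
    have D: "ac_deriv (\<lambda>x. F x - prim g x) (\<lambda>x. P x - g x)"
      by (intro ac_deriv_diff F ac_deriv_prim Lg)
    have "L2_norm (\<lambda>x. F x - prim g x) = L2_norm (prim (\<lambda>x. P x - g x))"
      using ac_deriv_eq[OF D] z by (intro L2_norm_cong_AE[OF ac_deriv_L2_fun[OF D]] AE_I2) auto
    also have "\<dots> \<le> 2 * (e / 6)" using prim_norm[OF ac_deriv_L2[OF D]] Pg by linarith
    finally have Fg: "L2_norm (\<lambda>x. F x - prim g x) \<le> e / 3" by simp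
    have "H1_norm (\<lambda>x. F x - prim g x) = sqrt ((L2_norm (\<lambda>x. F x - prim g x))\<^sup>2 + (L2_norm (\<lambda>x. P x - g x))\<^sup>2)"
      unfolding H1_norm_def H1_seminorm_eq[OF ac_deriv_imp_weak_deriv[OF D]] ..
    also have "\<dots> \<le> L2_norm (\<lambda>x. F x - prim g x) + L2_norm (\<lambda>x. P x - g x)"
      by (rule sqrt_sum_squares_le_sum) auto
    also have "\<dots> < e" using Fg Pg e by linarith
    finally show ?thesis using tf by blast
  qed
  moreover have "F \<in> Sobolev 1" using wF LP by auto
  ultimately show ?thesis unfolding H10_def by blast
qed

section \<open>The optimal control problem in terms of the derivative of the state\<close>

text \<open>The state \<open>y\<close> is determined only almost everywhere, but its slope \<open>p\<close> is the continuous representative, so that the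
  constraint can be read pointwise. Since \<open>prim p\<close> vanishes at \<open>-1\<close>, the condition
  \<open>prim p 1 = 0\<close> expresses the boundary condition at \<open>1\<close>.\<close>
definition has_slope :: "(real \<Rightarrow> real) \<Rightarrow> (real \<Rightarrow> real) \<Rightarrow> (real \<Rightarrow> real) \<Rightarrow> bool" where
  "has_slope y p r \<longleftrightarrow> ac_deriv p r \<and> prim p 1 = 0 \<and> (AE x in leb_I. y x = prim p x)"

lemma has_slope_weak_deriv:
  assumes "has_slope y p r"
  shows "has_weak_deriv y p" "AE x in leb_I. weak_deriv y x = p x"
    "AE x in leb_I. weak_deriv (weak_deriv y) x = r x"
proof -
  have p: "ac_deriv p r" "AE x in leb_I. prim p x = y x"
    using assms unfolding has_slope_def by (auto elim: eventually_mono)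
  show 1: "has_weak_deriv y p"
    by (rule has_weak_deriv_cong_AE[OF ac_deriv_imp_weak_deriv[OF ac_deriv_prim[OF ac_deriv_L2_fun[OF p(1)]]] p(2)]) simp
  show 2: "AE x in leb_I. weak_deriv y x = p x" by (rule weak_deriv_eq[OF 1])
  show "AE x in leb_I. weak_deriv (weak_deriv y) x = r x"
  proof (rule weak_deriv_eq, rule has_weak_deriv_cong_AE[OF ac_deriv_imp_weak_deriv[OF p(1)]])
    show "AE x in leb_I. p x = weak_deriv y x" using 2 by eventually_elim simp
  qed simp
qed

lemma Sobolev_2_H10_has_slope:
  assumes "y \<in> Sobolev 2 \<inter> H10"
  obtains p r where "has_slope y p r"
proof -
  obtain F p r where F: "ac_deriv F p" "ac_deriv p r" "AE x in leb_I. y x = F x"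
    using Sobolev_2_representative assms by blast
  have b: "F (-1) = 0" "F 1 = 0" using H10_boundary_values[OF _ F(1,3)] assms by auto
  have e: "F x = prim p x" if "x \<in> {-1..1}" for x using ac_deriv_eq[OF F(1) that] b by simp
  have "AE x in leb_I. F x = prim p x" by (rule AE_I2) (simp add: e)
  then have "AE x in leb_I. y x = prim p x" using F(3) by eventually_elim simp
  moreover have "prim p 1 = 0" using e[of 1] b by simp
  ultimately show ?thesis using that F(2) unfolding has_slope_def by blast
qed

lemma has_slope_prim:
  assumes "ac_deriv p r" "prim p 1 = 0"
  shows "has_slope (prim p) p r" "prim p \<in> Sobolev 2 \<inter> H10"
proof -
  show "has_slope (prim p) p r" using assms by (simp add: has_slope_def)
  have d: "ac_deriv (prim p) p" by (rule ac_deriv_prim[OF ac_deriv_L2_fun[OF assms(1)]])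
  have "prim p \<in> H10" by (rule H10_if_boundary_values[OF d ac_deriv_continuous[OF assms(1)]]) (use assms in auto)
  moreover have "p \<in> Sobolev 1"
    using ac_deriv_imp_weak_deriv[OF assms(1)] ac_deriv_L2[OF assms(1)] by auto
  then have "prim p \<in> Sobolev 2"
    using ac_deriv_imp_weak_deriv[OF d] unfolding numeral_2_eq_2 by auto
  ultimately show "prim p \<in> Sobolev 2 \<inter> H10" by blast
qed

definition slope_cost :: "real \<Rightarrow> (real \<Rightarrow> real) \<Rightarrow> (real \<Rightarrow> real) \<Rightarrow> (real \<Rightarrow> real) \<Rightarrow> (real \<Rightarrow> real) \<Rightarrow> real" where
  "slope_cost \<beta> y\<^sub>d f p r = 1/2 * ((L2_norm (\<lambda>x. prim p x - y\<^sub>d x))\<^sup>2 + \<beta> * (L2_norm (\<lambda>x. r x + f x))\<^sup>2)"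

lemma cost_eq_slope_cost:
  assumes y: "has_slope y p r" and L: "y\<^sub>d \<in> L2" "g \<in> L2" and f: "AE x in leb_I. f x = g x"
  shows "cost \<beta> y\<^sub>d f y = slope_cost \<beta> y\<^sub>d g p r"
proof -
  have p: "ac_deriv p r" "AE x in leb_I. y x = prim p x" using y by (auto simp: has_slope_def)
  have "L2_norm (\<lambda>x. prim p x - y\<^sub>d x) = L2_norm (\<lambda>x. y x - y\<^sub>d x)"
    by (rule L2_norm_cong_AE[OF L2_diff[OF prim_L2[OF ac_deriv_L2_fun[OF p(1)]] L(1)]])
      (use p(2) in eventually_elim, simp)
  moreover have "L2_norm (\<lambda>x. r x + g x) = L2_norm (\<lambda>x. weak_deriv (weak_deriv y) x + f x)"
    by (rule L2_norm_cong_AE[OF L2_add[OF ac_deriv_L2[OF p(1)] L(2)]])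
      (use has_slope_weak_deriv(3)[OF y] f in eventually_elim, simp)
  ultimately show ?thesis by (simp add: cost_def slope_cost_def)
qed

lemma slope_cost_expansion:
  assumes L: "p \<in> L2" "r \<in> L2" "q \<in> L2" "s \<in> L2" "y\<^sub>d \<in> L2" "f \<in> L2"
  shows "slope_cost \<beta> y\<^sub>d f (\<lambda>x. p x + t * q x) (\<lambda>x. r x + t * s x) = slope_cost \<beta> y\<^sub>d f p r
    + t * ((LINT x|leb_I. (prim p x - y\<^sub>d x) * prim q x) + \<beta> * (LINT x|leb_I. (r x + f x) * s x))
    + t\<^sup>2 * (1/2 * ((L2_norm (prim q))\<^sup>2 + \<beta> * (L2_norm s)\<^sup>2))"
proof -
  have e: "(L2_norm (\<lambda>x. a x + t * b x))\<^sup>2 = (L2_norm a)\<^sup>2 + 2 * t * (LINT x|leb_I. a x * b x) + t\<^sup>2 * (L2_norm b)\<^sup>2"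
    if "a \<in> L2" "b \<in> L2" for a b
    using L2_norm_add[OF that(1) L2_cmult[OF that(2), of t]]
    by (simp add: power_mult_distrib mult.left_commute[of _ t])
  have "(\<lambda>x. prim (\<lambda>x. p x + t * q x) x - y\<^sub>d x) = (\<lambda>x. (prim p x - y\<^sub>d x) + t * prim q x)"
    using L by (simp add: prim_add L2_cmult prim_cmult algebra_simps)
  then have 1: "(L2_norm (\<lambda>x. prim (\<lambda>x. p x + t * q x) x - y\<^sub>d x))\<^sup>2 = (L2_norm (\<lambda>x. prim p x - y\<^sub>d x))\<^sup>2
      + 2 * t * (LINT x|leb_I. (prim p x - y\<^sub>d x) * prim q x) + t\<^sup>2 * (L2_norm (prim q))\<^sup>2"
    using e[of "\<lambda>x. prim p x - y\<^sub>d x" "prim q"] L by (simp add: L2_diff prim_L2)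
  have "(\<lambda>x. r x + t * s x + f x) = (\<lambda>x. (r x + f x) + t * s x)" by (simp add: add_ac)
  then have 2: "(L2_norm (\<lambda>x. r x + t * s x + f x))\<^sup>2 = (L2_norm (\<lambda>x. r x + f x))\<^sup>2
      + 2 * t * (LINT x|leb_I. (r x + f x) * s x) + t\<^sup>2 * (L2_norm s)\<^sup>2"
    using e[of "\<lambda>x. r x + f x" s] L by (simp add: L2_add)
  show ?thesis unfolding slope_cost_def 1 2 by (simp add: field_simps)
qed

lemma nonneg_if_quadratic_nonneg:
  fixes b c :: real
  assumes "\<And>t. 0 < t \<Longrightarrow> t \<le> 1 \<Longrightarrow> 0 \<le> t * b + t\<^sup>2 * c"
  shows "0 \<le> b"
proof (rule ccontr)
  assume neg: "\<not> 0 \<le> b"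
  \<comment> \<open>so short a step that the quadratic term is at most half the linear one\<close>
  define t where "t = min 1 (- b / (2 * (\<bar>c\<bar> + 1)))"
  have t: "0 < t" "t \<le> 1" using neg by (auto simp: t_def divide_simps)
  have "0 \<le> t * (b + t * c)" using assms[OF t] by (simp add: power2_eq_square algebra_simps)
  then have nonneg: "0 \<le> b + t * c" using t(1) by (simp add: zero_le_mult_iff)
  have "t * c \<le> t * (\<bar>c\<bar> + 1)" using t by (intro mult_left_mono) auto
  also have "\<dots> \<le> - b / (2 * (\<bar>c\<bar> + 1)) * (\<bar>c\<bar> + 1)"
    by (intro mult_right_mono) (auto simp: t_def)
  also have "\<dots> = - b / 2" by (simp add: divide_simps)
  finally show False using neg nonneg by linarith
qed

lemma slope_cost_variational:
  assumes L: "p \<in> L2" "r \<in> L2" "q \<in> L2" "s \<in> L2" "y\<^sub>d \<in> L2" "f \<in> L2"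
    and opt: "\<And>t. 0 < t \<Longrightarrow> t \<le> 1 \<Longrightarrow>
      slope_cost \<beta> y\<^sub>d f p r \<le> slope_cost \<beta> y\<^sub>d f (\<lambda>x. p x + t * q x) (\<lambda>x. r x + t * s x)"
  shows "0 \<le> (LINT x|leb_I. (prim p x - y\<^sub>d x) * prim q x) + \<beta> * (LINT x|leb_I. (r x + f x) * s x)"
    (is "0 \<le> ?b")
proof (rule nonneg_if_quadratic_nonneg)
  fix t :: real assume t: "0 < t" "t \<le> 1"
  show "0 \<le> t * ?b + t\<^sup>2 * (1/2 * ((L2_norm (prim q))\<^sup>2 + \<beta> * (L2_norm s)\<^sup>2))"
    using opt[OF t] unfolding slope_cost_expansion[OF L, of \<beta> t] by (simp only: add.assoc le_add_same_cancel1)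
qed

section \<open>Regularity of the optimal state\<close>

lemma bounded_above_on_Icc:
  fixes F :: "real \<Rightarrow> real"
  assumes "continuous_on {-1..1} F"
  obtains C where "0 < C" "\<And>x. x \<in> {-1..1} \<Longrightarrow> F x \<le> C"
proof -
  obtain z where "\<forall>x\<in>{-1..1}. F x \<le> F z"
    using continuous_attains_sup[of "{-1..1}" F] assms by auto
  then show ?thesis by (intro that[of "max 1 (F z)"]) (force simp: le_max_iff_disj)+
qed

lemma tendsto_power_indicator_zero_set:
  fixes d :: real assumes "0 \<le> d" "d \<le> D" "0 < D"
  shows "(\<lambda>n. (1 - d / D) ^ n) \<longlonglongrightarrow> of_bool (d = 0)"
proof (cases "d = 0")
  case False
  then have "\<bar>1 - d / D\<bar> < 1" using assms by (auto simp: abs_if divide_simps)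
  then show ?thesis using False LIMSEQ_power_zero[of "1 - d / D"] by simp
qed simp

lemma integral_power_tendsto:
  assumes d: "ac_deriv d d'" "\<And>x. x \<in> {-1..1} \<Longrightarrow> 0 \<le> d x" "\<And>x. x \<in> {-1..1} \<Longrightarrow> d x \<le> D" "0 < D"
    and u: "integrable leb_I u"
  shows "(\<lambda>n. LINT t|leb_I. u t * (1 - d t / D) ^ n) \<longlonglongrightarrow> (LINT t|leb_I. u t * of_bool (d t = 0))"
proof (rule integral_dominated_convergence[where w="\<lambda>t. \<bar>u t\<bar>"])
  have [measurable]: "u \<in> borel_measurable leb_I" "d \<in> borel_measurable leb_I"
    using u L2_measurable[OF ac_deriv_L2_fun[OF d(1)]] by auto
  show "(\<lambda>t. u t * of_bool (d t = 0)) \<in> borel_measurable leb_I"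
    "(\<lambda>t. u t * (1 - d t / D) ^ n) \<in> borel_measurable leb_I" for n by measurable
  show "AE t in leb_I. (\<lambda>n. u t * (1 - d t / D) ^ n) \<longlonglongrightarrow> u t * of_bool (d t = 0)"
    using d by (intro AE_I2 tendsto_mult tendsto_const tendsto_power_indicator_zero_set) auto
  show "AE t in leb_I. norm (u t * (1 - d t / D) ^ n) \<le> \<bar>u t\<bar>" for n
  proof (rule AE_I2)
    fix t assume "t \<in> space leb_I"
    then have "\<bar>1 - d t / D\<bar> \<le> 1" using d(2,3)[of t] d(4) by (auto simp: abs_if divide_simps)
    then have "\<bar>(1 - d t / D) ^ n\<bar> \<le> 1" by (simp add: power_abs power_le_one)
    then show "norm (u t * (1 - d t / D) ^ n) \<le> \<bar>u t\<bar>" by (simp add: abs_mult mult_left_le)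
  qed
qed (use u in auto)

text \<open>A nonnegative function has derivative zero almost everywhere on its zero set: \<open>d' (1 - d / D)\<^sup>n\<close> is the derivative of
  a function of size \<open>O(1 / n)\<close>, and it converges, dominated by \<open>\<bar>d'\<bar>\<close>, to \<open>d'\<close> times the indicator of the zero set, whose primitive
  therefore vanishes.\<close>
lemma ac_deriv_zero_set:
  assumes d: "ac_deriv d d'" "\<And>x. x \<in> {-1..1} \<Longrightarrow> 0 \<le> d x"
  shows "AE x in leb_I. d' x * of_bool (d x = 0) = 0"
proof (rule AE_zero_if_prim_zero)
  have [measurable]: "d \<in> borel_measurable leb_I"
    using L2_measurable[OF ac_deriv_L2_fun[OF d(1)]] by auto
  note L = ac_deriv_L2[OF d(1)]
  obtain D where D: "0 < D" "\<And>x. x \<in> {-1..1} \<Longrightarrow> d x \<le> D"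
    using bounded_above_on_Icc[OF ac_deriv_continuous[OF d(1)]] by blast
  show "(\<lambda>x. d' x * of_bool (d x = 0)) \<in> L2"
  proof (rule L2_mult_bounded(1)[OF L, where C=1])
    have "(\<lambda>x. if d x = 0 then 1 else 0 :: real) \<in> borel_measurable leb_I" by measurable
    then show "(\<lambda>x. of_bool (d x = 0) :: real) \<in> borel_measurable leb_I" by (simp add: of_bool_def)
  qed simp
  fix x :: real assume x: "x \<in> {-1..1}"
  define E where "E = (\<lambda>x. 1 - d x / D)"
  have E: "ac_deriv E (\<lambda>x. 0 - (1 / D) * d' x)"
    using ac_deriv_diff[OF ac_deriv_const[of 1] ac_deriv_cmult[OF d(1), of "1 / D"]] by (simp add: E_def)
  have E01: "0 \<le> E t" "E t \<le> 1" if "t \<in> {-1..1}" for t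
    using D d(2) that by (auto simp: E_def divide_simps)
  have "prim (\<lambda>t. d' t * E t ^ n) x = D / real (Suc n) * (E (-1) ^ Suc n - E x ^ Suc n)" for n
  proof -
    have "E x ^ Suc n = E (-1) ^ Suc n + prim (\<lambda>x. real (Suc n) * E x ^ n * (0 - (1 / D) * d' x)) x"
      by (rule ac_deriv_eq[OF ac_deriv_power[OF E] x])
    also have "(\<lambda>x. real (Suc n) * E x ^ n * (0 - (1 / D) * d' x)) = (\<lambda>t. (- (real (Suc n) / D)) * (d' t * E t ^ n))"
      by (simp add: field_simps)
    finally have "E x ^ Suc n = E (-1) ^ Suc n + (- (real (Suc n) / D)) * prim (\<lambda>t. d' t * E t ^ n) x"
      unfolding prim_cmult .
    then have "real (Suc n) / D * prim (\<lambda>t. d' t * E t ^ n) x = E (-1) ^ Suc n - E x ^ Suc n" by linarith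
    then show ?thesis using D(1) by (auto simp: field_simps simp del: of_nat_Suc power_Suc)
  qed
  moreover have "(\<lambda>n. D / real (Suc n) * (E (-1) ^ Suc n - E x ^ Suc n)) \<longlonglongrightarrow> 0"
  proof (rule Lim_null_comparison)
    have "(\<lambda>n. D * inverse (real (Suc n))) \<longlonglongrightarrow> D * 0"
      by (intro tendsto_mult tendsto_const LIMSEQ_inverse_real_of_nat)
    then show "(\<lambda>n. D / real (Suc n)) \<longlonglongrightarrow> 0" by (simp add: divide_inverse)
    show "\<forall>\<^sub>F n in sequentially. norm (D / real (Suc n) * (E (-1) ^ Suc n - E x ^ Suc n)) \<le> D / real (Suc n)"
    proof (rule always_eventually, rule allI)
      fix n
      have "0 \<le> E (-1) ^ Suc n" "E (-1) ^ Suc n \<le> 1" "0 \<le> E x ^ Suc n" "E x ^ Suc n \<le> 1"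
        using E01[of "-1"] E01[OF x] by (auto intro!: power_le_one mult_le_one)
      then have "\<bar>E (-1) ^ Suc n - E x ^ Suc n\<bar> \<le> 1" by linarith
      then have "D / real (Suc n) * \<bar>E (-1) ^ Suc n - E x ^ Suc n\<bar> \<le> D / real (Suc n) * 1"
        using D by (intro mult_left_mono) auto
      then show "norm (D / real (Suc n) * (E (-1) ^ Suc n - E x ^ Suc n)) \<le> D / real (Suc n)"
        using D by (simp add: abs_mult)
    qed
  qed
  moreover have "(\<lambda>n. prim (\<lambda>t. d' t * E t ^ n) x) \<longlonglongrightarrow> prim (\<lambda>t. d' t * of_bool (d t = 0)) x"
    using integral_power_tendsto[OF d D(2) D(1) ind_integrable[OF L2_integrable[OF L], of "{..<x}"]]
    by (simp add: prim_def E_def mult.assoc)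
  ultimately show "prim (\<lambda>x. d' x * of_bool (d x = 0)) x = 0"
    using LIMSEQ_unique by simp
qed

text \<open>A dual description of functions with derivative bounded by \<open>k\<close>: if \<open>\<bar>u'\<bar> \<le> k\<close>, the oscillation of \<open>u\<close> over \<open>[a,b)\<close> is at
  most the integral of \<open>k\<close>, and an integrand \<open>m\<close> of mean zero on \<open>[a,b)\<close> sees only that oscillation. No point values
  of \<open>u\<close> occur, so the property can be verified for a function known only through its integrals.\<close>
definition local_osc :: "(real \<Rightarrow> real) \<Rightarrow> (real \<Rightarrow> real) \<Rightarrow> bool" where
  "local_osc u k \<longleftrightarrow> u \<in> L2 \<and> k \<in> L2 \<and> (\<forall>x. 0 \<le> k x) \<and>
     (\<forall>a b m. -1 \<le> a \<longrightarrow> a \<le> b \<longrightarrow> b \<le> 1 \<longrightarrow> m \<in> L2 \<longrightarrow> (\<forall>x. x \<notin> {a..<b} \<longrightarrow> m x = 0) \<longrightarrow>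
        (LINT x|leb_I. m x) = 0 \<longrightarrow>
        \<bar>LINT x|leb_I. u x * m x\<bar> \<le> (LINT x|leb_I. \<bar>m x\<bar>) * (LINT x|leb_I. indicat_real {a..<b} x * k x))"

lemma local_osc_add:
  assumes "local_osc u k" "local_osc v l" shows "local_osc (\<lambda>x. u x + v x) (\<lambda>x. k x + l x)"
  unfolding local_osc_def
proof (intro conjI allI impI)
  have L: "u \<in> L2" "k \<in> L2" "v \<in> L2" "l \<in> L2" using assms by (auto simp: local_osc_def)
  then show "(\<lambda>x. u x + v x) \<in> L2" "(\<lambda>x. k x + l x) \<in> L2" by (auto intro: L2_intros)
  show "0 \<le> k x + l x" for x using assms by (auto simp: local_osc_def)
  fix a b :: real and m assume h: "-1 \<le> a" "a \<le> b" "b \<le> 1" "m \<in> L2" "\<forall>x. x \<notin> {a..<b} \<longrightarrow> m x = 0"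
     "(LINT x|leb_I. m x) = 0"
  define N where "N = (LINT x|leb_I. \<bar>m x\<bar>)"
  have "\<bar>LINT x|leb_I. (u x + v x) * m x\<bar> = \<bar>(LINT x|leb_I. u x * m x) + (LINT x|leb_I. v x * m x)\<bar>"
    using L h by (simp add: distrib_right L2_mult_integrable)
  also have "\<dots> \<le> N * (LINT x|leb_I. indicat_real {a..<b} x * k x) + N * (LINT x|leb_I. indicat_real {a..<b} x * l x)"
    using assms h unfolding local_osc_def N_def
    by (intro order_trans[OF abs_triangle_ineq] add_mono) auto
  also have "\<dots> = N * (LINT x|leb_I. indicat_real {a..<b} x * (k x + l x))"
    using L by (simp add: distrib_left ind_integrable L2_integrable)
  finally show "\<bar>LINT x|leb_I. (u x + v x) * m x\<bar> \<le> (LINT x|leb_I. \<bar>m x\<bar>) * (LINT x|leb_I. indicat_real {a..<b} x * (k x + l x))"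
    by (simp add: N_def)
qed

lemma local_osc_cmult:
  assumes "local_osc u k" shows "local_osc (\<lambda>x. c * u x) (\<lambda>x. \<bar>c\<bar> * k x)"
  unfolding local_osc_def
proof (intro conjI allI impI)
  have L: "u \<in> L2" "k \<in> L2" using assms by (auto simp: local_osc_def)
  then show "(\<lambda>x. c * u x) \<in> L2" "(\<lambda>x. \<bar>c\<bar> * k x) \<in> L2" by (auto intro: L2_intros)
  show "0 \<le> \<bar>c\<bar> * k x" for x using assms by (auto simp: local_osc_def)
  fix a b :: real and m assume h: "-1 \<le> a" "a \<le> b" "b \<le> 1" "m \<in> L2" "\<forall>x. x \<notin> {a..<b} \<longrightarrow> m x = 0"
     "(LINT x|leb_I. m x) = 0"
  have "\<bar>LINT x|leb_I. c * u x * m x\<bar> = \<bar>c\<bar> * \<bar>LINT x|leb_I. u x * m x\<bar>"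
    by (simp add: mult.assoc abs_mult)
  also have "\<dots> \<le> \<bar>c\<bar> * ((LINT x|leb_I. \<bar>m x\<bar>) * (LINT x|leb_I. indicat_real {a..<b} x * k x))"
    using assms h unfolding local_osc_def by (intro mult_left_mono) auto
  also have "\<dots> = (LINT x|leb_I. \<bar>m x\<bar>) * (LINT x|leb_I. indicat_real {a..<b} x * (\<bar>c\<bar> * k x))"
    by (simp add: mult.left_commute)
  finally show "\<bar>LINT x|leb_I. c * u x * m x\<bar> \<le> (LINT x|leb_I. \<bar>m x\<bar>) * (LINT x|leb_I. indicat_real {a..<b} x * (\<bar>c\<bar> * k x))" .
qed

lemma prim_supported:
  assumes m: "m \<in> L2" "\<And>x. x \<notin> {a..<b} \<Longrightarrow> m x = 0"
  shows "x \<le> a \<Longrightarrow> prim m x = 0" "b \<le> x \<Longrightarrow> prim m x = (LINT t|leb_I. m t)"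
proof -
  assume "x \<le> a"
  then have "prim m x = prim (\<lambda>t. 0) x" unfolding prim_def
    by (intro Bochner_Integration.integral_cong) (auto simp: indicator_def m(2))
  then show "prim m x = 0" by simp
next
  assume "b \<le> x"
  then show "prim m x = (LINT t|leb_I. m t)" unfolding prim_def
    by (intro Bochner_Integration.integral_cong) (auto simp: indicator_def m(2))
qed

lemma prim_diff_abs_le:
  assumes "m \<in> L2" "a \<le> b" shows "\<bar>prim m b - prim m a\<bar> \<le> prim (\<lambda>t. \<bar>m t\<bar>) b - prim (\<lambda>t. \<bar>m t\<bar>) a"
proof -
  have "\<bar>prim m b - prim m a\<bar> \<le> (LINT t|leb_I. \<bar>indicat_real {a..<b} t * m t\<bar>)"
    unfolding prim_diff_eq[OF assms] by (rule abs_integral_le)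
  also have "\<dots> = prim (\<lambda>t. \<bar>m t\<bar>) b - prim (\<lambda>t. \<bar>m t\<bar>) a"
    unfolding prim_diff_eq[OF L2_abs[OF assms(1)] assms(2)] by (simp add: abs_mult)
  finally show ?thesis .
qed

lemma local_osc_ac_deriv:
  assumes F: "ac_deriv F u" shows "local_osc F (\<lambda>x. \<bar>u x\<bar>)"
  unfolding local_osc_def
proof (intro conjI allI impI)
  have L: "F \<in> L2" "u \<in> L2" using ac_deriv_L2[OF F] ac_deriv_L2_fun[OF F] by auto
  then show "F \<in> L2" "(\<lambda>x. \<bar>u x\<bar>) \<in> L2" by (auto intro: L2_intros)
  fix a b :: real and m assume h: "-1 \<le> a" "a \<le> b" "b \<le> 1" and m: "m \<in> L2" "\<forall>x. x \<notin> {a..<b} \<longrightarrow> m x = 0"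
     "(LINT x|leb_I. m x) = 0"
  define N where "N = (LINT x|leb_I. \<bar>m x\<bar>)"
  have bd: "\<bar>u x * prim m x\<bar> \<le> N * (indicat_real {a..<b} x * \<bar>u x\<bar>)" if "x \<in> {-1<..<1}" for x
  proof (cases "x \<in> {a..<b}")
    case True
    have "\<bar>prim m x\<bar> \<le> prim (\<lambda>t. \<bar>m t\<bar>) x" using prim_diff_abs_le[OF m(1), of "-1" x] that by simp
    also have "\<dots> \<le> N"
      using prim_diff_abs_le[OF m(1), of x 1] that by (simp add: N_def)
    finally show ?thesis using True by (simp add: abs_mult mult.commute[of "\<bar>u x\<bar>"] mult_right_mono)
  next
    case False
    then have "prim m x = 0" using prim_supported[OF m(1), of a b x] m by auto
    then show ?thesis using False by simp
  qed
  have "\<bar>LINT x|leb_I. F x * m x\<bar> = \<bar>LINT x|leb_I. u x * prim m x\<bar>"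
    using integration_by_parts[OF F ac_deriv_prim[OF m(1)]] m(3) by simp
  also have "\<dots> \<le> (LINT x|leb_I. \<bar>u x * prim m x\<bar>)" by (rule abs_integral_le)
  also have "\<dots> \<le> (LINT x|leb_I. N * (indicat_real {a..<b} x * \<bar>u x\<bar>))"
  proof (rule integral_mono)
    show "integrable leb_I (\<lambda>x. \<bar>u x * prim m x\<bar>)"
      using L2_mult_integrable[OF L(2) prim_L2[OF m(1)]] by (rule integrable_abs)
    show "integrable leb_I (\<lambda>x. N * (indicat_real {a..<b} x * \<bar>u x\<bar>))"
      by (intro integrable_mult_right ind_integrable L2_integrable L2_abs L) simp
  qed (use bd in simp)
  finally show "\<bar>LINT x|leb_I. F x * m x\<bar> \<le> (LINT x|leb_I. \<bar>m x\<bar>) * (LINT x|leb_I. indicat_real {a..<b} x * \<bar>u x\<bar>)"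
    by (simp add: N_def)
qed simp

text \<open>The optimality condition for the continuous problem in terms of the slope \<open>p\<close> and its derivative \<open>r\<close>. The functions
  \<open>f\<close> and \<open>\<psi>\<close> are continuous representatives, with derivatives \<open>f'\<close>, \<open>\<psi>'\<close> and \<open>\<psi>''\<close>.\<close>
locale optimal_slope =
  fixes \<beta> :: real and y\<^sub>d f f' \<psi> \<psi>' \<psi>'' p r :: "real \<Rightarrow> real"
  assumes \<beta>: "0 < \<beta>" and y\<^sub>d: "y\<^sub>d \<in> L2" and f: "ac_deriv f f'"
    and \<psi>: "ac_deriv \<psi> \<psi>'" and \<psi>': "ac_deriv \<psi>' \<psi>''" and \<psi>_mean: "0 < (LINT x|leb_I. \<psi> x)"
    and p: "ac_deriv p r" and p_mean: "(LINT x|leb_I. p x) = 0"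
    and p_le: "\<And>x. x \<in> {-1..1} \<Longrightarrow> p x \<le> \<psi> x"
    and optimal: "\<And>q s. ac_deriv q s \<Longrightarrow> (LINT x|leb_I. q x) = 0 \<Longrightarrow> (\<And>x. x \<in> {-1..1} \<Longrightarrow> q x \<le> \<psi> x)
      \<Longrightarrow> slope_cost \<beta> y\<^sub>d f p r \<le> slope_cost \<beta> y\<^sub>d f q s"
begin

lemma L2s: "f \<in> L2" "\<psi> \<in> L2" "\<psi>' \<in> L2" "p \<in> L2" "r \<in> L2" "f' \<in> L2" "\<psi>'' \<in> L2"
  using f \<psi> \<psi>' p ac_deriv_L2 ac_deriv_L2_fun by auto

text \<open>The primitive of the residual \<open>y - y\<^sub>d\<close>: pairing the residual with a state amounts to pairing \<open>- adj\<close> with its slope.\<close>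
definition adj :: "real \<Rightarrow> real" where
  "adj = prim (\<lambda>x. prim p x - y\<^sub>d x)"

lemma adj: "ac_deriv adj (\<lambda>x. prim p x - y\<^sub>d x)"
  unfolding adj_def by (intro ac_deriv_prim L2_intros L2s y\<^sub>d)

lemma L2_adj: "adj \<in> L2" by (rule ac_deriv_L2_fun[OF adj])

text \<open>For \<open>q\<close> of mean zero with derivative \<open>s\<close> this is the derivative of the cost in direction \<open>q\<close> (\<open>grad_eq\<close>). The formula
  extends it to directions of arbitrary mean.\<close>
definition grad :: "(real \<Rightarrow> real) \<Rightarrow> (real \<Rightarrow> real) \<Rightarrow> real" where
  "grad q s = \<beta> * (LINT x|leb_I. (r x + f x) * s x) - (LINT x|leb_I. adj x * q x)"

lemma grad_add:
  assumes "q \<in> L2" "s \<in> L2" "u \<in> L2" "v \<in> L2"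
  shows "grad (\<lambda>x. q x + u x) (\<lambda>x. s x + v x) = grad q s + grad u v"
  using assms L2_mult_integrable[OF L2_add[OF L2s(5) L2s(1)]] L2_mult_integrable[OF L2_adj]
  by (simp add: grad_def distrib_left[of "_ + _"] distrib_left[of "adj _"] distrib_left[of \<beta>])

lemma grad_cmult: "grad (\<lambda>x. c * q x) (\<lambda>x. c * s x) = c * grad q s"
  by (simp add: grad_def mult.left_commute[of _ c] right_diff_distrib)

lemma grad_diff:
  assumes "q \<in> L2" "s \<in> L2" "u \<in> L2" "v \<in> L2"
  shows "grad (\<lambda>x. q x - u x) (\<lambda>x. s x - v x) = grad q s - grad u v"
  using grad_add[OF assms(1,2) L2_cmult[OF assms(3), of "-1"] L2_cmult[OF assms(4), of "-1"]]
    grad_cmult[of "-1" u v] by simp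

lemma grad_eq:
  assumes q: "ac_deriv q s" "(LINT x|leb_I. q x) = 0"
  shows "grad q s = (LINT x|leb_I. (prim p x - y\<^sub>d x) * prim q x) + \<beta> * (LINT x|leb_I. (r x + f x) * s x)"
  using integration_by_parts[OF adj ac_deriv_prim[OF ac_deriv_L2_fun[OF q(1)]]] q(2)
  by (simp add: grad_def adj_def)

lemma variational_inequality:
  assumes q: "ac_deriv q s" "(LINT x|leb_I. q x) = 0" "\<And>x. x \<in> {-1..1} \<Longrightarrow> q x \<le> \<psi> x"
  shows "0 \<le> grad (\<lambda>x. q x - p x) (\<lambda>x. s x - r x)"
proof -
  have D: "ac_deriv (\<lambda>x. q x - p x) (\<lambda>x. s x - r x)" by (rule ac_deriv_diff[OF q(1) p])
  note L = ac_deriv_L2_fun[OF D] ac_deriv_L2[OF D]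
  have m: "(LINT x|leb_I. q x - p x) = 0"
    using q(2) p_mean L2_integrable[OF ac_deriv_L2_fun[OF q(1)]] L2s by (simp add: L2_integrable)
  have "0 \<le> (LINT x|leb_I. (prim p x - y\<^sub>d x) * prim (\<lambda>x. q x - p x) x) + \<beta> * (LINT x|leb_I. (r x + f x) * (s x - r x))"
  proof (rule slope_cost_variational[OF L2s(4,5) L y\<^sub>d L2s(1)])
    fix t :: real assume t: "0 < t" "t \<le> 1"
    show "slope_cost \<beta> y\<^sub>d f p r \<le> slope_cost \<beta> y\<^sub>d f (\<lambda>x. p x + t * (q x - p x)) (\<lambda>x. r x + t * (s x - r x))"
    proof (rule optimal)
      show "ac_deriv (\<lambda>x. p x + t * (q x - p x)) (\<lambda>x. r x + t * (s x - r x))"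
        by (intro ac_deriv_add ac_deriv_cmult D p)
      show "(LINT x|leb_I. p x + t * (q x - p x)) = 0"
        using m p_mean L L2s(4) by (simp add: L2_integrable)
      fix x :: real assume x: "x \<in> {-1..1}"
      have "p x + t * (q x - p x) = (1 - t) * p x + t * q x" by (simp add: algebra_simps)
      also have "\<dots> \<le> (1 - t) * \<psi> x + t * \<psi> x"
        using t p_le[OF x] q(3)[OF x] by (intro add_mono mult_left_mono) auto
      finally show "p x + t * (q x - p x) \<le> \<psi> x" by (simp add: algebra_simps)
    qed
  qed
  then show ?thesis using grad_eq[OF D m] by simp
qed

definition gap :: "real \<Rightarrow> real" where "gap x = \<psi> x - p x"
definition gap' :: "real \<Rightarrow> real" where "gap' x = \<psi>' x - r x"

lemma gap: "ac_deriv gap gap'"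
  unfolding gap_def[abs_def] gap'_def[abs_def] by (intro ac_deriv_diff \<psi> p)

lemma gap_nonneg: "x \<in> {-1..1} \<Longrightarrow> 0 \<le> gap x"
  using p_le by (simp add: gap_def)

lemma gap_mean: "(LINT x|leb_I. gap x) = (LINT x|leb_I. \<psi> x)"
  using p_mean L2s by (simp add: gap_def L2_integrable)

text \<open>The Lagrange multiplier of the side condition \<open>\<integral> p = 0\<close>, fixed by the requirement that \<open>multiplier\<close> vanishes on the
  gap.\<close>
definition mean_mult :: real where
  "mean_mult = grad gap gap' / (LINT x|leb_I. \<psi> x)"

text \<open>The Lagrange multiplier of the constraint \<open>p \<le> \<psi>\<close> as a functional of \<open>q\<close> and its derivative \<open>s\<close>. It is kept as
  a positive functional because contact at the end points may contribute atoms, which no density represents.\<close>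
definition multiplier :: "(real \<Rightarrow> real) \<Rightarrow> (real \<Rightarrow> real) \<Rightarrow> real" where
  "multiplier q s = mean_mult * (LINT x|leb_I. q x) - grad q s"

lemma multiplier_diff:
  assumes "q \<in> L2" "s \<in> L2" "u \<in> L2" "v \<in> L2"
  shows "multiplier (\<lambda>x. q x - u x) (\<lambda>x. s x - v x) = multiplier q s - multiplier u v"
  using assms by (simp add: multiplier_def grad_diff L2_integrable algebra_simps)

lemma multiplier_cmult: "multiplier (\<lambda>x. c * q x) (\<lambda>x. c * s x) = c * multiplier q s"
  by (simp add: multiplier_def grad_cmult algebra_simps)

lemma multiplier_gap: "multiplier gap gap' = 0"
  using \<psi>_mean by (simp add: multiplier_def gap_mean mean_mult_def)

text \<open>Moving from \<open>p\<close> downwards by \<open>q\<close> and upwards by the multiple of the gap that has the same mean keeps the mean zero, and a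
  short enough step keeps the slope below \<open>\<psi>\<close>.\<close>
lemma multiplier_nonneg:
  assumes q: "ac_deriv q s" "\<And>x. x \<in> {-1..1} \<Longrightarrow> 0 \<le> q x"
  shows "0 \<le> multiplier q s"
proof -
  define \<sigma> where "\<sigma> = (LINT x|leb_I. q x) / (LINT x|leb_I. \<psi> x)"
  have "0 \<le> (LINT x|leb_I. q x)" by (rule integral_nonneg_AE, rule AE_I2) (use q(2) in auto)
  then have \<sigma>: "0 \<le> \<sigma>" using \<psi>_mean by (simp add: \<sigma>_def)
  \<comment> \<open>this step length makes the coefficient \<open>1 - t * \<sigma>\<close> of the gap nonnegative\<close>
  define t where "t = 1 / (1 + \<sigma>)"
  have t: "0 < t" "t * \<sigma> \<le> 1" using \<sigma> by (auto simp: t_def divide_simps)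
  define v where "v = (\<lambda>x. \<sigma> * gap x - q x)"
  define v' where "v' = (\<lambda>x. \<sigma> * gap' x - s x)"
  have v: "ac_deriv v v'" unfolding v_def v'_def by (intro ac_deriv_diff ac_deriv_cmult gap q)
  note L = ac_deriv_L2_fun[OF v] ac_deriv_L2_fun[OF gap] ac_deriv_L2_fun[OF q(1)]
    ac_deriv_L2[OF v] ac_deriv_L2[OF gap] ac_deriv_L2[OF q(1)]
  have vm: "(LINT x|leb_I. v x) = 0"
    using L \<psi>_mean by (simp add: v_def L2_integrable gap_mean \<sigma>_def)
  have "0 \<le> grad (\<lambda>x. (p x + t * v x) - p x) (\<lambda>x. (r x + t * v' x) - r x)"
  proof (rule variational_inequality)
    show "ac_deriv (\<lambda>x. p x + t * v x) (\<lambda>x. r x + t * v' x)" by (intro ac_deriv_add ac_deriv_cmult v p)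
    show "(LINT x|leb_I. p x + t * v x) = 0" using L L2s vm p_mean by (simp add: L2_integrable)
    fix x :: real assume x: "x \<in> {-1..1}"
    have "0 \<le> (1 - t * \<sigma>) * gap x + t * q x"
      using t gap_nonneg[OF x] q(2)[OF x] by (intro add_nonneg_nonneg mult_nonneg_nonneg) auto
    also have "\<dots> = \<psi> x - (p x + t * v x)" by (simp add: v_def gap_def algebra_simps)
    finally show "p x + t * v x \<le> \<psi> x" by simp
  qed
  then have "0 \<le> t * grad v v'" by (simp add: grad_cmult)
  then have "0 \<le> grad v v'" using t by (simp add: zero_le_mult_iff)
  also have "grad v v' = \<sigma> * grad gap gap' - grad q s"
    unfolding v_def v'_def using L by (simp add: grad_diff L2_cmult grad_cmult)
  also have "\<sigma> * grad gap gap' = mean_mult * (LINT x|leb_I. q x)" by (simp add: \<sigma>_def mean_mult_def)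
  finally show ?thesis by (simp add: multiplier_def)
qed

lemma multiplier_mono:
  assumes "ac_deriv q s" "ac_deriv u v" "\<And>x. x \<in> {-1..1} \<Longrightarrow> q x \<le> u x"
  shows "multiplier q s \<le> multiplier u v"
proof -
  have "0 \<le> multiplier (\<lambda>x. u x - q x) (\<lambda>x. v x - s x)"
    by (rule multiplier_nonneg[OF ac_deriv_diff[OF assms(2,1)]]) (use assms(3) in simp)
  then show ?thesis using assms ac_deriv_L2 ac_deriv_L2_fun by (simp add: multiplier_diff)
qed

text \<open>Integrand of the zero order part of the multiplier, see \<open>multiplier_eq_stress\<close>.\<close>
definition reac :: "real \<Rightarrow> real" where "reac x = mean_mult + adj x"
definition stress :: "real \<Rightarrow> real" where "stress x = prim reac x + \<beta> * (r x + f x)"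

lemma reac: "ac_deriv reac (\<lambda>x. 0 + (prim p x - y\<^sub>d x))"
  unfolding reac_def[abs_def] by (intro ac_deriv_add ac_deriv_const adj)

lemma L2_reac: "reac \<in> L2" by (rule ac_deriv_L2_fun[OF reac])

lemma L2_stress: "stress \<in> L2"
  unfolding stress_def[abs_def] by (intro L2_intros L2_reac L2s)

lemma multiplier_eq_stress:
  assumes q: "ac_deriv q s" "q 1 = 0"
  shows "multiplier q s = - (LINT x|leb_I. stress x * s x)"
proof -
  note L = ac_deriv_L2_fun[OF q(1)] ac_deriv_L2[OF q(1)]
  have "(LINT x|leb_I. stress x * s x) = (LINT x|leb_I. prim reac x * s x + \<beta> * ((r x + f x) * s x))"
    by (simp add: stress_def algebra_simps)
  also have "\<dots> = (LINT x|leb_I. prim reac x * s x) + \<beta> * (LINT x|leb_I. (r x + f x) * s x)"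
    using L2_mult_integrable[OF prim_L2[OF L2_reac] L(2)] L2_mult_integrable[OF L2_add[OF L2s(5) L2s(1)] L(2)] by simp
  also have "(LINT x|leb_I. prim reac x * s x) = - (LINT x|leb_I. reac x * q x)"
    using integration_by_parts[OF ac_deriv_prim[OF L2_reac] q(1)] q(2) by simp
  also have "(LINT x|leb_I. reac x * q x) = mean_mult * (LINT x|leb_I. q x) + (LINT x|leb_I. adj x * q x)"
    using L L2_mult_integrable[OF L2_adj L(1)] by (simp add: reac_def distrib_right L2_integrable)
  finally show ?thesis by (simp add: multiplier_def grad_def)
qed

text \<open>The part of \<open>gap'\<close> whose derivative is known to be square integrable beforehand; \<open>stress_eq_load\<close> expresses the
  remaining part by the stress.\<close>
definition load :: "real \<Rightarrow> real" where "load x = \<psi>' x + (f x + (1 / \<beta>) * prim reac x)"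
definition load' :: "real \<Rightarrow> real" where "load' x = \<psi>'' x + (f' x + (1 / \<beta>) * reac x)"

lemma load: "ac_deriv load load'"
  unfolding load_def[abs_def] load'_def[abs_def]
  by (intro ac_deriv_add ac_deriv_cmult ac_deriv_prim \<psi>' f L2_reac)

lemma stress_eq_load: "stress x = \<beta> * (load x - gap' x)"
  using \<beta> by (simp add: stress_def load_def gap'_def field_simps)

text \<open>The Lewy--Stampacchia inequality. Split \<open>q\<close> with the weight \<open>E\<^sup>n\<close>, where \<open>E = 1 - gap / D\<close>. The part with weight
  \<open>1 - E\<^sup>n\<close> is at most a multiple of the gap, on which the multiplier vanishes. In the other part the derivative of the
  weight contributes with a favourable sign, and \<open>E\<^sup>n\<close> tends to the indicator of the contact set, where \<open>gap'\<close> vanishes.\<close>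
lemma multiplier_le_load:
  assumes q: "ac_deriv q s" "\<And>x. x \<in> {-1..1} \<Longrightarrow> 0 \<le> q x" "q (-1) = 0" "q 1 = 0"
  shows "multiplier q s \<le> \<beta> * (LINT x|leb_I. \<bar>load' x\<bar> * q x)"
proof -
  obtain D where D: "0 < D" "\<And>x. x \<in> {-1..1} \<Longrightarrow> gap x \<le> D"
    using bounded_above_on_Icc[OF ac_deriv_continuous[OF gap]] by blast
  obtain S where S: "0 < S" "\<And>x. x \<in> {-1..1} \<Longrightarrow> q x \<le> S"
    using bounded_above_on_Icc[OF ac_deriv_continuous[OF q(1)]] by blast
  define E where "E = (\<lambda>x. 1 - gap x / D)"
  define E' where "E' = (\<lambda>x. 0 - (1 / D) * gap' x)"
  have E: "ac_deriv E E'"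
    using ac_deriv_diff[OF ac_deriv_const[of 1] ac_deriv_cmult[OF gap, of "1 / D"]] by (simp add: E_def E'_def)
  have E01: "0 \<le> E t" "E t \<le> 1" if "t \<in> {-1..1}" for t
    using D gap_nonneg that by (auto simp: E_def divide_simps)
  note L = ac_deriv_L2_fun[OF q(1)] ac_deriv_L2[OF q(1)] ac_deriv_L2[OF gap] ac_deriv_L2_fun[OF load] ac_deriv_L2[OF load]
  have step: "multiplier q s \<le> \<beta> * (LINT x|leb_I. gap' x * s x * E x ^ Suc n) + \<beta> * (LINT x|leb_I. \<bar>load' x\<bar> * q x)" for n
  proof -
    define w where "w = (\<lambda>x. q x * E x ^ Suc n)"
    define w' where "w' = (\<lambda>x. s x * E x ^ Suc n + q x * (real (Suc n) * E x ^ n * E' x))"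
    have w: "ac_deriv w w'" unfolding w_def w'_def by (intro ac_deriv_mult q(1) ac_deriv_power E)
    have En: "continuous_on {-1..1} (\<lambda>x. E x ^ Suc n)" by (rule ac_deriv_continuous[OF ac_deriv_power[OF E]])
    have sE: "(\<lambda>x. s x * E x ^ Suc n) \<in> L2" by (rule L2_mult_continuous(1)[OF L(2) En])
    define C where "C = S * real (Suc n) / D"
    have "multiplier (\<lambda>x. q x - w x) (\<lambda>x. s x - w' x) \<le> multiplier (\<lambda>x. C * gap x) (\<lambda>x. C * gap' x)"
    proof (rule multiplier_mono[OF ac_deriv_diff[OF q(1) w] ac_deriv_cmult[OF gap]])
      fix x :: real assume x: "x \<in> {-1..1}"
      \<comment> \<open>by the Bernoulli inequality the weight \<open>1 - E ^ Suc n\<close> is at most a multiple of the gap\<close>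
      have "1 + real (Suc n) * (E x - 1) \<le> (1 + (E x - 1)) ^ Suc n"
        by (rule Bernoulli_inequality) (use E01[OF x] in simp)
      then have 1: "1 - E x ^ Suc n \<le> real (Suc n) * gap x / D" by (simp add: E_def del: of_nat_Suc power_Suc)
      have "q x - w x = q x * (1 - E x ^ Suc n)" by (simp add: w_def algebra_simps)
      also have "\<dots> \<le> S * (real (Suc n) * gap x / D)"
        using q(2)[OF x] S(2)[OF x] S(1) 1 E01[OF x] by (intro mult_mono) (auto intro!: mult_le_one power_le_one)
      finally show "q x - w x \<le> C * gap x" by (simp add: C_def)
    qed
    also have "\<dots> = 0" by (simp add: multiplier_cmult multiplier_gap)
    finally have "multiplier q s \<le> multiplier w w'"
      using L ac_deriv_L2_fun[OF w] ac_deriv_L2[OF w] by (simp add: multiplier_diff)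
    also have "\<dots> = \<beta> * ((LINT x|leb_I. gap' x * w' x) - (LINT x|leb_I. load x * w' x))"
    proof -
      have "multiplier w w' = - (LINT x|leb_I. stress x * w' x)"
        by (rule multiplier_eq_stress[OF w]) (simp add: w_def q)
      also have "\<dots> = - (LINT x|leb_I. \<beta> * (load x * w' x - gap' x * w' x))"
        by (simp add: stress_eq_load algebra_simps)
      also have "\<dots> = \<beta> * ((LINT x|leb_I. gap' x * w' x) - (LINT x|leb_I. load x * w' x))"
        using L2_mult_integrable[OF L(4) ac_deriv_L2[OF w]] L2_mult_integrable[OF L(3) ac_deriv_L2[OF w]]
        by (simp add: algebra_simps)
      finally show ?thesis .
    qed
    also have "(LINT x|leb_I. load x * w' x) = - (LINT x|leb_I. load' x * w x)"
      using integration_by_parts[OF load w] q by (simp add: w_def)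
    finally have 1: "multiplier q s \<le> \<beta> * ((LINT x|leb_I. gap' x * w' x) + (LINT x|leb_I. load' x * w x))"
      by simp
    have 2: "(LINT x|leb_I. gap' x * w' x) \<le> (LINT x|leb_I. gap' x * (s x * E x ^ Suc n))"
    proof (rule integral_mono)
      show "integrable leb_I (\<lambda>x. gap' x * w' x)" by (rule L2_mult_integrable[OF L(3) ac_deriv_L2[OF w]])
      show "integrable leb_I (\<lambda>x. gap' x * (s x * E x ^ Suc n))" by (rule L2_mult_integrable[OF L(3) sE])
      fix x assume "x \<in> space leb_I"
      then have x: "x \<in> {-1..1}" by simp
      \<comment> \<open>the derivative of the weight is a negative multiple of \<open>gap'\<close>, so this term is minus a square\<close>
      have "gap' x * (q x * (real (Suc n) * E x ^ n * E' x)) = - (q x * (real (Suc n) * E x ^ n * (gap' x)\<^sup>2 / D))"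
        by (simp add: E'_def power2_eq_square)
      also have "\<dots> \<le> 0" using q(2)[OF x] E01[OF x] D by simp
      finally show "gap' x * w' x \<le> gap' x * (s x * E x ^ Suc n)" by (simp add: w'_def distrib_left)
    qed
    have 3: "(LINT x|leb_I. load' x * w x) \<le> (LINT x|leb_I. \<bar>load' x\<bar> * q x)"
    proof (rule integral_mono)
      show "integrable leb_I (\<lambda>x. load' x * w x)" by (rule L2_mult_integrable[OF L(5) ac_deriv_L2_fun[OF w]])
      show "integrable leb_I (\<lambda>x. \<bar>load' x\<bar> * q x)" by (rule L2_mult_integrable[OF L2_abs[OF L(5)] L(1)])
      fix x assume "x \<in> space leb_I"
      then have x: "x \<in> {-1..1}" by simp
      have "0 \<le> w x" "w x \<le> q x"
        using q(2)[OF x] E01[OF x] unfolding w_def by (auto intro!: mult_left_le power_le_one mult_le_one)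
      then show "load' x * w x \<le> \<bar>load' x\<bar> * q x" by (intro mult_mono) auto
    qed
    have "multiplier q s \<le> \<beta> * ((LINT x|leb_I. gap' x * (s x * E x ^ Suc n)) + (LINT x|leb_I. \<bar>load' x\<bar> * q x))"
      using 1 mult_left_mono[OF add_mono[OF 2 3], of \<beta>] \<beta> by linarith
    then show ?thesis by (simp add: distrib_left mult.assoc)
  qed
  have "(\<lambda>n. LINT x|leb_I. (gap' x * s x) * E x ^ n) \<longlonglongrightarrow> (LINT x|leb_I. (gap' x * s x) * of_bool (gap x = 0))"
    unfolding E_def by (rule integral_power_tendsto[OF gap gap_nonneg D(2,1) L2_mult_integrable[OF L(3,2)]])
  also have "(LINT x|leb_I. (gap' x * s x) * of_bool (gap x = 0)) = 0"
  proof (rule integral_eq_zero_AE)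
    have "AE x in leb_I. gap' x * of_bool (gap x = 0) = 0" by (rule ac_deriv_zero_set[OF gap gap_nonneg])
    then show "AE x in leb_I. (gap' x * s x) * of_bool (gap x = 0) = 0" by eventually_elim auto
  qed
  finally have "(\<lambda>n. LINT x|leb_I. (gap' x * s x) * E x ^ Suc n) \<longlonglongrightarrow> 0" by (rule LIMSEQ_Suc)
  then have "(\<lambda>n. \<beta> * (LINT x|leb_I. gap' x * s x * E x ^ Suc n) + \<beta> * (LINT x|leb_I. \<bar>load' x\<bar> * q x))
     \<longlonglongrightarrow> \<beta> * 0 + \<beta> * (LINT x|leb_I. \<bar>load' x\<bar> * q x)"
    by (intro tendsto_intros)
  then have "multiplier q s \<le> \<beta> * 0 + \<beta> * (LINT x|leb_I. \<bar>load' x\<bar> * q x)"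
    by (rule LIMSEQ_le_const) (use step in blast)
  then show ?thesis by simp
qed

text \<open>The regularity of the stress. For \<open>m\<close> of mean zero on \<open>[a,b)\<close> the integral of \<open>stress * m\<close> is, up to sign, the multiplier at
  \<open>prim m\<close>. As the multiplier is monotone, it is bounded by its value at a majorant \<open>Q\<close> of \<open>\<bar>prim m\<bar>\<close> that vanishes
  outside \<open>[a,b)\<close>, to which the Lewy--Stampacchia inequality applies.\<close>
lemma local_osc_stress: "local_osc stress (\<lambda>x. \<beta> / 2 * \<bar>load' x\<bar>)"
  unfolding local_osc_def
proof (intro conjI allI impI)
  show "stress \<in> L2" by (rule L2_stress)
  have Ll: "load' \<in> L2" by (rule ac_deriv_L2[OF load])
  then show "(\<lambda>x. \<beta> / 2 * \<bar>load' x\<bar>) \<in> L2" by (intro L2_cmult L2_abs)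
  show "0 \<le> \<beta> / 2 * \<bar>load' x\<bar>" for x using \<beta> by simp
  fix a b :: real and m assume ab: "-1 \<le> a" "a \<le> b" "b \<le> 1" and m: "m \<in> L2" "\<forall>x. x \<notin> {a..<b} \<longrightarrow> m x = 0"
     "(LINT x|leb_I. m x) = 0"
  define W where "W = (LINT x|leb_I. \<bar>m x\<bar>)"
  show "\<bar>LINT x|leb_I. stress x * m x\<bar> \<le> (LINT x|leb_I. \<bar>m x\<bar>) * (LINT x|leb_I. indicat_real {a..<b} x * (\<beta> / 2 * \<bar>load' x\<bar>))"
  proof (cases "W = 0")
    case True
    then have "AE x in leb_I. \<bar>m x\<bar> = 0"
      using integral_nonneg_eq_0_iff_AE[of leb_I "\<lambda>x. \<bar>m x\<bar>"] L2_integrable[OF L2_abs[OF m(1)]] by (simp add: W_def)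
    then have "(LINT x|leb_I. stress x * m x) = 0" by (intro integral_eq_zero_AE) auto
    then show ?thesis using True by (simp add: W_def)
  next
    case False
    moreover have "0 \<le> W" by (simp add: W_def)
    ultimately have W: "0 < W" by simp
    have La: "(\<lambda>x. \<bar>m x\<bar>) \<in> L2" by (rule L2_abs[OF m(1)])
    define V where "V = prim (\<lambda>x. \<bar>m x\<bar>)"
    have V: "ac_deriv V (\<lambda>x. \<bar>m x\<bar>)" unfolding V_def by (rule ac_deriv_prim[OF La])
    have V01: "0 \<le> V x" "V x \<le> W" "\<bar>prim m x\<bar> \<le> V x" "\<bar>prim m x\<bar> \<le> W - V x" if "x \<in> {-1..1}" for x
      using prim_diff_abs_le[OF m(1), of "-1" x] prim_diff_abs_le[OF m(1), of x 1] that m(3)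
      by (auto simp: V_def W_def)
    \<comment> \<open>a smooth majorant of \<open>min V (W - V)\<close>: the larger of \<open>V\<close> and \<open>W - V\<close> is at least \<open>W / 2\<close>\<close>
    define Q where "Q = (\<lambda>x. 2 / W * (V x * (W - V x)))"
    define Q' where "Q' = (\<lambda>x. 2 / W * (\<bar>m x\<bar> * (W - V x) + V x * (0 - \<bar>m x\<bar>)))"
    have Q: "ac_deriv Q Q'" unfolding Q_def Q'_def
      by (intro ac_deriv_cmult ac_deriv_mult ac_deriv_diff ac_deriv_const V)
    have V1: "V 1 = W" by (simp add: V_def W_def)
    have Qge: "\<bar>prim m x\<bar> \<le> Q x" if x: "x \<in> {-1..1}" for x
    proof (cases "V x \<le> W / 2")
      case True
      then have "V x * (W / 2) \<le> V x * (W - V x)" using V01[OF x] by (intro mult_left_mono) auto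
      then have "V x \<le> Q x" using W by (simp add: Q_def field_simps)
      then show ?thesis using V01(3)[OF x] by simp
    next
      case False
      then have "W / 2 * (W - V x) \<le> V x * (W - V x)" using V01[OF x] by (intro mult_right_mono) auto
      then have "W - V x \<le> Q x" using W by (simp add: Q_def field_simps)
      then show ?thesis using V01(4)[OF x] by simp
    qed
    have Qle: "\<bar>load' x\<bar> * Q x \<le> W / 2 * (indicat_real {a..<b} x * \<bar>load' x\<bar>)" if "x \<in> {-1<..<1}" for x
    proof (cases "x \<in> {a..<b}")
      case True
      have "0 \<le> (W - 2 * V x)\<^sup>2" by simp
      then have "4 * (V x * (W - V x)) \<le> W * W" by (simp add: power2_eq_square algebra_simps)
      then have "Q x \<le> W / 2" using W by (simp add: Q_def field_simps)
      then have "Q x * \<bar>load' x\<bar> \<le> W / 2 * \<bar>load' x\<bar>" by (rule mult_right_mono) simp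
      then show ?thesis using True by (simp add: mult.commute[of "\<bar>load' x\<bar>"])
    next
      case False
      then have "V x = 0 \<or> V x = W"
        using prim_supported[OF La, of a b x] m(2) by (auto simp: V_def W_def)
      then show ?thesis using False by (auto simp: Q_def)
    qed
    note P = ac_deriv_prim[OF m(1)]
    have Pm: "multiplier (prim m) m = - (LINT x|leb_I. stress x * m x)"
      by (rule multiplier_eq_stress[OF P]) (use m in simp)
    have "multiplier (prim m) m \<le> multiplier Q Q'"
      by (rule multiplier_mono[OF P Q]) (use Qge in force)
    moreover have "multiplier (\<lambda>x. (-1) * prim m x) (\<lambda>x. (-1) * m x) \<le> multiplier Q Q'"
      by (rule multiplier_mono[OF ac_deriv_cmult[OF P] Q]) (use Qge in force)
    ultimately have "\<bar>LINT x|leb_I. stress x * m x\<bar> \<le> multiplier Q Q'"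
      unfolding multiplier_cmult Pm by simp
    also have "\<dots> \<le> \<beta> * (LINT x|leb_I. \<bar>load' x\<bar> * Q x)"
    proof (rule multiplier_le_load[OF Q])
      show "0 \<le> Q x" if "x \<in> {-1..1}" for x using Qge[OF that] by linarith
    qed (auto simp: Q_def V1, simp add: V_def)
    also have "\<dots> \<le> \<beta> * (LINT x|leb_I. W / 2 * (indicat_real {a..<b} x * \<bar>load' x\<bar>))"
    proof (intro mult_left_mono integral_mono)
      show "integrable leb_I (\<lambda>x. \<bar>load' x\<bar> * Q x)"
        by (rule L2_mult_integrable[OF L2_abs[OF Ll] ac_deriv_L2_fun[OF Q]])
      show "integrable leb_I (\<lambda>x. W / 2 * (indicat_real {a..<b} x * \<bar>load' x\<bar>))"
        by (intro integrable_mult_right ind_integrable L2_integrable L2_abs Ll) simp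
    qed (use Qle \<beta> in auto)
    also have "\<dots> = W * (LINT x|leb_I. indicat_real {a..<b} x * (\<beta> / 2 * \<bar>load' x\<bar>))"
      by (simp add: mult.left_commute[of _ \<beta>] mult.left_commute[of "indicat_real _ _"])
    finally show ?thesis by (simp add: W_def)
  qed
qed

lemma local_osc_second_derivative: "\<exists>k. local_osc r k"
proof -
  have "local_osc (\<lambda>x. (1 / \<beta>) * (stress x + (-1) * prim reac x) + (-1) * f x)
     (\<lambda>x. \<bar>1 / \<beta>\<bar> * (\<beta> / 2 * \<bar>load' x\<bar> + \<bar>-1\<bar> * \<bar>reac x\<bar>) + \<bar>-1\<bar> * \<bar>f' x\<bar>)"
    by (intro local_osc_add local_osc_cmult local_osc_stress local_osc_ac_deriv f ac_deriv_prim L2_reac)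
  moreover have "(\<lambda>x. (1 / \<beta>) * (stress x + (-1) * prim reac x) + (-1) * f x) = r"
    using \<beta> by (auto simp: stress_def)
  ultimately show ?thesis by auto
qed

lemma local_osc_gap': "\<exists>k. local_osc gap' k"
proof -
  obtain k where "local_osc r k" using local_osc_second_derivative by blast
  then have "local_osc (\<lambda>x. \<psi>' x + (-1) * r x) (\<lambda>x. \<bar>\<psi>'' x\<bar> + \<bar>-1\<bar> * k x)"
    by (intro local_osc_add local_osc_cmult local_osc_ac_deriv \<psi>')
  moreover have "(\<lambda>x. \<psi>' x + (-1) * r x) = gap'" by (auto simp: gap'_def)
  ultimately show ?thesis by auto
qed

end

section \<open>Piecewise functions and projections on a grid\<close>

locale mesh =
  fixes n :: nat and x :: "nat \<Rightarrow> real"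
  assumes grid: "grid n x"
begin

lemma n_pos: "0 < n" and x_0: "x 0 = -1" and x_n: "x n = 1" and x_Suc: "i < n \<Longrightarrow> x i < x (Suc i)"
  using grid by (auto simp: grid_def)

lemma x_mono: "i \<le> j \<Longrightarrow> j \<le> n \<Longrightarrow> x i \<le> x j"
proof (induction rule: dec_induct)
  case (step k)
  then show ?case using x_Suc[of k] by simp
qed simp

lemma x_bounds: "i \<le> n \<Longrightarrow> -1 \<le> x i" "i \<le> n \<Longrightarrow> x i \<le> 1"
  using x_mono[of 0 i] x_mono[of i n] x_0 x_n by auto

definition h :: real where "h = mesh_size n x"

lemma cell_length: "i < n \<Longrightarrow> x (Suc i) - x i \<le> h"
  unfolding h_def mesh_size_def by (rule Max_ge) auto

lemma h_pos: "0 < h"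
  using cell_length[of 0] x_Suc[of 0] n_pos by linarith

definition cell :: "nat \<Rightarrow> real set" where "cell i = {x i..<x (Suc i)}"

lemma cell_exists:
  assumes "t \<in> {-1..<1}" obtains i where "i < n" "t \<in> cell i"
proof -
  have "\<exists>i<m. t \<in> cell i" if "m \<le> n" "t < x m" for m
    using that
  proof (induction m)
    case 0 then show ?case using assms x_0 by simp
  next
    case (Suc m)
    then show ?case by (cases "t < x m") (auto simp: cell_def less_Suc_eq)
  qed
  from this[of n] show ?thesis using that assms x_n by auto
qed

lemma closed_cell_exists:
  assumes "t \<in> {-1..1}" obtains i where "i < n" "t \<in> {x i..x (Suc i)}"
proof (cases "t = 1")
  case True
  then show ?thesis using that[of "n - 1"] n_pos x_n x_mono[of "n - 1" n] by auto
next
  case False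
  then obtain i where "i < n" "t \<in> cell i" using cell_exists[of t] assms by auto
  then show ?thesis using that[of i] by (auto simp: cell_def)
qed

lemma cell_unique:
  assumes "i < n" "j < n" "t \<in> cell i" "t \<in> cell j" shows "i = j"
proof (rule ccontr)
  assume "i \<noteq> j"
  then consider "Suc i \<le> j" | "Suc j \<le> i" by linarith
  then show False using x_mono[of "Suc i" j] x_mono[of "Suc j" i] assms by cases (auto simp: cell_def)
qed

abbreviation cind :: "nat \<Rightarrow> real \<Rightarrow> real" where "cind i \<equiv> indicat_real (cell i)"

definition pw :: "(nat \<Rightarrow> real \<Rightarrow> real) \<Rightarrow> real \<Rightarrow> real" where
  "pw q t = (\<Sum>i<n. cind i t * q i t)"

lemma pw_eq: assumes "j < n" "t \<in> cell j" shows "pw q t = q j t"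
proof -
  have "pw q t = (\<Sum>i<n. if i = j then q j t else 0)"
    unfolding pw_def by (rule sum.cong) (use assms cell_unique in \<open>auto simp: indicator_def\<close>)
  then show ?thesis using assms by simp
qed

lemma pw_same: "t \<in> {-1<..<1} \<Longrightarrow> pw (\<lambda>i. u) t = u t"
  using cell_exists[of t] pw_eq[of _ t "\<lambda>i. u"] by auto

lemma cell_borel [simp]: "cell i \<in> sets borel" by (simp add: cell_def)

lemma L2_cell: "u \<in> L2 \<Longrightarrow> (\<lambda>t. cind i t * u t) \<in> L2"
  by (rule L2_indicator[OF _ cell_borel])

lemma L2_pw: "(\<And>i. i < n \<Longrightarrow> q i \<in> L2) \<Longrightarrow> pw q \<in> L2"
  unfolding pw_def[abs_def] by (intro L2_sum L2_cell) auto

lemma integral_pw: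
  assumes "\<And>i. i < n \<Longrightarrow> integrable leb_I (q i)"
  shows "(LINT t|leb_I. pw q t) = (\<Sum>i<n. LINT t|leb_I. cind i t * q i t)"
  unfolding pw_def using assms by (intro Bochner_Integration.integral_sum ind_integrable) auto

lemma integral_cells:
  assumes "integrable leb_I u"
  shows "(LINT t|leb_I. u t) = (\<Sum>i<n. LINT t|leb_I. cind i t * u t)"
proof -
  have "(LINT t|leb_I. u t) = (LINT t|leb_I. pw (\<lambda>i. u) t)"
    by (rule Bochner_Integration.integral_cong) (auto simp: pw_same)
  then show ?thesis using integral_pw[of "\<lambda>i. u"] assms by simp
qed

lemma integral_cell_pw:
  assumes "i < n"
  shows "(LINT t|leb_I. cind i t * F (pw q t) t) = (LINT t|leb_I. cind i t * F (q i t) t)"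
  by (rule Bochner_Integration.integral_cong) (use assms in \<open>auto simp: indicator_def pw_eq\<close>)

lemma integral_cell_1: "i < n \<Longrightarrow> (LINT t|leb_I. cind i t) = x (Suc i) - x i"
  unfolding cell_def using measure_leb_I_Ico[of "x i" "x (Suc i)"] x_bounds[of i] x_bounds[of "Suc i"] x_Suc[of i] by auto

lemma prim_cell:
  assumes "u \<in> L2" "i < n"
  shows "prim u (x (Suc i)) - prim u (x i) = (LINT t|leb_I. cind i t * u t)"
  unfolding cell_def using x_Suc[OF assms(2)] by (intro prim_diff_eq assms) simp

lemma prim_nodes_eq:
  assumes "u \<in> L2" "v \<in> L2" "\<And>i. i < n \<Longrightarrow> (LINT t|leb_I. cind i t * u t) = (LINT t|leb_I. cind i t * v t)"
    and "i \<le> n"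
  shows "prim u (x i) = prim v (x i)"
  using assms(4)
proof (induction i)
  case 0 then show ?case by (simp add: x_0)
next
  case (Suc i)
  then show ?case using prim_cell[OF assms(1), of i] prim_cell[OF assms(2), of i] assms(3)[of i] by auto
qed

text \<open>Here \<open>F\<close> may be any primitive of the piece, so that a closed formula for it yields one for \<open>prim\<close> on the cell.\<close>
lemma prim_pw_cell:
  assumes q: "\<And>i. i < n \<Longrightarrow> q i \<in> L2" and i: "i < n" and t: "t \<in> {x i..x (Suc i)}"
    and F: "ac_deriv F (q i)"
  shows "prim (pw q) t = prim (pw q) (x i) + (F t - F (x i))"
proof -
  have b: "-1 \<le> x i" "t \<le> 1" using x_bounds[of i] x_bounds[of "Suc i"] i t by auto
  have "prim (pw q) t - prim (pw q) (x i) = (LINT s|leb_I. indicat_real {x i..<t} s * pw q s)"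
    using t by (intro prim_diff_eq L2_pw q) auto
  also have "\<dots> = (LINT s|leb_I. indicat_real {x i..<t} s * q i s)"
    using t i by (intro Bochner_Integration.integral_cong) (auto simp: indicator_def pw_eq cell_def)
  also have "\<dots> = F t - F (x i)"
    using t b by (intro ac_deriv_diff_eq[symmetric] F) auto
  finally show ?thesis by simp
qed

definition cell_mean :: "(real \<Rightarrow> real) \<Rightarrow> nat \<Rightarrow> real" where
  "cell_mean u i = (LINT t|leb_I. cind i t * u t) / (x (Suc i) - x i)"

text \<open>The \<open>L\<^sub>2\<close> projection onto piecewise constants. Its primitive is the piecewise linear nodal interpolant of the
  primitive (\<open>prim_proj0_nodes\<close>).\<close>
definition proj0 :: "(real \<Rightarrow> real) \<Rightarrow> real \<Rightarrow> real" where
  "proj0 u = pw (\<lambda>i t. cell_mean u i)"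

lemma L2_proj0: "proj0 u \<in> L2"
  unfolding proj0_def by (intro L2_pw L2_const)

lemma cell_mean_integral: "i < n \<Longrightarrow> (LINT t|leb_I. cind i t * cell_mean u i) = (LINT t|leb_I. cind i t * u t)"
  using x_Suc[of i] integral_cell_1[of i] by (simp only: integral_mult_left_zero cell_mean_def) simp

lemma proj0_cell_integral: "i < n \<Longrightarrow> (LINT t|leb_I. cind i t * proj0 u t) = (LINT t|leb_I. cind i t * u t)"
  unfolding proj0_def using integral_cell_pw[of i "\<lambda>a t. a" "\<lambda>i t. cell_mean u i"] cell_mean_integral by simp

lemma proj0_error_cell: "u \<in> L2 \<Longrightarrow> i < n \<Longrightarrow> (LINT t|leb_I. cind i t * (u t - cell_mean u i)) = 0"
  using cell_mean_integral[of i u] ind_integrable[OF L2_integrable, of u "cell i"]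
    ind_integrable[OF L2_integrable[OF L2_const], of "cell i" "cell_mean u i"]
  by (simp add: right_diff_distrib)

lemma proj0_diff:
  assumes "u \<in> L2" "v \<in> L2" shows "proj0 (\<lambda>t. u t - v t) t = proj0 u t - proj0 v t"
proof -
  have "cell_mean (\<lambda>t. u t - v t) i = cell_mean u i - cell_mean v i" for i
    using L2_integrable[OF assms(1)] L2_integrable[OF assms(2)]
    by (simp add: cell_mean_def right_diff_distrib ind_integrable diff_divide_distrib)
  then show ?thesis by (simp add: proj0_def pw_def right_diff_distrib sum_subtractf)
qed

text \<open>Test the oscillation bound with \<open>m\<close> the error itself, cut off to the cell. Both integrals on the right hand
  side gain a factor \<open>sqrt (x (Suc i) - x i)\<close> from the Cauchy--Schwarz inequality.\<close>
lemma proj0_error_cell_bound: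
  assumes u: "local_osc u k" and i: "i < n"
  shows "(LINT t|leb_I. cind i t * (u t - cell_mean u i)\<^sup>2) \<le> h\<^sup>2 * (LINT t|leb_I. cind i t * (k t)\<^sup>2)"
proof -
  have L: "u \<in> L2" "k \<in> L2" "\<And>t. 0 \<le> k t" using u by (auto simp: local_osc_def)
  define l where "l = x (Suc i) - x i"
  have l: "0 < l" "l \<le> h" using x_Suc[OF i] cell_length[OF i] by (auto simp: l_def)
  have b: "-1 \<le> x i" "x i \<le> x (Suc i)" "x (Suc i) \<le> 1" using x_bounds[of i] x_bounds[of "Suc i"] i x_Suc[OF i] by auto
  define c where "c = cell_mean u i"
  define m where "m = (\<lambda>t. cind i t * (u t - c))"
  have m: "m \<in> L2" unfolding m_def using L by (intro L2_cell L2_diff L2_const)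
  have mz: "(LINT t|leb_I. m t) = 0" using proj0_error_cell[OF L(1) i] by (simp add: m_def c_def)
  have ms: "\<And>t. t \<notin> cell i \<Longrightarrow> m t = 0" by (simp add: m_def)
  have Lc: "cind i \<in> L2" using L2_cell[OF L2_const[of 1], of i] by simp
  have nc: "L2_norm (cind i) = sqrt l" unfolding cell_def l_def by (rule L2_norm_indicator_Ico[OF b])
  have norm_le: "(LINT t|leb_I. \<bar>v t\<bar>) \<le> sqrt l * L2_norm v" if "v \<in> L2" "\<And>t. t \<notin> cell i \<Longrightarrow> v t = 0" for v
  proof -
    have "(LINT t|leb_I. \<bar>v t\<bar>) = (LINT t|leb_I. cind i t * \<bar>v t\<bar>)"
      by (rule Bochner_Integration.integral_cong) (use that(2) in \<open>auto simp: indicator_def\<close>)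
    also have "\<dots> \<le> L2_norm (cind i) * L2_norm (\<lambda>t. \<bar>v t\<bar>)"
      using Cauchy_Schwarz_L2[OF Lc L2_abs[OF that(1)]] by (simp add: abs_le_iff)
    also have "L2_norm (\<lambda>t. \<bar>v t\<bar>) = L2_norm v" by (simp add: L2_norm_def)
    finally show ?thesis by (simp add: nc)
  qed
  define w where "w = (\<lambda>t. cind i t * k t)"
  have w: "w \<in> L2" unfolding w_def by (rule L2_cell[OF L(2)])
  have sq: "(\<lambda>t. (m t)\<^sup>2) = (\<lambda>t. cind i t * (u t - c)\<^sup>2)" "(\<lambda>t. (w t)\<^sup>2) = (\<lambda>t. cind i t * (k t)\<^sup>2)"
    by (auto simp: m_def w_def indicator_def)
  have "(L2_norm m)\<^sup>2 = (LINT t|leb_I. (u t - c) * m t)"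
    unfolding L2_norm_square by (rule Bochner_Integration.integral_cong) (auto simp: m_def indicator_def power2_eq_square)
  also have "\<dots> = (LINT t|leb_I. u t * m t)"
    using L2_mult_integrable[OF L(1) m] L2_integrable[OF m] mz by (simp add: left_diff_distrib)
  also have "\<dots> \<le> (LINT t|leb_I. \<bar>m t\<bar>) * (LINT t|leb_I. indicat_real {x i..<x (Suc i)} t * k t)"
    using u b m mz ms unfolding local_osc_def cell_def by (auto simp: abs_le_iff)
  also have "(LINT t|leb_I. indicat_real {x i..<x (Suc i)} t * k t) = (LINT t|leb_I. \<bar>w t\<bar>)"
    using L(3) by (simp add: w_def cell_def abs_mult)
  also have "(LINT t|leb_I. \<bar>m t\<bar>) * (LINT t|leb_I. \<bar>w t\<bar>) \<le> (sqrt l * L2_norm m) * (sqrt l * L2_norm w)"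
    using l by (intro mult_mono norm_le m w ms) (auto simp: w_def)
  also have "\<dots> = (sqrt l * sqrt l) * L2_norm w * L2_norm m" by (simp only: mult_ac)
  also have "\<dots> = l * L2_norm w * L2_norm m" using l by simp
  finally have "L2_norm m * L2_norm m \<le> (l * L2_norm w) * L2_norm m" by (simp add: power2_eq_square)
  then have "L2_norm m \<le> l * L2_norm w"
    using l L2_norm_nonneg[of m] L2_norm_nonneg[of w] by (cases "L2_norm m = 0") (auto simp: mult_le_cancel_right)
  also have "\<dots> \<le> h * L2_norm w" using l by (intro mult_right_mono) auto
  finally have "(L2_norm m)\<^sup>2 \<le> (h * L2_norm w)\<^sup>2" by (rule power_mono) simp
  then show ?thesis by (simp add: L2_norm_square power_mult_distrib sq c_def)
qed

lemma proj0_error_bound: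
  assumes u: "local_osc u k"
  shows "L2_norm (\<lambda>t. u t - proj0 u t) \<le> h * L2_norm k"
proof (rule power2_le_imp_le)
  have L: "u \<in> L2" "k \<in> L2" using u by (auto simp: local_osc_def)
  have "(L2_norm (\<lambda>t. u t - proj0 u t))\<^sup>2 = (\<Sum>i<n. LINT t|leb_I. cind i t * (u t - proj0 u t)\<^sup>2)"
    unfolding L2_norm_square by (intro integral_cells L2_square_integrable L2_diff L L2_proj0)
  also have "\<dots> = (\<Sum>i<n. LINT t|leb_I. cind i t * (u t - cell_mean u i)\<^sup>2)"
    unfolding proj0_def by (intro sum.cong refl integral_cell_pw[where F="\<lambda>a t. (u t - a)\<^sup>2"]) simp
  also have "\<dots> \<le> (\<Sum>i<n. h\<^sup>2 * (LINT t|leb_I. cind i t * (k t)\<^sup>2))"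
    by (intro sum_mono proj0_error_cell_bound u) simp
  also have "\<dots> = h\<^sup>2 * (LINT t|leb_I. (k t)\<^sup>2)"
    using integral_cells[OF L2_square_integrable[OF L(2)]] by (simp add: sum_distrib_left)
  finally show "(L2_norm (\<lambda>t. u t - proj0 u t))\<^sup>2 \<le> (h * L2_norm k)\<^sup>2"
    by (simp add: power_mult_distrib L2_norm_square)
qed (use h_pos in simp)

lemma proj0_orthogonal:
  assumes v: "v \<in> L2"
  shows "(LINT t|leb_I. proj0 u t * (v t - proj0 v t)) = 0"
proof -
  have "(LINT t|leb_I. proj0 u t * (v t - proj0 v t)) = (\<Sum>i<n. LINT t|leb_I. cind i t * (proj0 u t * (v t - proj0 v t)))"
    using v by (intro integral_cells L2_mult_integrable L2_diff L2_proj0)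
  also have "\<dots> = (\<Sum>i<n. 0)"
  proof (intro sum.cong refl)
    fix i assume "i \<in> {..<n}"
    then have i: "i < n" by simp
    have "(LINT t|leb_I. cind i t * (proj0 u t * (v t - proj0 v t))) = (LINT t|leb_I. cell_mean u i * (cind i t * (v t - cell_mean v i)))"
      by (rule Bochner_Integration.integral_cong) (use i in \<open>auto simp: indicator_def proj0_def pw_eq\<close>)
    then show "(LINT t|leb_I. cind i t * (proj0 u t * (v t - proj0 v t))) = 0"
      using proj0_error_cell[OF v i] by simp
  qed
  finally show ?thesis by simp
qed

lemma integral_mult_proj0_error:
  assumes u: "u \<in> L2" and v: "v \<in> L2"
  shows "(LINT t|leb_I. u t * (v t - proj0 v t)) = (LINT t|leb_I. (u t - proj0 u t) * (v t - proj0 v t))"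
proof -
  have d: "(\<lambda>t. v t - proj0 v t) \<in> L2" by (intro L2_diff v L2_proj0)
  show ?thesis
    using proj0_orthogonal[OF v, of u] L2_mult_integrable[OF u d] L2_mult_integrable[OF L2_proj0 d, of u]
    by (simp add: left_diff_distrib)
qed

lemma proj0_error_le: 
  assumes v: "v \<in> L2" shows "L2_norm (\<lambda>t. v t - proj0 v t) \<le> L2_norm v"
proof -
  let ?d = "\<lambda>t. v t - proj0 v t"
  have d: "?d \<in> L2" by (intro L2_diff v L2_proj0)
  have "L2_norm ?d * L2_norm ?d = (LINT t|leb_I. v t * ?d t)"
    using L2_norm_square[of ?d] integral_mult_proj0_error[OF v v] by (simp add: power2_eq_square)
  also have "\<dots> \<le> L2_norm v * L2_norm ?d" using Cauchy_Schwarz_L2[OF v d] by (simp add: abs_le_iff)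
  finally show ?thesis
    using L2_norm_nonneg[of ?d] L2_norm_nonneg[of v] by (cases "L2_norm ?d = 0") (auto simp: mult_le_cancel_right)
qed

lemma prim_proj0_nodes: "u \<in> L2 \<Longrightarrow> i \<le> n \<Longrightarrow> prim (proj0 u) (x i) = prim u (x i)"
  by (intro prim_nodes_eq L2_proj0 proj0_cell_integral)

lemma affine_nonneg:
  assumes "0 \<le> a + b * s" "0 \<le> a + b * (t::real)" "s \<le> u" "u \<le> t" shows "0 \<le> a + b * u"
proof (cases "0 \<le> b")
  case True then show ?thesis using assms mult_left_mono[of s u b] by linarith
next
  case False then show ?thesis using assms mult_left_mono_neg[of u t b] by linarith
qed

lemma ac_deriv_linear: "ac_deriv (\<lambda>t. c * t) (\<lambda>t. c)"
  by (rule ac_deriv_classical[of "{}"]) (auto intro!: continuous_intros derivative_eq_intros L2_const)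

lemma prim_pw_const_cell:
  assumes "i < n" "t \<in> {x i..x (Suc i)}"
  shows "prim (pw (\<lambda>i t. c i)) t = (prim (pw (\<lambda>i t. c i)) (x i) - c i * x i) + c i * t"
  using prim_pw_cell[of "\<lambda>i t. c i", OF L2_const assms ac_deriv_linear] by simp

text \<open>The function below is the piecewise linear interpolant of \<open>q\<close>; it is affine on each cell and hence inherits
  nonnegativity from the nodes.\<close>
lemma nodal_interpolant_nonneg:
  assumes q: "ac_deriv q s" and nodes: "\<And>i. i \<le> n \<Longrightarrow> 0 \<le> q (x i)" and t: "t \<in> {-1..1}"
  shows "0 \<le> q (-1) + prim (proj0 s) t"
proof -
  obtain i where i: "i < n" "t \<in> {x i..x (Suc i)}" by (rule closed_cell_exists[OF t])
  define a b where "a = q (-1) + (prim (proj0 s) (x i) - cell_mean s i * x i)" and "b = cell_mean s i"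
  have e: "q (-1) + prim (proj0 s) u = a + b * u" if "u \<in> {x i..x (Suc i)}" for u
    using prim_pw_const_cell[OF i(1) that, of "cell_mean s"] by (simp add: a_def b_def proj0_def)
  have N: "0 \<le> q (-1) + prim (proj0 s) (x j)" if "j \<le> n" for j
    using nodes[OF that] ac_deriv_eq[OF q, of "x j"] x_bounds[OF that] prim_proj0_nodes[OF ac_deriv_L2[OF q] that] by simp
  show ?thesis
    using N[of i] N[of "Suc i"] e[of "x i"] e[of "x (Suc i)"] e[of t] i x_Suc[OF i(1)] affine_nonneg[of a b "x i" "x (Suc i)" t]
    by simp
qed

definition cell_mid :: "nat \<Rightarrow> real" where "cell_mid i = (x i + x (Suc i)) / 2"

text \<open>The coefficient of the \<open>L\<^sub>2\<close> projection onto affine functions; \<open>12 / l\<^sup>3\<close> normalises \<open>t - cell_mid i\<close> on a cell of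
  length \<open>l\<close> (\<open>integral_cell_shift_square\<close>).\<close>
definition cell_slope :: "(real \<Rightarrow> real) \<Rightarrow> nat \<Rightarrow> real" where
  "cell_slope u i = 12 / (x (Suc i) - x i) ^ 3 * (LINT t|leb_I. cind i t * (u t * (t - cell_mid i)))"

text \<open>The \<open>L\<^sub>2\<close> projection onto discontinuous piecewise affine functions. Applied to \<open>y''\<close> it gives the second derivative of the
  cubic Hermite interpolant: on each cell the two orthogonality relations say that \<open>y'\<close> and \<open>y\<close> gain the same
  increments as their interpolants.\<close>
definition proj1 :: "(real \<Rightarrow> real) \<Rightarrow> real \<Rightarrow> real" where
  "proj1 u = pw (\<lambda>i t. cell_mean u i + cell_slope u i * (t - cell_mid i))"

lemma L2_affine: "(\<lambda>t. a + b * (t - c)) \<in> L2"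
  by (intro L2_continuous continuous_intros)

lemma L2_shift: "(\<lambda>t. t - c) \<in> L2"
  by (intro L2_continuous continuous_intros)

lemma L2_proj1: "proj1 u \<in> L2"
  unfolding proj1_def by (intro L2_pw L2_affine)

lemma integral_cell_poly:
  assumes i: "i < n" and F: "\<And>t. (F has_real_derivative g t) (at t)" and g: "continuous_on {-1..1} g"
  shows "(LINT t|leb_I. cind i t * g t) = F (x (Suc i)) - F (x i)"
proof -
  have "ac_deriv F g"
  proof (rule ac_deriv_classical[of "{}"])
    show "continuous_on {-1..1} F" using F by (meson DERIV_isCont continuous_at_imp_continuous_on)
    show "g \<in> L2" by (rule L2_continuous[OF g])
  qed (use F in auto)
  then show ?thesis unfolding cell_def
    using x_bounds[of i] x_bounds[of "Suc i"] x_Suc[OF i] i by (intro ac_deriv_diff_eq[symmetric]) auto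
qed

lemma integral_cell_shift: "i < n \<Longrightarrow> (LINT t|leb_I. cind i t * (t - cell_mid i)) = 0"
proof -
  assume i: "i < n"
  have "(LINT t|leb_I. cind i t * (t - cell_mid i)) = (x (Suc i) - cell_mid i)\<^sup>2 / 2 - (x i - cell_mid i)\<^sup>2 / 2"
    by (rule integral_cell_poly[OF i]) (auto intro!: derivative_eq_intros continuous_intros)
  then show ?thesis by (simp add: cell_mid_def power2_eq_square field_simps)
qed

lemma integral_cell_shift_square:
  "i < n \<Longrightarrow> (LINT t|leb_I. cind i t * (t - cell_mid i)\<^sup>2) = (x (Suc i) - x i) ^ 3 / 12"
proof -
  assume i: "i < n"
  have "(LINT t|leb_I. cind i t * (t - cell_mid i)\<^sup>2) = (x (Suc i) - cell_mid i) ^ 3 / 3 - (x i - cell_mid i) ^ 3 / 3"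
    by (rule integral_cell_poly[OF i]) (auto intro!: derivative_eq_intros continuous_intros)
  then show ?thesis by (simp add: cell_mid_def power3_eq_cube field_simps)
qed

lemma proj1_error_cell:
  assumes u: "u \<in> L2" and i: "i < n"
  shows "(LINT t|leb_I. cind i t * (u t - proj1 u t)) = 0"
    and "(LINT t|leb_I. cind i t * ((u t - proj1 u t) * (t - cell_mid i))) = 0"
proof -
  let ?m = "cell_mid i" and ?a = "cell_mean u i" and ?b = "cell_slope u i"
  have int1: "integrable leb_I (\<lambda>t. cind i t * u t)" "integrable leb_I (\<lambda>t. cind i t * (t - ?m))"
     "integrable leb_I (\<lambda>t. cind i t)"
    using ind_integrable[OF L2_integrable[OF L2_const[of 1]], of "cell i"]
    by (auto intro!: L2_integrable L2_cell u L2_shift)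
  have int2: "integrable leb_I (\<lambda>t. cind i t * (u t * (t - ?m)))" "integrable leb_I (\<lambda>t. cind i t * (t - ?m)\<^sup>2)"
    by (rule ind_integrable[OF L2_mult_integrable[OF u L2_shift] cell_borel]
        ind_integrable[OF L2_square_integrable[OF L2_shift] cell_borel])+
  have "(LINT t|leb_I. cind i t * (u t - proj1 u t)) = (LINT t|leb_I. cind i t * (u t - (?a + ?b * (t - ?m))))"
    unfolding proj1_def by (rule integral_cell_pw[OF i, where F="\<lambda>a t. u t - a"])
  also have "\<dots> = (LINT t|leb_I. cind i t * u t - ?a * cind i t - ?b * (cind i t * (t - ?m)))"
    by (rule Bochner_Integration.integral_cong) (auto simp: algebra_simps)
  also have "\<dots> = (LINT t|leb_I. cind i t * u t) - ?a * (LINT t|leb_I. cind i t) - ?b * (LINT t|leb_I. cind i t * (t - ?m))"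
    using int1 by simp
  also have "\<dots> = 0"
    unfolding integral_cell_shift[OF i] integral_cell_1[OF i] using x_Suc[OF i] by (simp add: cell_mean_def)
  finally show "(LINT t|leb_I. cind i t * (u t - proj1 u t)) = 0" .
  have "(LINT t|leb_I. cind i t * ((u t - proj1 u t) * (t - ?m))) = (LINT t|leb_I. cind i t * ((u t - (?a + ?b * (t - ?m))) * (t - ?m)))"
    unfolding proj1_def by (rule integral_cell_pw[OF i, where F="\<lambda>a t. (u t - a) * (t - ?m)"])
  also have "\<dots> = (LINT t|leb_I. cind i t * (u t * (t - ?m)) - ?a * (cind i t * (t - ?m)) - ?b * (cind i t * (t - ?m)\<^sup>2))"
    by (rule Bochner_Integration.integral_cong) (auto simp: algebra_simps power2_eq_square)
  also have "\<dots> = (LINT t|leb_I. cind i t * (u t * (t - ?m))) - ?a * (LINT t|leb_I. cind i t * (t - ?m)) - ?b * (LINT t|leb_I. cind i t * (t - ?m)\<^sup>2)"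
    using int1 int2 by simp
  also have "\<dots> = 0"
    unfolding integral_cell_shift[OF i] integral_cell_shift_square[OF i] using x_Suc[OF i] by (simp add: cell_slope_def)
  finally show "(LINT t|leb_I. cind i t * ((u t - proj1 u t) * (t - ?m))) = 0" .
qed

text \<open>Pythagoras: the error of \<open>proj1\<close> is orthogonal to \<open>proj1 u - proj0 u\<close>.\<close>
lemma proj1_error_le_proj0_error:
  assumes u: "u \<in> L2"
  shows "L2_norm (\<lambda>t. u t - proj1 u t) \<le> L2_norm (\<lambda>t. u t - proj0 u t)"
proof -
  define d where "d = (\<lambda>t. u t - proj1 u t)"
  define w where "w = pw (\<lambda>i t. cell_slope u i * (t - cell_mid i))"
  have d: "d \<in> L2" unfolding d_def by (intro L2_diff u L2_proj1)
  have w: "w \<in> L2" unfolding w_def by (intro L2_pw L2_cmult L2_shift)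
  have e: "(\<lambda>t. u t - proj0 u t) = (\<lambda>t. d t + w t)"
    by (auto simp: d_def w_def proj0_def proj1_def pw_def distrib_left sum.distrib)
  have "(LINT t|leb_I. d t * w t) = (\<Sum>i<n. LINT t|leb_I. cind i t * (d t * w t))"
    by (intro integral_cells L2_mult_integrable d w)
  also have "\<dots> = (\<Sum>i<n. 0)"
  proof (intro sum.cong refl)
    fix i assume "i \<in> {..<n}"
    then have i: "i < n" by simp
    have "(LINT t|leb_I. cind i t * (d t * w t)) = (LINT t|leb_I. cell_slope u i * (cind i t * (d t * (t - cell_mid i))))"
      by (rule Bochner_Integration.integral_cong) (use i in \<open>auto simp: indicator_def w_def pw_eq\<close>)
    also have "\<dots> = 0" using proj1_error_cell(2)[OF u i] by (simp add: d_def)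
    finally show "(LINT t|leb_I. cind i t * (d t * w t)) = 0" .
  qed
  finally have "(L2_norm (\<lambda>t. u t - proj0 u t))\<^sup>2 = (L2_norm d)\<^sup>2 + (L2_norm w)\<^sup>2"
    unfolding e L2_norm_add[OF d w] by simp
  then have "(L2_norm d)\<^sup>2 \<le> (L2_norm (\<lambda>t. u t - proj0 u t))\<^sup>2" by simp
  then show ?thesis unfolding d_def by (rule power2_le_imp_le) simp
qed

lemma prim_proj1_nodes: 
  assumes u: "u \<in> L2" and i: "i \<le> n" shows "prim (proj1 u) (x i) = prim u (x i)"
proof (rule prim_nodes_eq[OF L2_proj1 u _ i])
  fix j assume j: "j < n"
  show "(LINT t|leb_I. cind j t * proj1 u t) = (LINT t|leb_I. cind j t * u t)"
    using proj1_error_cell(1)[OF u j] ind_integrable[OF L2_integrable[OF u], of "cell j"]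
      ind_integrable[OF L2_integrable[OF L2_proj1], of "cell j" u]
    by (simp add: right_diff_distrib)
qed

text \<open>Integration by parts on a cell turns the integral of the primitive of the error into its first moment, which
  vanishes.\<close>
lemma integral_prim_proj1:
  assumes u: "u \<in> L2" shows "(LINT t|leb_I. prim (proj1 u) t) = (LINT t|leb_I. prim u t)"
proof -
  define e where "e = (\<lambda>t. u t - proj1 u t)"
  have e: "e \<in> L2" unfolding e_def by (intro L2_diff u L2_proj1)
  have nodes: "prim e (x i) = 0" if "i \<le> n" for i
    using prim_proj1_nodes[OF u that] u L2_proj1 by (simp add: e_def prim_diff)
  have "(LINT t|leb_I. prim e t) = (\<Sum>i<n. LINT t|leb_I. cind i t * prim e t)"
    by (intro integral_cells L2_integrable prim_L2 e)
  also have "\<dots> = (\<Sum>i<n. 0)"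
  proof (intro sum.cong refl)
    fix i assume "i \<in> {..<n}"
    then have i: "i < n" by simp
    define m where "m = cell_mid i"
    have "ac_deriv (\<lambda>t. t - m) (\<lambda>t. 1)"
      by (rule ac_deriv_classical[of "{}"]) (auto intro!: continuous_intros derivative_eq_intros L2_const)
    then have D: "ac_deriv (\<lambda>t. prim e t * (t - m)) (\<lambda>t. e t * (t - m) + prim e t * 1)"
      by (rule ac_deriv_mult[OF ac_deriv_prim[OF e]])
    have "0 = (LINT t|leb_I. cind i t * (e t * (t - m) + prim e t * 1))"
      using ac_deriv_diff_eq[OF D, of "x i" "x (Suc i)"] nodes[of i] nodes[of "Suc i"] i
        x_bounds[of i] x_bounds[of "Suc i"] x_Suc[OF i] by (simp add: cell_def)
    also have "\<dots> = (LINT t|leb_I. cind i t * (e t * (t - m))) + (LINT t|leb_I. cind i t * prim e t)"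
      using ind_integrable[OF L2_mult_integrable[OF e L2_shift[of m]], of "cell i"]
        ind_integrable[OF L2_integrable[OF prim_L2[OF e]], of "cell i"] by (simp add: distrib_left)
    also have "(LINT t|leb_I. cind i t * (e t * (t - m))) = 0"
      using proj1_error_cell(2)[OF u i] by (simp add: e_def m_def)
    finally show "(LINT t|leb_I. cind i t * prim e t) = 0" by simp
  qed
  finally have "(LINT t|leb_I. prim e t) = 0" by simp
  moreover have "(LINT t|leb_I. prim e t) = (LINT t|leb_I. prim u t) - (LINT t|leb_I. prim (proj1 u) t)"
    using u L2_proj1 by (simp add: e_def prim_diff L2_integrable prim_L2)
  ultimately show ?thesis by simp
qed

end

section \<open>The finite element space\<close>

lemma has_slope_segment:
  assumes y: "has_slope y p r" and z: "has_slope z q s"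
  shows "has_slope (\<lambda>t. y t + c * (z t - y t)) (\<lambda>t. p t + c * (q t - p t)) (\<lambda>t. r t + c * (s t - r t))"
  unfolding has_slope_def
proof (intro conjI)
  have p: "ac_deriv p r" "prim p 1 = 0" and q: "ac_deriv q s" "prim q 1 = 0"
    and ae: "AE t in leb_I. y t = prim p t" "AE t in leb_I. z t = prim q t"
    using y z unfolding has_slope_def by blast+
  note L = ac_deriv_L2_fun[OF p(1)] ac_deriv_L2_fun[OF q(1)]
  show "ac_deriv (\<lambda>t. p t + c * (q t - p t)) (\<lambda>t. r t + c * (s t - r t))"
    by (intro ac_deriv_add ac_deriv_cmult ac_deriv_diff p q)
  have e: "prim (\<lambda>t. p t + c * (q t - p t)) t = prim p t + c * (prim q t - prim p t)" for t
    using L by (simp add: prim_add prim_cmult prim_diff L2_intros)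
  show "prim (\<lambda>t. p t + c * (q t - p t)) 1 = 0" using e[of 1] p(2) q(2) by simp
  show "AE t in leb_I. y t + c * (z t - y t) = prim (\<lambda>t. p t + c * (q t - p t)) t"
    using ae by eventually_elim (simp add: e)
qed

lemma differentiable_on_real:
  "(\<And>t. t \<in> S \<Longrightarrow> (f has_real_derivative f' t) (at t within S)) \<Longrightarrow> f differentiable_on S"
  unfolding differentiable_on_def real_differentiable_def by blast

lemma cderiv_eqI:
  assumes "(v has_real_derivative d) (at t within {-1..1})" "t \<in> {-1..1}"
  shows "cderiv v t = d"
  unfolding cderiv_def using assms
  by (intro vector_derivative_within_cbox[of "-1" 1, unfolded cbox_interval])
    (auto simp: has_real_derivative_iff_has_vector_derivative)

lemma cderiv_works:
  assumes "v differentiable_on {-1..1}" "t \<in> {-1..1}"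
  shows "(v has_real_derivative cderiv v t) (at t within {-1..1})"
proof -
  have "v differentiable (at t within {-1..1})" using assms by (auto simp: differentiable_on_def)
  then obtain d where "(v has_real_derivative d) (at t within {-1..1})"
    by (auto simp: real_differentiable_def)
  then show ?thesis using cderiv_eqI[OF _ assms(2)] by metis
qed

lemma cderiv_prim:
  assumes p: "continuous_on {-1..1} p" and t: "t \<in> {-1..1}"
  shows "(prim p has_real_derivative p t) (at t within {-1..1})" "cderiv (prim p) t = p t"
proof -
  have "((\<lambda>x. integral {-1..x} p) has_real_derivative p t) (at t within {-1..1})"
    by (rule integral_has_real_derivative[OF p t])
  then show "(prim p has_real_derivative p t) (at t within {-1..1})"
    by (rule has_field_derivative_transform_within[OF _ zero_less_one t])
      (auto intro!: integral_unique prim_has_integral L2_continuous[OF p])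
  then show "cderiv (prim p) t = p t" by (rule cderiv_eqI[OF _ t])
qed

context mesh
begin

lemma V_segment:
  assumes v: "v \<in> V n x" and w: "w \<in> V n x"
  shows "(\<lambda>t. v t + c * (w t - v t)) \<in> V n x"
    and "t \<in> {-1..1} \<Longrightarrow> cderiv (\<lambda>t. v t + c * (w t - v t)) t = cderiv v t + c * (cderiv w t - cderiv v t)"
proof -
  let ?u = "\<lambda>t. v t + c * (w t - v t)"
  have d: "v differentiable_on {-1..1}" "w differentiable_on {-1..1}"
    and cont: "continuous_on {-1..1} (cderiv v)" "continuous_on {-1..1} (cderiv w)"
    using v w by (auto simp: V_def)
  have D: "(?u has_real_derivative cderiv v t + c * (cderiv w t - cderiv v t)) (at t within {-1..1})"
    if "t \<in> {-1..1}" for t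
    using cderiv_works[OF d(1) that] cderiv_works[OF d(2) that] by (auto intro!: derivative_intros DERIV_cmult)
  then show e: "t \<in> {-1..1} \<Longrightarrow> cderiv ?u t = cderiv v t + c * (cderiv w t - cderiv v t)" for t
    by (intro cderiv_eqI)
  show "?u \<in> V n x" unfolding V_def
  proof (intro CollectI conjI allI impI)
    show "?u differentiable_on {-1..1}"
      by (rule differentiable_on_real[OF D])
    have "continuous_on {-1..1} (\<lambda>t. cderiv v t + c * (cderiv w t - cderiv v t))"
      using cont by (intro continuous_intros)
    then show "continuous_on {-1..1} (cderiv ?u)" by (rule continuous_on_eq) (simp add: e)
    fix i assume "i < n"
    then obtain p q where p: "degree p \<le> 3" "\<forall>t\<in>{x i..x (Suc i)}. v t = poly p t"
      and q: "degree q \<le> 3" "\<forall>t\<in>{x i..x (Suc i)}. w t = poly q t"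
      using v w unfolding V_def by blast
    show "\<exists>p. degree p \<le> 3 \<and> (\<forall>t\<in>{x i..x (Suc i)}. ?u t = poly p t)"
      using p q by (intro exI[of _ "p + smult c (q - p)"])
        (auto intro!: degree_add_le degree_diff_le order_trans[OF degree_smult_le])
  qed (use v w in \<open>auto simp: V_def\<close>)
qed

text \<open>The classical derivative of a finite element function is differentiable off the nodes, which makes it a slope.\<close>
lemma ac_deriv_V:
  assumes v: "v \<in> V n x"
  obtains s where "ac_deriv (cderiv v) s" "prim (cderiv v) 1 = 0" "\<And>t. t \<in> {-1..1} \<Longrightarrow> v t = prim (cderiv v) t"
proof -
  have d: "v differentiable_on {-1..1}" and cont: "continuous_on {-1..1} (cderiv v)"
    and b: "v (-1) = 0" "v 1 = 0"
    using v by (auto simp: V_def)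
  have "\<forall>i<n. \<exists>p. degree p \<le> 3 \<and> (\<forall>t\<in>{x i..x (Suc i)}. v t = poly p t)"
    using v by (auto simp: V_def)
  then obtain q where q: "\<And>i t. i < n \<Longrightarrow> t \<in> {x i..x (Suc i)} \<Longrightarrow> v t = poly (q i) t" by metis
  have D: "(v has_real_derivative cderiv v t) (at t)" if "t \<in> {-1<..<1}" for t
    using cderiv_works[OF d, of t] that at_within_interior[of t "{-1..1}"] by auto
  have vd: "ac_deriv v (cderiv v)"
    by (rule ac_deriv_classical[of "{}"])
      (use D d cont in \<open>auto intro: differentiable_imp_continuous_on L2_continuous\<close>)
  have e: "v t = prim (cderiv v) t" if "t \<in> {-1..1}" for t using ac_deriv_eq[OF vd that] b by simp
  define s where "s = pw (\<lambda>i. poly (pderiv (pderiv (q i))))"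
  have "ac_deriv (cderiv v) s"
  proof (rule ac_deriv_classical[OF _ cont])
    show "finite (x ` {..n})" by simp
    show "s \<in> L2" unfolding s_def by (intro L2_pw L2_continuous continuous_on_poly continuous_on_id)
    fix t assume t: "t \<in> {-1<..<1} - x ` {..n}"
    obtain i where i: "i < n" "t \<in> cell i" using cell_exists[of t] t by auto
    then have "t \<noteq> x i" using t by auto
    then have ti: "t \<in> {x i<..<x (Suc i)}" using i by (auto simp: cell_def)
    have sub: "u \<in> {-1<..<1}" if "u \<in> {x i<..<x (Suc i)}" for u
      using that x_bounds[of i] x_bounds[of "Suc i"] i by auto
    have c: "cderiv v u = poly (pderiv (q i)) u" if u: "u \<in> {x i<..<x (Suc i)}" for u
    proof (rule DERIV_unique)
      show "(v has_real_derivative cderiv v u) (at u)" by (rule D[OF sub[OF u]])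
      show "(v has_real_derivative poly (pderiv (q i)) u) (at u)"
        by (rule has_field_derivative_transform_within_open[OF poly_DERIV _ u]) (use q i in auto)
    qed
    have "(cderiv v has_real_derivative poly (pderiv (pderiv (q i))) t) (at t)"
      by (rule has_field_derivative_transform_within_open[OF poly_DERIV _ ti]) (use c in auto)
    then show "(cderiv v has_real_derivative s t) (at t)" using pw_eq[OF i] by (simp add: s_def)
  qed
  moreover have "prim (cderiv v) 1 = 0" using e[of 1] b by simp
  ultimately show ?thesis using that e by blast
qed

lemma V_has_slope:
  assumes "v \<in> V n x" obtains s where "has_slope v (cderiv v) s"
proof -
  obtain s where s: "ac_deriv (cderiv v) s" "prim (cderiv v) 1 = 0" "\<And>t. t \<in> {-1..1} \<Longrightarrow> v t = prim (cderiv v) t"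
    using ac_deriv_V[OF assms] by blast
  have "AE t in leb_I. v t = prim (cderiv v) t" by (rule AE_I2) (use s(3) in auto)
  then show ?thesis using that s unfolding has_slope_def by blast
qed

text \<open>On each cell the two integrations raise the degree from one to three; the outer primitive is continuously
  differentiable because the inner one is continuous.\<close>
lemma V_intro:
  assumes p: "p = (\<lambda>t. c + prim (pw (\<lambda>i t. a i + b i * (t - m i))) t)" and mean: "prim p 1 = 0"
  shows "prim p \<in> V n x" "t \<in> {-1..1} \<Longrightarrow> cderiv (prim p) t = p t"
proof -
  define s where "s = pw (\<lambda>i t. a i + b i * (t - m i))"
  have s: "s \<in> L2" unfolding s_def by (intro L2_pw L2_affine)
  have cp: "continuous_on {-1..1} p" unfolding p s_def[symmetric] by (intro continuous_intros prim_continuous s)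
  show e: "t \<in> {-1..1} \<Longrightarrow> cderiv (prim p) t = p t" for t by (rule cderiv_prim(2)[OF cp])
  show "prim p \<in> V n x" unfolding V_def
  proof (intro CollectI conjI allI impI)
    show "prim p differentiable_on {-1..1}"
      by (rule differentiable_on_real[OF cderiv_prim(1)[OF cp]])
    show "continuous_on {-1..1} (cderiv (prim p))" using cp by (rule continuous_on_eq) (simp add: e)
    fix i assume i: "i < n"
    define q where "q = [:p (x i) - (a i - b i * m i) * x i - b i / 2 * (x i)\<^sup>2, a i - b i * m i, b i / 2:]"
    define Q where "Q = [:0, p (x i) - (a i - b i * m i) * x i - b i / 2 * (x i)\<^sup>2, (a i - b i * m i) / 2, b i / 6:]"
    have F: "ac_deriv (\<lambda>t. (a i - b i * m i) * t + b i / 2 * t\<^sup>2) (\<lambda>t. a i + b i * (t - m i))"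
      by (rule ac_deriv_classical[of "{}"])
        (auto intro!: continuous_intros derivative_eq_intros L2_continuous simp: algebra_simps)
    have pq: "p t = poly q t" if t: "t \<in> {x i..x (Suc i)}" for t
      unfolding p using prim_pw_cell[where q="\<lambda>i t. a i + b i * (t - m i)", OF L2_affine i t F] by (simp add: p q_def algebra_simps power2_eq_square)
    have Q: "ac_deriv (poly Q) (poly q)"
    proof (rule ac_deriv_classical[of "{}"])
      have "pderiv Q = q" by (simp add: Q_def q_def pderiv_pCons)
      then show "(poly Q has_real_derivative poly q t) (at t)" for t using poly_DERIV[of Q t] by simp
    qed (auto intro!: L2_continuous continuous_on_poly continuous_on_id)
    have pp: "ac_deriv (prim p) p" by (rule ac_deriv_prim[OF L2_continuous[OF cp]])
    have "prim p t = poly (Q + [:prim p (x i) - poly Q (x i):]) t" if t: "t \<in> {x i..x (Suc i)}" for t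
    proof -
      have b: "-1 \<le> x i" "t \<le> 1" "x i \<le> t" using x_bounds[of i] x_bounds[of "Suc i"] i t by auto
      have "prim p t - prim p (x i) = (LINT u|leb_I. indicat_real {x i..<t} u * p u)"
        by (rule ac_deriv_diff_eq[OF pp b(1,3,2)])
      also have "\<dots> = (LINT u|leb_I. indicat_real {x i..<t} u * poly q u)"
        by (rule Bochner_Integration.integral_cong) (use pq t in \<open>auto simp: indicator_def\<close>)
      also have "\<dots> = poly Q t - poly Q (x i)"
        by (rule ac_deriv_diff_eq[OF Q b(1,3,2), symmetric])
      finally show ?thesis by simp
    qed
    moreover have "degree (Q + [:prim p (x i) - poly Q (x i):]) \<le> 3"
      by (rule degree_add_le) (auto simp: Q_def)
    ultimately show "\<exists>q. degree q \<le> 3 \<and> (\<forall>t\<in>{x i..x (Suc i)}. prim p t = poly q t)" by blast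
  qed (use mean in auto)
qed

lemma P1_interp: "is_P1_interpolant n x \<zeta> (P1_interp n x \<zeta>)"
proof -
  define c where "c i = (\<zeta> (x (Suc i)) - \<zeta> (x i)) / (x (Suc i) - x i)" for i
  define s where "s = pw (\<lambda>i t. c i)"
  define g where "g t = \<zeta> (x 0) + prim s t" for t
  have s: "s \<in> L2" unfolding s_def by (intro L2_pw L2_const)
  have cell: "g t = \<zeta> (x 0) + (prim s (x i) - c i * x i) + c i * t" if "i < n" "t \<in> {x i..x (Suc i)}" for i t
    using prim_pw_const_cell[OF that, of c] by (simp add: g_def s_def)
  have "is_P1_interpolant n x \<zeta> g" unfolding is_P1_interpolant_def
  proof (intro conjI allI impI)
    show "continuous_on {-1..1} g" unfolding g_def[abs_def] by (intro continuous_intros prim_continuous s)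
    show "\<exists>a b. \<forall>t\<in>{x i..x (Suc i)}. g t = a + b * t" if "i < n" for i
      using cell[OF that] by blast
    show "g (x i) = \<zeta> (x i)" if "i \<le> n" for i
      using that
    proof (induction i)
      case 0 then show ?case by (simp add: g_def x_0)
    next
      case (Suc i)
      then have "g (x (Suc i)) = g (x i) + c i * (x (Suc i) - x i)"
        using cell[of i "x i"] cell[of i "x (Suc i)"] x_Suc[of i] by (simp add: algebra_simps)
      then show ?case using Suc x_Suc[of i] by (simp add: c_def)
    qed
  qed
  then show ?thesis unfolding P1_interp_def by (rule someI[where P="is_P1_interpolant n x \<zeta>"])
qed

text \<open>Both interpolants are affine on each cell and continuous, so comparing them on the open interval is the same as comparing
  their nodal values, including those at \<open>-1\<close> and \<open>1\<close>.\<close>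
lemma K_discrete_iff:
  "v \<in> K_discrete n x \<psi> \<longleftrightarrow> v \<in> V n x \<and> (\<forall>i\<le>n. cderiv v (x i) \<le> \<psi> (x i))"
proof -
  define g k where "g = P1_interp n x (cderiv v)" and "k = P1_interp n x \<psi>"
  have g: "is_P1_interpolant n x (cderiv v) g" and k: "is_P1_interpolant n x \<psi> k"
    unfolding g_def k_def by (rule P1_interp)+
  have "(\<forall>t\<in>{-1<..<1}. g t \<le> k t) \<longleftrightarrow> (\<forall>i\<le>n. cderiv v (x i) \<le> \<psi> (x i))"
  proof
    assume le: "\<forall>t\<in>{-1<..<1}. g t \<le> k t"
    show "\<forall>i\<le>n. cderiv v (x i) \<le> \<psi> (x i)"
    proof (intro allI impI)
      fix i assume i: "i \<le> n"
      have "0 \<le> k (x i) - g (x i)"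
      proof (rule continuous_AE_nonneg[where F="\<lambda>t. k t - g t"])
        show "continuous_on {-1..1} (\<lambda>t. k t - g t)"
          using g k by (intro continuous_intros) (auto simp: is_P1_interpolant_def)
        show "AE t in leb_I. 0 \<le> k t - g t" by (rule AE_I2) (use le in auto)
      qed (use x_bounds[OF i] in auto)
      then show "cderiv v (x i) \<le> \<psi> (x i)" using g k i by (auto simp: is_P1_interpolant_def)
    qed
  next
    assume nodes: "\<forall>i\<le>n. cderiv v (x i) \<le> \<psi> (x i)"
    show "\<forall>t\<in>{-1<..<1}. g t \<le> k t"
    proof
      fix t :: real assume t: "t \<in> {-1<..<1}"
      obtain i where i: "i < n" "t \<in> {x i..x (Suc i)}" using closed_cell_exists[of t] t by auto
      obtain a b where ab: "\<forall>t\<in>{x i..x (Suc i)}. g t = a + b * t" using g i(1) unfolding is_P1_interpolant_def by blast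
      obtain a' b' where ab': "\<forall>t\<in>{x i..x (Suc i)}. k t = a' + b' * t" using k i(1) unfolding is_P1_interpolant_def by blast
      have node: "0 \<le> k (x j) - g (x j)" if "j \<le> n" for j
        using g k nodes that by (auto simp: is_P1_interpolant_def)
      have e: "k u - g u = (a' - a) + (b' - b) * u" if "u \<in> {x i..x (Suc i)}" for u
        using ab ab' that by (auto simp: algebra_simps)
      have "0 \<le> (a' - a) + (b' - b) * t"
      proof (rule affine_nonneg)
        show "0 \<le> (a' - a) + (b' - b) * x i" "0 \<le> (a' - a) + (b' - b) * x (Suc i)"
          using node[of i] node[of "Suc i"] e[of "x i"] e[of "x (Suc i)"] i(1) x_Suc[OF i(1)] by auto
      qed (use i in auto)
      then show "g t \<le> k t" using e[OF i(2)] by simp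
    qed
  qed
  then show ?thesis by (auto simp: K_discrete_def g_def k_def)
qed

lemma K_discrete_segment:
  assumes v: "v \<in> K_discrete n x \<psi>" and w: "w \<in> K_discrete n x \<psi>" and c: "0 \<le> c" "c \<le> 1"
  shows "(\<lambda>t. v t + c * (w t - v t)) \<in> K_discrete n x \<psi>"
  unfolding K_discrete_iff
proof (intro conjI allI impI)
  have VV: "v \<in> V n x" "w \<in> V n x" using v w by (auto simp: K_discrete_iff)
  show "(\<lambda>t. v t + c * (w t - v t)) \<in> V n x" by (rule V_segment(1)[OF VV])
  fix i assume i: "i \<le> n"
  have "cderiv (\<lambda>t. v t + c * (w t - v t)) (x i) = (1 - c) * cderiv v (x i) + c * cderiv w (x i)"
    using V_segment(2)[OF VV, of "x i" c] x_bounds[OF i] by (simp add: algebra_simps)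
  also have "\<dots> \<le> (1 - c) * \<psi> (x i) + c * \<psi> (x i)"
    using v w i c by (intro add_mono mult_left_mono) (auto simp: K_discrete_iff)
  finally show "cderiv (\<lambda>t. v t + c * (w t - v t)) (x i) \<le> \<psi> (x i)" by (simp add: algebra_simps)
qed

end

section \<open>The error estimate\<close>

lemma has_slope_seminorm:
  assumes y: "has_slope y p r" and z: "has_slope z q s"
  shows "H1_seminorm (\<lambda>t. y t - z t) = L2_norm (\<lambda>t. p t - q t)"
proof (rule H1_seminorm_eq)
  have p: "ac_deriv p r" "AE t in leb_I. y t = prim p t" and q: "ac_deriv q s" "AE t in leb_I. z t = prim q t"
    using y z unfolding has_slope_def by blast+
  note L = ac_deriv_L2_fun[OF p(1)] ac_deriv_L2_fun[OF q(1)]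
  have "has_weak_deriv (\<lambda>t. prim p t - prim q t) (\<lambda>t. p t - q t)"
    by (intro ac_deriv_imp_weak_deriv ac_deriv_diff ac_deriv_prim L)
  then show "has_weak_deriv (\<lambda>t. y t - z t) (\<lambda>t. p t - q t)"
    by (rule has_weak_deriv_cong_AE) (use p(2) q(2) in \<open>eventually_elim, simp\<close>, simp)
qed

text \<open>The mean of \<open>q\<close> differs from \<open>q (-1)\<close> by the mean of \<open>prim s\<close>, so \<open>q (-1)\<close> is controlled by \<open>s\<close>.\<close>
lemma Poincare_mean_zero:
  assumes q: "ac_deriv q s" and mean: "(LINT t|leb_I. q t) = 0"
  shows "L2_norm q \<le> 4 * L2_norm s"
proof -
  note L = ac_deriv_L2[OF q]
  have e: "q t = q (-1) + prim s t" if "t \<in> {-1..1}" for t by (rule ac_deriv_eq[OF q that])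
  have "(LINT t|leb_I. q t) = (LINT t|leb_I. q (-1) + prim s t)"
    by (rule Bochner_Integration.integral_cong[OF refl], rule e) simp
  also have "\<dots> = 2 * q (-1) + (LINT t|leb_I. prim s t)"
    using L2_integrable[OF prim_L2[OF L]] by simp
  finally have "2 * \<bar>q (-1)\<bar> = \<bar>LINT t|leb_I. prim s t\<bar>" using mean by linarith
  also have "\<dots> \<le> sqrt 2 * L2_norm (prim s)"
    by (rule order_trans[OF abs_integral_le integral_abs_le_L2_norm[OF prim_L2[OF L]]])
  also have "\<dots> \<le> sqrt 2 * (2 * L2_norm s)" by (intro mult_left_mono prim_norm L) auto
  finally have c: "sqrt 2 * \<bar>q (-1)\<bar> \<le> sqrt 2 * (sqrt 2 * L2_norm s)" by simp
  have "L2_norm q = L2_norm (\<lambda>t. q (-1) + prim s t)"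
    by (rule L2_norm_cong_AE[OF ac_deriv_L2_fun[OF q]], rule AE_I2, rule e) simp
  also have "\<dots> \<le> L2_norm (\<lambda>t. q (-1)) + L2_norm (prim s)"
    by (intro L2_norm_triangle L2_const prim_L2 L)
  also have "\<dots> \<le> 2 * L2_norm s + 2 * L2_norm s"
    using c prim_norm[OF L] by (intro add_mono) (simp_all flip: mult.assoc)
  finally show ?thesis by simp
qed

text \<open>Solves a quadratic inequality for the error: if \<open>k < E\<close> the term with \<open>k\<^sup>2\<close> is absorbed into the mixed one.\<close>
lemma quadratic_bound:
  fixes \<beta> A B E k :: real
  assumes "0 < \<beta>" "0 \<le> A" "0 \<le> B" "0 < k" "0 \<le> E" "\<beta> * E\<^sup>2 \<le> A * k\<^sup>2 + B * k * E"
  shows "E \<le> (1 + (A + B) / \<beta>) * k"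
proof (rule ccontr)
  assume neg: "\<not> E \<le> (1 + (A + B) / \<beta>) * k"
  have "1 * k \<le> (1 + (A + B) / \<beta>) * k" using assms by (intro mult_right_mono) auto
  then have kE: "k < E" using neg by linarith
  have "A * k\<^sup>2 \<le> A * (k * E)" using assms kE by (intro mult_left_mono) (auto simp: power2_eq_square)
  then have "\<beta> * E\<^sup>2 \<le> (A + B) * k * E" using assms(6) by (simp add: algebra_simps)
  then have "(\<beta> * E) * E \<le> ((A + B) * k) * E" by (simp add: power2_eq_square algebra_simps)
  then have "\<beta> * E \<le> (A + B) * k" using kE assms by (simp add: mult_le_cancel_right)
  then have "E \<le> (A + B) / \<beta> * k" using assms by (simp add: field_simps)
  also have "\<dots> \<le> (1 + (A + B) / \<beta>) * k" using assms by (intro mult_right_mono) auto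
  finally show False using neg by simp
qed

locale optimal_slope_mesh = optimal_slope \<beta> y\<^sub>d f f' \<psi> \<psi>' \<psi>'' p r + mesh n x
  for \<beta> :: real and y\<^sub>d f f' \<psi> \<psi>' \<psi>'' p r :: "real \<Rightarrow> real" and n :: nat and x :: "nat \<Rightarrow> real"
begin

text \<open>Let \<open>N\<close> be the piecewise linear interpolant of \<open>q = gap - \<rho>\<close>. It is nonnegative, hence so is the multiplier at \<open>N\<close>. As the
  multiplier vanishes on the gap, its value at \<open>\<rho>\<close> is minus that at \<open>q\<close>, and so at most minus that at \<open>q - N\<close>. The function \<open>q - N\<close> vanishes at the
  end points and its derivative is orthogonal to piecewise constants, so only the corresponding part of the
  stress matters.\<close>
lemma multiplier_le_nodal:
  assumes \<rho>: "ac_deriv \<rho> \<rho>'" and nodes: "\<And>i. i \<le> n \<Longrightarrow> \<rho> (x i) \<le> gap (x i)"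
  shows "multiplier \<rho> \<rho>' \<le> L2_norm (\<lambda>t. stress t - proj0 stress t) *
    (L2_norm (\<lambda>t. gap' t - proj0 gap' t) + L2_norm \<rho>')"
proof -
  define q where "q = (\<lambda>t. gap t - \<rho> t)"
  define v where "v = (\<lambda>t. gap' t - \<rho>' t)"
  have q: "ac_deriv q v" unfolding q_def v_def by (intro ac_deriv_diff gap \<rho>)
  note L = ac_deriv_L2[OF gap] ac_deriv_L2[OF \<rho>] ac_deriv_L2[OF q]
    ac_deriv_L2_fun[OF gap] ac_deriv_L2_fun[OF \<rho>] ac_deriv_L2_fun[OF q]
  define N where "N = (\<lambda>t. q (-1) + prim (proj0 v) t)"
  have N: "ac_deriv N (\<lambda>t. 0 + proj0 v t)"
    unfolding N_def by (intro ac_deriv_add ac_deriv_const ac_deriv_prim L2_proj0)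
  then have N': "ac_deriv N (proj0 v)" by simp
  have "0 \<le> multiplier N (proj0 v)"
  proof (rule multiplier_nonneg[OF N'])
    fix t :: real assume t: "t \<in> {-1..1}"
    show "0 \<le> N t" unfolding N_def
      by (rule nodal_interpolant_nonneg[OF q _ t]) (use nodes in \<open>simp add: q_def\<close>)
  qed
  have D: "ac_deriv (\<lambda>t. q t - N t) (\<lambda>t. v t - proj0 v t)" by (rule ac_deriv_diff[OF q N'])
  have "q 1 - N 1 = 0"
    using ac_deriv_eq[OF q, of 1] prim_proj0_nodes[OF L(3), of n] x_n by (simp add: N_def)
  then have "multiplier (\<lambda>t. q t - N t) (\<lambda>t. v t - proj0 v t) = - (LINT t|leb_I. stress t * (v t - proj0 v t))"
    by (rule multiplier_eq_stress[OF D])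
  moreover have "multiplier (\<lambda>t. q t - N t) (\<lambda>t. v t - proj0 v t) = multiplier q v - multiplier N (proj0 v)"
    by (intro multiplier_diff L ac_deriv_L2[OF N'] ac_deriv_L2_fun[OF N'])
  moreover have "multiplier q v = - multiplier \<rho> \<rho>'"
    unfolding q_def v_def using multiplier_diff[OF L(4,1,5,2)] multiplier_gap by simp
  ultimately have "multiplier \<rho> \<rho>' \<le> (LINT t|leb_I. stress t * (v t - proj0 v t))"
    using \<open>0 \<le> multiplier N (proj0 v)\<close> by linarith
  also have "\<dots> = (LINT t|leb_I. (stress t - proj0 stress t) * (v t - proj0 v t))"
    by (rule integral_mult_proj0_error[OF L2_stress L(3)])
  also have "\<dots> \<le> L2_norm (\<lambda>t. stress t - proj0 stress t) * L2_norm (\<lambda>t. v t - proj0 v t)"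
    using Cauchy_Schwarz_L2[OF L2_diff[OF L2_stress L2_proj0] L2_diff[OF L(3) L2_proj0]] by (simp add: abs_le_iff)
  also have "\<dots> \<le> L2_norm (\<lambda>t. stress t - proj0 stress t) *
    (L2_norm (\<lambda>t. gap' t - proj0 gap' t) + L2_norm \<rho>')"
  proof (rule mult_left_mono)
    have "(\<lambda>t. v t - proj0 v t) = (\<lambda>t. (gap' t - proj0 gap' t) + - (\<rho>' t - proj0 \<rho>' t))"
      unfolding v_def using proj0_diff[OF L(1,2)] by auto
    then have "L2_norm (\<lambda>t. v t - proj0 v t)
      \<le> L2_norm (\<lambda>t. gap' t - proj0 gap' t) + L2_norm (\<lambda>t. - (\<rho>' t - proj0 \<rho>' t))"
      using L2_norm_triangle[OF L2_diff[OF L(1) L2_proj0] L2_minus[OF L2_diff[OF L(2) L2_proj0]]] by simp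
    also have "L2_norm (\<lambda>t. - (\<rho>' t - proj0 \<rho>' t)) = L2_norm (\<lambda>t. \<rho>' t - proj0 \<rho>' t)" by (rule L2_norm_minus)
    finally show "L2_norm (\<lambda>t. v t - proj0 v t) \<le> L2_norm (\<lambda>t. gap' t - proj0 gap' t) + L2_norm \<rho>'"
      using proj0_error_le[OF L(2)] by linarith
  qed simp
  finally show ?thesis .
qed

text \<open>The slope of the Hermite interpolant of the optimal state.\<close>
definition interp_slope :: "real \<Rightarrow> real" where
  "interp_slope t = p (-1) + prim (proj1 r) t"

lemma interp_slope: "ac_deriv interp_slope (proj1 r)"
proof -
  have "ac_deriv interp_slope (\<lambda>t. 0 + proj1 r t)"
    unfolding interp_slope_def[abs_def] by (intro ac_deriv_add ac_deriv_const ac_deriv_prim L2_proj1)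
  then show ?thesis by simp
qed

lemma interp_slope_nodes: "i \<le> n \<Longrightarrow> interp_slope (x i) = p (x i)"
  using ac_deriv_eq[OF p, of "x i"] x_bounds[of i] prim_proj1_nodes[OF L2s(5), of i] by (simp add: interp_slope_def)

lemma interp_slope_mean: "prim interp_slope 1 = 0"
proof -
  have "(LINT t|leb_I. p t) = (LINT t|leb_I. p (-1) + prim r t)"
    by (rule Bochner_Integration.integral_cong[OF refl], rule ac_deriv_eq[OF p]) simp
  then have "(LINT t|leb_I. p (-1) + prim r t) = 0" using p_mean by simp
  then show ?thesis
    using integral_prim_proj1[OF L2s(5)] L2_integrable[OF prim_L2[OF L2s(5)]] L2_integrable[OF prim_L2[OF L2_proj1[of r]]]
    by (simp add: interp_slope_def)
qed

lemma interp_has_slope: "has_slope (prim interp_slope) interp_slope (proj1 r)"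
  by (rule has_slope_prim(1)[OF interp_slope interp_slope_mean])

lemma interp_in_K_discrete: "prim interp_slope \<in> K_discrete n x \<psi>"
proof -
  have e: "interp_slope = (\<lambda>t. p (-1) + prim (pw (\<lambda>i t. cell_mean r i + cell_slope r i * (t - cell_mid i))) t)"
    by (rule ext) (simp add: interp_slope_def proj1_def)
  show ?thesis unfolding K_discrete_iff
    using V_intro[OF e interp_slope_mean] x_bounds interp_slope_nodes p_le by auto
qed

text \<open>Both variational inequalities are tested with the difference between the discrete slope and the slope of the Hermite
  interpolant, and subtracted. What remains besides the squared error is the interpolation error, paired with the
  error, and the multiplier at that difference, to which \<open>multiplier_le_nodal\<close> applies.\<close>
lemma discrete_error:
  assumes osc: "local_osc r k" "local_osc gap' l"
    and v: "v \<in> K_discrete n x \<psi>" "has_slope v (cderiv v) s"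
    and opt: "\<And>w q u. w \<in> K_discrete n x \<psi> \<Longrightarrow> has_slope w q u \<Longrightarrow> slope_cost \<beta> y\<^sub>d f (cderiv v) s \<le> slope_cost \<beta> y\<^sub>d f q u"
  defines "m \<equiv> \<lambda>t. \<beta> / 2 * \<bar>load' t\<bar>"
  shows "L2_norm (\<lambda>t. r t - s t) \<le> (1 + ((4 * (L2_norm k)\<^sup>2 + L2_norm m * (L2_norm l + L2_norm k))
    + (\<beta> * L2_norm k + L2_norm m)) / \<beta>) * h"
proof -
  define a where "a = cderiv v"
  have a: "ac_deriv a s" "prim a 1 = 0" using v(2) by (auto simp: has_slope_def a_def)
  define g where "g = interp_slope"
  define g' where "g' = proj1 r"
  have g: "ac_deriv g g'" "prim g 1 = 0" using interp_slope interp_slope_mean by (auto simp: g_def g'_def)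
  note L = ac_deriv_L2_fun[OF a(1)] ac_deriv_L2[OF a(1)] ac_deriv_L2_fun[OF g(1)] ac_deriv_L2[OF g(1)] L2s(4,5)
  define e where "e = (\<lambda>t. r t - s t)"
  define \<eta> where "\<eta> = (\<lambda>t. r t - g' t)"
  define Y where "Y = prim (\<lambda>t. p t - a t)"
  define Z where "Z = prim (\<lambda>t. p t - g t)"
  have Le: "e \<in> L2" and L\<eta>: "\<eta> \<in> L2" and LY: "Y \<in> L2" and LZ: "Z \<in> L2"
    unfolding e_def \<eta>_def Y_def Z_def by (intro prim_L2 L2_diff L)+
  have vi_h: "0 \<le> (LINT t|leb_I. (prim a t - y\<^sub>d t) * prim (\<lambda>t. g t - a t) t) + \<beta> * (LINT t|leb_I. (s t + f t) * (g' t - s t))"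
  proof (rule slope_cost_variational[OF L(1,2) L2_diff[OF L(3,1)] L2_diff[OF L(4,2)] y\<^sub>d L2s(1)])
    fix c :: real assume c: "0 < c" "c \<le> 1"
    show "slope_cost \<beta> y\<^sub>d f a s \<le> slope_cost \<beta> y\<^sub>d f (\<lambda>t. a t + c * (g t - a t)) (\<lambda>t. s t + c * (g' t - s t))"
      unfolding a_def g_def g'_def
      by (rule opt[OF K_discrete_segment[OF v(1) interp_in_K_discrete] has_slope_segment[OF v(2) interp_has_slope]])
        (use c in auto)
  qed
  have D: "ac_deriv (\<lambda>t. a t - g t) (\<lambda>t. s t - g' t)" by (rule ac_deriv_diff[OF a(1) g(1)])
  have D': "ac_deriv (\<lambda>t. g t - a t) (\<lambda>t. g' t - s t)" by (rule ac_deriv_diff[OF g(1) a(1)])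
  have mean: "(LINT t|leb_I. g t - a t) = 0" "(LINT t|leb_I. a t - g t) = 0" using L a(2) g(2) by (simp_all add: L2_integrable)
  have mult: "multiplier (\<lambda>t. a t - g t) (\<lambda>t. s t - g' t) =
     (LINT t|leb_I. (prim p t - y\<^sub>d t) * prim (\<lambda>t. g t - a t) t) + \<beta> * (LINT t|leb_I. (r t + f t) * (g' t - s t))"
    using grad_eq[OF D' mean(1)] grad_cmult[of "-1" "\<lambda>t. g t - a t" "\<lambda>t. g' t - s t"] mean(2)
    by (simp add: multiplier_def)
  have "(LINT t|leb_I. Y t * (Y t - Z t)) + \<beta> * (LINT t|leb_I. e t * (e t - \<eta> t))
    = ((LINT t|leb_I. (prim p t - y\<^sub>d t) * prim (\<lambda>t. g t - a t) t) + \<beta> * (LINT t|leb_I. (r t + f t) * (g' t - s t)))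
     - ((LINT t|leb_I. (prim a t - y\<^sub>d t) * prim (\<lambda>t. g t - a t) t) + \<beta> * (LINT t|leb_I. (s t + f t) * (g' t - s t)))"
  proof -
    have YZ: "Y t - Z t = prim (\<lambda>t. g t - a t) t" "Y t = (prim p t - y\<^sub>d t) - (prim a t - y\<^sub>d t)" for t
      using L by (simp_all add: Y_def Z_def prim_diff)
    have ee: "e t - \<eta> t = g' t - s t" "e t = (r t + f t) - (s t + f t)" for t by (simp_all add: e_def \<eta>_def)
    have LG: "prim (\<lambda>t. g t - a t) \<in> L2" "(\<lambda>t. g' t - s t) \<in> L2" "(\<lambda>t. prim p t - y\<^sub>d t) \<in> L2"
      "(\<lambda>t. prim a t - y\<^sub>d t) \<in> L2" "(\<lambda>t. r t + f t) \<in> L2" "(\<lambda>t. s t + f t) \<in> L2"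
      using L y\<^sub>d L2s by (auto intro!: L2_diff L2_add prim_L2)
    have 1: "(LINT t|leb_I. Y t * (Y t - Z t)) = (LINT t|leb_I. (prim p t - y\<^sub>d t) * prim (\<lambda>t. g t - a t) t)
      - (LINT t|leb_I. (prim a t - y\<^sub>d t) * prim (\<lambda>t. g t - a t) t)"
      unfolding YZ(1) unfolding YZ(2) left_diff_distrib[of "prim p _ - y\<^sub>d _"]
      by (intro Bochner_Integration.integral_diff L2_mult_integrable LG)
    have 2: "(LINT t|leb_I. e t * (e t - \<eta> t)) = (LINT t|leb_I. (r t + f t) * (g' t - s t))
      - (LINT t|leb_I. (s t + f t) * (g' t - s t))"
      unfolding ee(1) unfolding ee(2) left_diff_distrib[of "r _ + f _"]
      by (intro Bochner_Integration.integral_diff L2_mult_integrable LG)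
    show ?thesis unfolding 1 2 by (simp add: right_diff_distrib)
  qed
  also have "\<dots> \<le> multiplier (\<lambda>t. a t - g t) (\<lambda>t. s t - g' t)" using vi_h unfolding mult by linarith
  also have "\<dots> \<le> L2_norm (\<lambda>t. stress t - proj0 stress t) *
    (L2_norm (\<lambda>t. gap' t - proj0 gap' t) + L2_norm (\<lambda>t. s t - g' t))"
  proof (rule multiplier_le_nodal[OF D])
    fix i assume i: "i \<le> n"
    show "a (x i) - g (x i) \<le> gap (x i)"
      using v(1) i interp_slope_nodes[OF i] by (simp add: K_discrete_iff a_def g_def gap_def)
  qed
  also have "\<dots> \<le> (h * L2_norm m) * (h * L2_norm l + (L2_norm e + L2_norm \<eta>))"
  proof (intro mult_mono add_mono)
    show "L2_norm (\<lambda>t. stress t - proj0 stress t) \<le> h * L2_norm m"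
      unfolding m_def by (rule proj0_error_bound[OF local_osc_stress])
    show "L2_norm (\<lambda>t. gap' t - proj0 gap' t) \<le> h * L2_norm l"
      by (rule proj0_error_bound[OF osc(2)])
    have "(\<lambda>t. s t - g' t) = (\<lambda>t. - e t + \<eta> t)" by (auto simp: e_def \<eta>_def)
    then show "L2_norm (\<lambda>t. s t - g' t) \<le> L2_norm e + L2_norm \<eta>"
      using L2_norm_triangle[OF L2_minus[OF Le] L\<eta>] by simp
  qed (use h_pos in \<open>auto intro!: add_nonneg_nonneg\<close>)
  finally have main: "(LINT t|leb_I. Y t * (Y t - Z t)) + \<beta> * (LINT t|leb_I. e t * (e t - \<eta> t))
    \<le> (h * L2_norm m) * (h * L2_norm l + (L2_norm e + L2_norm \<eta>))" .
  have prod: "(L2_norm u)\<^sup>2 - L2_norm u * L2_norm w \<le> (LINT t|leb_I. u t * (u t - w t))" if "u \<in> L2" "w \<in> L2" for u w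
  proof -
    have "(LINT t|leb_I. u t * (u t - w t)) = (L2_norm u)\<^sup>2 - (LINT t|leb_I. u t * w t)"
      using L2_mult_integrable[OF that] L2_mult_integrable[OF that(1) that(1)]
        L2_norm_square[of u, unfolded power2_eq_square]
      by (simp add: right_diff_distrib power2_eq_square)
    then show ?thesis using Cauchy_Schwarz_L2[OF that] by linarith
  qed
  have \<eta>: "L2_norm \<eta> \<le> h * L2_norm k"
    using proj1_error_le_proj0_error[OF L2s(5)] proj0_error_bound[OF osc(1)] by (simp add: \<eta>_def g'_def)
  have Z: "L2_norm Z \<le> 4 * L2_norm \<eta>"
  proof -
    have "L2_norm Z \<le> 2 * L2_norm (\<lambda>t. p t - g t)" unfolding Z_def by (rule prim_norm[OF L2_diff[OF L(5,3)]])
    also have "L2_norm (\<lambda>t. p t - g t) = L2_norm (prim \<eta>)"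
    proof (rule L2_norm_cong_AE[OF L2_diff[OF L(5,3)]], rule AE_I2)
      fix t assume "t \<in> space leb_I"
      then show "p t - g t = prim \<eta> t"
        using ac_deriv_eq[OF p, of t] L by (simp add: g_def g'_def \<eta>_def interp_slope_def prim_diff L2_proj1)
    qed
    also have "2 * L2_norm (prim \<eta>) \<le> 2 * (2 * L2_norm \<eta>)" using prim_norm[OF L\<eta>] by simp
    finally show ?thesis by simp
  qed
  define E H T M N where "E = L2_norm e" and "H = L2_norm \<eta>" and "T = L2_norm k" and "M = L2_norm m" and "N = L2_norm l"
  have nn: "0 \<le> E" "0 \<le> H" "0 \<le> T" "0 \<le> M" "0 \<le> N" by (simp_all add: E_def H_def T_def M_def N_def)
  \<comment> \<open>the error of the state itself is absorbed by the left hand side\<close>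
  have "L2_norm Y * L2_norm Z \<le> (L2_norm Y)\<^sup>2 + 4 * H\<^sup>2"
  proof -
    have "0 \<le> (L2_norm Y - 2 * H)\<^sup>2" by simp
    then have "4 * (L2_norm Y * H) \<le> (L2_norm Y)\<^sup>2 + 4 * H\<^sup>2" by (simp add: power2_diff power_mult_distrib)
    moreover have "L2_norm Y * L2_norm Z \<le> L2_norm Y * (4 * H)" using Z by (intro mult_left_mono) (auto simp: H_def)
    ultimately show ?thesis by simp
  qed
  moreover have "\<beta> * (E\<^sup>2 - E * H) \<le> \<beta> * (LINT t|leb_I. e t * (e t - \<eta> t))"
    using prod[OF Le L\<eta>] \<beta> by (intro mult_left_mono) (auto simp: E_def H_def)
  ultimately have "\<beta> * E\<^sup>2 \<le> 4 * H\<^sup>2 + \<beta> * (E * H) + (h * M) * (h * N + (E + H))"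
    using main prod[OF LY LZ] by (simp add: E_def H_def M_def N_def right_diff_distrib)
  also have "\<dots> \<le> 4 * (h * T)\<^sup>2 + \<beta> * (E * (h * T)) + (h * M) * (h * N + (E + h * T))"
    using \<eta> nn h_pos \<beta> by (intro add_mono mult_left_mono power_mono) (auto simp: H_def T_def)
  also have "\<dots> = (4 * T\<^sup>2 + M * (N + T)) * h\<^sup>2 + (\<beta> * T + M) * h * E"
    by (simp add: power2_eq_square algebra_simps)
  finally have "E \<le> (1 + ((4 * T\<^sup>2 + M * (N + T)) + (\<beta> * T + M)) / \<beta>) * h"
    using \<beta> nn h_pos by (intro quadratic_bound) (auto intro!: add_nonneg_nonneg mult_nonneg_nonneg)
  then show ?thesis by (simp add: E_def T_def M_def N_def e_def)
qed

end

lemma K_iff_slope: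
  assumes "has_slope y p r" "y \<in> Sobolev 2 \<inter> H10" "continuous_on {-1..1} \<psi>"
  shows "y \<in> K \<psi> \<longleftrightarrow> (\<forall>t\<in>{-1..1}. p t \<le> \<psi> t)"
proof
  have p: "ac_deriv p r" using assms(1) by (simp add: has_slope_def)
  have ae: "AE t in leb_I. weak_deriv y t = p t" by (rule has_slope_weak_deriv(2)[OF assms(1)])
  show "\<forall>t\<in>{-1..1}. p t \<le> \<psi> t" if "y \<in> K \<psi>"
  proof
    fix t :: real assume t: "t \<in> {-1..1}"
    have "AE t in leb_I. weak_deriv y t \<le> \<psi> t" using that by (simp add: K_def)
    with ae have "AE t in leb_I. 0 \<le> \<psi> t - p t" by eventually_elim simp
    then have "0 \<le> \<psi> t - p t"
      by (rule continuous_AE_nonneg[where F="\<lambda>t. \<psi> t - p t", OF continuous_on_diff[OF assms(3) ac_deriv_continuous[OF p]] _ t])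
    then show "p t \<le> \<psi> t" by simp
  qed
  show "y \<in> K \<psi>" if "\<forall>t\<in>{-1..1}. p t \<le> \<psi> t"
  proof -
    have "AE t in leb_I. p t \<le> \<psi> t" by (rule AE_I2) (use that in auto)
    with ae have "AE t in leb_I. weak_deriv y t \<le> \<psi> t" by eventually_elim simp
    then show ?thesis using assms(2) by (simp add: K_def)
  qed
qed

theorem theorem3p1:
  fixes \<beta> :: real and y\<^sub>d f \<psi> y :: "real \<Rightarrow> real"
  assumes "\<beta> > 0"
    and "y\<^sub>d \<in> L2"
    and "f \<in> Sobolev 1"
    and "\<psi> \<in> Sobolev 2"
    and "continuous_on {-1..1} \<psi>"
    and "(LINT x|leb_I. \<psi> x) > 0"
    and "is_arg_min (cost \<beta> y\<^sub>d f) (\<lambda>z. z \<in> K \<psi>) y"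
  shows "\<exists>C>0. \<forall>n x y\<^sub>h. grid n x \<longrightarrow>
           is_arg_min (cost \<beta> y\<^sub>d f) (\<lambda>z. z \<in> K_discrete n x \<psi>) y\<^sub>h \<longrightarrow>
           H1_seminorm (\<lambda>t. y t - y\<^sub>h t) + L2_norm (\<lambda>t. control f y t - control f y\<^sub>h t)
             \<le> C * mesh_size n x"
proof -
  have yK: "y \<in> K \<psi>" and ymin: "\<And>z. z \<in> K \<psi> \<Longrightarrow> cost \<beta> y\<^sub>d f y \<le> cost \<beta> y\<^sub>d f z"
    using assms(7) by (auto simp: is_arg_min_linorder)
  have yS: "y \<in> Sobolev 2 \<inter> H10" using yK by (simp add: K_def)
  obtain p r where y: "has_slope y p r" by (rule Sobolev_2_H10_has_slope[OF yS])
  obtain g g' where g: "ac_deriv g g'" "AE t in leb_I. f t = g t"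
    by (rule Sobolev_1_representative[OF assms(3)])
  have Lg: "g \<in> L2" by (rule ac_deriv_L2_fun[OF g(1)])
  note cost = cost_eq_slope_cost[OF _ assms(2) Lg g(2)]
  obtain \<psi>0 \<psi>' \<psi>'' where \<psi>0: "ac_deriv \<psi>0 \<psi>'" "ac_deriv \<psi>' \<psi>''" "AE t in leb_I. \<psi> t = \<psi>0 t"
    by (rule Sobolev_2_representative[OF assms(4)])
  have \<psi>: "ac_deriv \<psi> \<psi>'"
  proof (rule ac_deriv_cong[OF \<psi>0(1)])
    fix t :: real assume "t \<in> {-1..1}"
    then show "\<psi>0 t = \<psi> t"
      using continuous_AE_eq[OF assms(5) ac_deriv_continuous[OF \<psi>0(1)] \<psi>0(3)] by simp
  qed
  interpret optimal_slope \<beta> y\<^sub>d g g' \<psi> \<psi>' \<psi>'' p r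
  proof
    show "ac_deriv p r" "(LINT x|leb_I. p x) = 0" using y by (auto simp: has_slope_def)
    show "p t \<le> \<psi> t" if "t \<in> {-1..1}" for t using K_iff_slope[OF y yS assms(5)] yK that by blast
    fix q s assume q: "ac_deriv q s" "(LINT x|leb_I. q x) = 0" "\<And>x. x \<in> {-1..1} \<Longrightarrow> q x \<le> \<psi> x"
    then have q1: "prim q 1 = 0" by simp
    have "prim q \<in> K \<psi>"
      using K_iff_slope[OF has_slope_prim[OF q(1) q1] assms(5)] q(3) by blast
    then show "slope_cost \<beta> y\<^sub>d g p r \<le> slope_cost \<beta> y\<^sub>d g q s"
      using ymin[of "prim q"] cost[OF y] cost[OF has_slope_prim(1)[OF q(1) q1]] by simp
  qed (use assms g(1) \<psi> \<psi>0(2) in auto)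
  obtain k l where kl: "local_osc r k" "local_osc gap' l"
    using local_osc_second_derivative local_osc_gap' by blast
  define m where "m = (\<lambda>t. \<beta> / 2 * \<bar>load' t\<bar>)"
  define C where "C = 1 + ((4 * (L2_norm k)\<^sup>2 + L2_norm m * (L2_norm l + L2_norm k)) + (\<beta> * L2_norm k + L2_norm m)) / \<beta>"
  have C: "0 < C" unfolding C_def using assms(1)
    by (intro add_pos_nonneg divide_nonneg_pos add_nonneg_nonneg mult_nonneg_nonneg) auto
  \<comment> \<open>four times the error of the second derivative from the Poincare inequality, once from the control\<close>
  have bound: "H1_seminorm (\<lambda>t. y t - y\<^sub>h t) + L2_norm (\<lambda>t. control f y t - control f y\<^sub>h t) \<le> 5 * C * mesh_size n x"
    if grid: "grid n x" and yh: "is_arg_min (cost \<beta> y\<^sub>d f) (\<lambda>z. z \<in> K_discrete n x \<psi>) y\<^sub>h" for n x y\<^sub>h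
  proof -
    interpret optimal_slope_mesh \<beta> y\<^sub>d g g' \<psi> \<psi>' \<psi>'' p r n x
      by unfold_locales (rule grid)
    have yhK: "y\<^sub>h \<in> K_discrete n x \<psi>"
      and yhmin: "\<And>z. z \<in> K_discrete n x \<psi> \<Longrightarrow> cost \<beta> y\<^sub>d f y\<^sub>h \<le> cost \<beta> y\<^sub>d f z"
      using yh by (auto simp: is_arg_min_linorder)
    obtain s where s: "has_slope y\<^sub>h (cderiv y\<^sub>h) s"
      using V_has_slope yhK by (auto simp: K_discrete_iff)
    have e: "L2_norm (\<lambda>t. r t - s t) \<le> C * h"
      unfolding C_def m_def
    proof (rule discrete_error[OF kl yhK s])
      fix w q u assume w: "w \<in> K_discrete n x \<psi>" "has_slope w q u"
      show "slope_cost \<beta> y\<^sub>d g (cderiv y\<^sub>h) s \<le> slope_cost \<beta> y\<^sub>d g q u"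
        using yhmin[OF w(1)] cost[OF s] cost[OF w(2)] by simp
    qed
    have ac: "ac_deriv p r" "ac_deriv (cderiv y\<^sub>h) s" "(LINT t|leb_I. p t) = 0" "(LINT t|leb_I. cderiv y\<^sub>h t) = 0"
      using y s by (auto simp: has_slope_def)
    have "H1_seminorm (\<lambda>t. y t - y\<^sub>h t) = L2_norm (\<lambda>t. p t - cderiv y\<^sub>h t)" by (rule has_slope_seminorm[OF y s])
    also have "\<dots> \<le> 4 * L2_norm (\<lambda>t. r t - s t)"
      by (rule Poincare_mean_zero[OF ac_deriv_diff[OF ac(1,2)]])
        (use ac ac_deriv_L2_fun[OF ac(1)] ac_deriv_L2_fun[OF ac(2)] in \<open>simp add: L2_integrable\<close>)
    finally have 1: "H1_seminorm (\<lambda>t. y t - y\<^sub>h t) \<le> 4 * L2_norm (\<lambda>t. r t - s t)" .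
    have "L2_norm (\<lambda>t. r t - s t) = L2_norm (\<lambda>t. s t - r t)" by (rule L2_norm_minus_commute)
    also have "\<dots> = L2_norm (\<lambda>t. control f y t - control f y\<^sub>h t)"
      by (rule L2_norm_cong_AE[OF L2_diff[OF ac_deriv_L2[OF ac(2)] ac_deriv_L2[OF ac(1)]]])
        (use has_slope_weak_deriv(3)[OF y] has_slope_weak_deriv(3)[OF s] in \<open>eventually_elim, simp add: control_def\<close>)
    finally show ?thesis using 1 e by (simp add: h_def)
  qed
  show ?thesis
    by (intro exI[of _ "5 * C"] conjI allI impI bound) (use C in auto)
qed

end
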